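(* Let $p$ be a prime. For every integer $k\geq 1$, the fixed point space $\left(\mathcal{L}_{p^{k}}\right)^{\Delta_{k}}$ has $T\mathrm{GL}_{k}(\mathbb{F}_{p})^{\diamond}$ as a retract.
   Context: Decomposition spaces. A proper orthogonal decomposition of $\mathbb{C}^{n}$ is an unordered collection of nonzero, pairwise orthogonal, proper subspaces of $\mathbb{C}^{n}$ whose sum is $\mathbb{C}^{n}$. These form a poset under coarsening (there is a unique morphism $\lambda\to\mu$ exactly when $\lambda$ refines $\mu$), denoted $\mathcal{L}_{n}$. It is a category internal to topological spaces: $U(n)$ acts on the object set and on the morphism set, and each is topologized as the disjoint union of its $U(n)$-orbits. $\mathcal{L}_{n}$ also denotes the (geometric realization of the) nerve of this topological poset. For a closed subgroup $H\subseteq U(n)$, $(\mathcal{L}_{n})^{H}$ is the fixed point space of $H$; it is the nerve of the topological subposet of decompositions $\lambda$ stabilized by $H$ (elements of $H$ may permute the components of $\lambda$). $\Delta_{k}$ is the group $(\mathbb{Z}/p)^{k}\subset U(p^{k})$ acting on the standard basis of $\mathbb{C}^{p^{k}}$ by the regular representation. $T\mathrm{GL}_{k}(\mathbb{F}_{p})$ is the Tits building for $\mathrm{GL}_{k}(\mathbb{F}_{p})$: the (nerve of the) poset of proper, nontrivial subgroups of $\Delta_{k}$ ordered by inclusion. For a space $X$, $X^{\diamond}$ denotes the unreduced suspension of $X$; in particular $\emptyset^{\diamond}=S^{0}$. *)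

theory Defs
  imports "HOL-Analysis.Analysis" "HOL-Homology.Simplices" "HOL-Algebra.Product_Groups"
    "HOL-Algebra.Elementary_Groups" "HOL-Computational_Algebra.Primes"
begin

section \<open>Final topologies and quotient spaces\<close>

definition final_topology ::
    "'b set \<Rightarrow> 'i set \<Rightarrow> ('i \<Rightarrow> 'a topology) \<Rightarrow> ('i \<Rightarrow> 'a \<Rightarrow> 'b) \<Rightarrow> 'b topology" where
  "final_topology S I X f =
     topology (\<lambda>U. U \<subseteq> S \<and> (\<forall>i\<in>I. openin (X i) {x \<in> topspace (X i). f i x \<in> U}))"

lemma istopology_final_topology:
  "istopology (\<lambda>U. U \<subseteq> S \<and> (\<forall>i\<in>I. openin (X i) {x \<in> topspace (X i). f i x \<in> U}))"
  (is "istopology ?P")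
  unfolding istopology_def
proof (intro conjI allI impI ballI)
    fix A B assume AB: "?P A" "?P B"
    show "A \<inter> B \<subseteq> S"
      using AB by blast
    fix i assume i: "i \<in> I"
    have *: "{x \<in> topspace (X i). f i x \<in> A \<inter> B} =
          {x \<in> topspace (X i). f i x \<in> A} \<inter> {x \<in> topspace (X i). f i x \<in> B}"
      by blast
    have "openin (X i) {x \<in> topspace (X i). f i x \<in> A}" "openin (X i) {x \<in> topspace (X i). f i x \<in> B}"
      using AB i by blast+
    then show "openin (X i) {x \<in> topspace (X i). f i x \<in> A \<inter> B}"
      unfolding * by (rule openin_Int)
  next
    fix K assume K: "\<forall>A\<in>K. ?P A"
    show "\<Union>K \<subseteq> S"
      using K by blast
    fix i assume i: "i \<in> I"
    have "openin (X i) (\<Union>A\<in>K. {x \<in> topspace (X i). f i x \<in> A})"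
      by (rule openin_Union) (use K i in blast)
    moreover have "{x \<in> topspace (X i). f i x \<in> \<Union>K} =
        (\<Union>A\<in>K. {x \<in> topspace (X i). f i x \<in> A})"
      by blast
    ultimately show "openin (X i) {x \<in> topspace (X i). f i x \<in> \<Union>K}"
      by (simp only:)
  qed

lemma openin_final_topology:
  "openin (final_topology S I X f) U \<longleftrightarrow>
     U \<subseteq> S \<and> (\<forall>i\<in>I. openin (X i) {x \<in> topspace (X i). f i x \<in> U})"
  unfolding final_topology_def topology_inverse'[OF istopology_final_topology] by (rule refl)

lemma topspace_final_topology:
  assumes "\<And>i x. i \<in> I \<Longrightarrow> x \<in> topspace (X i) \<Longrightarrow> f i x \<in> S"
  shows "topspace (final_topology S I X f) = S"
proof (rule antisym)
  have "openin (final_topology S I X f) (topspace (final_topology S I X f))"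
    by (rule openin_topspace)
  then show "topspace (final_topology S I X f) \<subseteq> S"
    unfolding openin_final_topology by (rule conjunct1)
  have "openin (final_topology S I X f) S"
    unfolding openin_final_topology
  proof (intro conjI ballI)
    fix i assume "i \<in> I"
    then have "{x \<in> topspace (X i). f i x \<in> S} = topspace (X i)"
      using assms by blast
    then show "openin (X i) {x \<in> topspace (X i). f i x \<in> S}"
      by (simp only: openin_topspace)
  qed (rule subset_refl)
  then show "S \<subseteq> topspace (final_topology S I X f)"
    by (rule openin_subset)
qed

text \<open>The quotient of a space by the equivalence relation generated by \<open>R\<close>; its points are
  the equivalence classes.\<close>

definition quotient_space :: "'a topology \<Rightarrow> ('a \<times> 'a) set \<Rightarrow> 'a set topology" where
  "quotient_space X R =
     (let E = (R \<union> R\<inverse>)\<^sup>* in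
      final_topology ((\<lambda>x. E `` {x}) ` topspace X) {()} (\<lambda>_. X) (\<lambda>_ x. E `` {x}))"

text \<open>The disjoint union of two points and \<open>X \<times> [0,1]\<close>, modulo the identification of
  \<open>X \<times> {0}\<close> with the first and \<open>X \<times> {1}\<close> with the second point; the
  suspension of the empty space is therefore the discrete two-point space.\<close>

definition unreduced_suspension :: "'a topology \<Rightarrow> (bool + 'a \<times> real) topology" where
  "unreduced_suspension X =
     final_topology (range Inl \<union> Inr ` (topspace X \<times> {0<..<1})) {()}
       (\<lambda>_. prod_topology X (top_of_set {0..1}))
       (\<lambda>_ (x, t). if t = 0 then Inl False else if t = 1 then Inl True else Inr (x, t))"


section \<open>Topological posets, their nerves and realizations\<close>

record 'a top_poset =
  Objects :: "'a topology"
  Morphisms :: "('a \<times> 'a) topology"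

text \<open>The space of composable strings \<open>x 0 \<rightarrow> \<dots> \<rightarrow> x m\<close>, as the limit of the
  diagram \<open>Ob \<leftarrow> Mor \<rightarrow> Ob \<leftarrow> \<dots> \<rightarrow> Ob\<close>: the initial topology with respect to all
  vertices \<open>x i\<close> and all morphisms \<open>(x i, x (i + 1))\<close>.\<close>

definition nerve :: "'a top_poset \<Rightarrow> nat \<Rightarrow> (nat \<Rightarrow> 'a) topology" where
  "nerve P m =
     pullback_topology
       {x \<in> extensional {..m}. (\<forall>i\<le>m. x i \<in> topspace (Objects P)) \<and>
          (\<forall>i<m. (x i, x (Suc i)) \<in> topspace (Morphisms P))}
       (\<lambda>x. (x, \<lambda>i\<in>{..<m}. (x i, x (Suc i))))
       (prod_topology (product_topology (\<lambda>_. Objects P) {..m})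
                      (product_topology (\<lambda>_. Morphisms P) {..<m}))"

definition simplex_push :: "nat \<Rightarrow> (nat \<Rightarrow> nat) \<Rightarrow> (nat \<Rightarrow> real) \<Rightarrow> (nat \<Rightarrow> real)" where
  "simplex_push m \<theta> t = (\<lambda>j. \<Sum>i | i \<le> m \<and> \<theta> i = j. t i)"

text \<open>The identifications \<open>(\<theta>\<^sup>* x, t) \<sim> (x, \<theta>\<^sub>* t)\<close> for order-preserving
  \<open>\<theta> : {0,\<dots>,m} \<rightarrow> {0,\<dots>,l}\<close>.\<close>

definition realization_rel ::
    "'a top_poset \<Rightarrow> ((nat \<times> (nat \<Rightarrow> 'a) \<times> (nat \<Rightarrow> real)) \<times> (nat \<times> (nat \<Rightarrow> 'a) \<times> (nat \<Rightarrow> real))) set" where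
  "realization_rel P =
     {((m, restrict (x \<circ> \<theta>) {..m}, t), (l, x, simplex_push m \<theta> t)) | m l \<theta> x t.
        mono_on {..m} \<theta> \<and> \<theta> ` {..m} \<subseteq> {..l} \<and>
        x \<in> topspace (nerve P l) \<and> t \<in> standard_simplex m}"

definition realization ::
    "'a top_poset \<Rightarrow> (nat \<times> (nat \<Rightarrow> 'a) \<times> (nat \<Rightarrow> real)) set topology" where
  "realization P =
     quotient_space
       (sum_topology
          (\<lambda>m. prod_topology (nerve P m) (subtopology (powertop_real UNIV) (standard_simplex m)))
          UNIV)
       (realization_rel P)"

text \<open>The map on realizations induced by an automorphism \<open>f\<close> of a poset; since \<open>f\<close> is
  invertible, the image of an equivalence class is again a full equivalence class.\<close>

definition realization_map ::
    "('a \<Rightarrow> 'a) \<Rightarrow> (nat \<times> (nat \<Rightarrow> 'a) \<times> (nat \<Rightarrow> real)) set \<Rightarrow>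
     (nat \<times> (nat \<Rightarrow> 'a) \<times> (nat \<Rightarrow> real)) set" where
  "realization_map f c = (\<lambda>(m, x, t). (m, restrict (f \<circ> x) {..m}, t)) ` c"

definition fixed_point_space :: "'g set \<Rightarrow> ('g \<Rightarrow> 'a \<Rightarrow> 'a) \<Rightarrow> 'a topology \<Rightarrow> 'a topology" where
  "fixed_point_space H act X = subtopology X {c \<in> topspace X. \<forall>g\<in>H. act g c = c}"


section \<open>Proper orthogonal decompositions\<close>

definition hermitian_inner :: "complex^'n \<Rightarrow> complex^'n \<Rightarrow> complex" where
  "hermitian_inner v w = (\<Sum>i\<in>UNIV. v $ i * cnj (w $ i))"

definition conjugate_transpose :: "complex^'n^'n \<Rightarrow> complex^'n^'n" where
  "conjugate_transpose A = (\<chi> i j. cnj (A $ j $ i))"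

definition unitary_group :: "(complex^'n^'n) set" where
  "unitary_group =
     {A. A ** conjugate_transpose A = mat 1 \<and> conjugate_transpose A ** A = mat 1}"

definition proper_decomposition :: "(complex^'n) set set \<Rightarrow> bool" where
  "proper_decomposition \<Lambda> \<longleftrightarrow>
     (\<forall>V\<in>\<Lambda>. vec.subspace V \<and> V \<noteq> {0} \<and> V \<noteq> UNIV) \<and>
     pairwise (\<lambda>V W. \<forall>v\<in>V. \<forall>w\<in>W. hermitian_inner v w = 0) \<Lambda> \<and>
     vec.span (\<Union>\<Lambda>) = UNIV"

definition refines :: "(complex^'n) set set \<Rightarrow> (complex^'n) set set \<Rightarrow> bool" where
  "refines \<Lambda> M \<longleftrightarrow> (\<forall>V\<in>\<Lambda>. \<exists>W\<in>M. V \<subseteq> W)"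

definition decomposition_act ::
    "complex^'n^'n \<Rightarrow> (complex^'n) set set \<Rightarrow> (complex^'n) set set" where
  "decomposition_act A \<Lambda> = (\<lambda>V. (\<lambda>v. A *v v) ` V) ` \<Lambda>"

text \<open>The final topology with respect to all orbit maps \<open>g \<mapsto> g x\<close> is the disjoint
  union of the orbits, each with its topology as a homogeneous space of \<open>U(n)\<close>.\<close>

definition orbit_topology ::
    "'a set \<Rightarrow> (complex^'n^'n \<Rightarrow> 'a \<Rightarrow> 'a) \<Rightarrow> 'a topology" where
  "orbit_topology S act =
     final_topology S S (\<lambda>_. top_of_set unitary_group) (\<lambda>x g. act g x)"

definition decomposition_poset :: "(complex^'n) set set top_poset" where
  "decomposition_poset =
     \<lparr>Objects = orbit_topology {\<Lambda>. proper_decomposition \<Lambda>} decomposition_act,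
      Morphisms = orbit_topology
        {(\<Lambda>, M). proper_decomposition \<Lambda> \<and> proper_decomposition M \<and> refines \<Lambda> M}
        (\<lambda>g (\<Lambda>, M). (decomposition_act g \<Lambda>, decomposition_act g M))\<rparr>"

definition decomposition_fixed_points ::
    "(complex^'n^'n) set \<Rightarrow>
     (nat \<times> (nat \<Rightarrow> (complex^'n) set set) \<times> (nat \<Rightarrow> real)) set topology" where
  "decomposition_fixed_points H =
     fixed_point_space H (\<lambda>g. realization_map (decomposition_act g))
       (realization decomposition_poset)"


section \<open>The group \<open>\<Delta>\<^sub>k\<close> and the Tits building\<close>

definition elementary_abelian :: "nat \<Rightarrow> nat \<Rightarrow> (nat \<Rightarrow> int) monoid" where
  "elementary_abelian p k = product_group {..<k} (\<lambda>_. integer_mod_group p)"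

text \<open>The regular representation of \<open>G\<close>, where the \<open>j\<close>-th standard basis vector is
  labelled by \<open>b j \<in> G\<close>: the basis vector labelled \<open>h\<close> is sent to the one labelled \<open>g h\<close>.\<close>

definition regular_rep ::
    "('g, 'm) monoid_scheme \<Rightarrow> ('n \<Rightarrow> 'g) \<Rightarrow> 'g \<Rightarrow> complex^'n^'n" where
  "regular_rep G b g = (\<chi> i j. if b i = g \<otimes>\<^bsub>G\<^esub> b j then 1 else 0)"

definition Delta :: "nat \<Rightarrow> nat \<Rightarrow> ('n \<Rightarrow> nat \<Rightarrow> int) \<Rightarrow> (complex^'n^'n) set" where
  "Delta p k b = regular_rep (elementary_abelian p k) b ` carrier (elementary_abelian p k)"

definition proper_nontrivial_subgroups :: "('g, 'm) monoid_scheme \<Rightarrow> 'g set set" where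
  "proper_nontrivial_subgroups G = {K. subgroup K G \<and> K \<noteq> {\<one>\<^bsub>G\<^esub>} \<and> K \<noteq> carrier G}"

definition tits_poset :: "nat \<Rightarrow> nat \<Rightarrow> (nat \<Rightarrow> int) set top_poset" where
  "tits_poset p k =
     (let S = proper_nontrivial_subgroups (elementary_abelian p k) in
      \<lparr>Objects = discrete_topology S,
       Morphisms = discrete_topology {(K, L). K \<in> S \<and> L \<in> S \<and> K \<subseteq> L}\<rparr>)"

definition tits_building ::
    "nat \<Rightarrow> nat \<Rightarrow> (nat \<times> (nat \<Rightarrow> (nat \<Rightarrow> int) set) \<times> (nat \<Rightarrow> real)) set topology" where
  "tits_building p k = realization (tits_poset p k)"

end

theory Submission
  imports Defs
begin

text \<open>
  Write \<open>G\<close> for the group \<open>\<Delta>\<^sub>k\<close>. Points of a realization are described by the weights that their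
  barycentric coordinates put on the vertices. In this description the suspension of the Tits
  building consists of the probability distributions on the lattice of all subgroups of \<open>G\<close>, the
  trivial group and \<open>G\<close> included, whose support is a chain that does not contain both of these
  extremes: a chain of proper nontrivial subgroups is coned off once by the trivial group and once
  by \<open>G\<close> (\<open>suspension_homeomorphic_pole_weights\<close>).

  A \<open>G\<close>-invariant decomposition \<open>\<Lambda>\<close> determines two subgroups \<open>lower \<Lambda> \<subseteq> upper \<Lambda>\<close> of \<open>G\<close>. The upper one
  is generated by the stabilizers of the components. For the lower one, group the components into
  \<open>G\<close>-orbits; the orbits span \<open>G\<close>-invariant subspaces and hence partition the characters of \<open>G\<close>. The
  characters whose multiplication preserves every part form a group, and \<open>lower \<Lambda>\<close> is its
  annihilator in \<open>G\<close>. Coarsening a decomposition enlarges the upper and shrinks the lower group. The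
  lower group is trivial only if \<open>G\<close> permutes the components transitively; then the upper group is
  their common stabilizer, which is not \<open>G\<close> since the decomposition is proper. So the two groups are
  never the two extremes together, and a chain of invariant decompositions yields a chain of
  subgroups that does not contain both extremes. Sending a vertex \<open>\<Lambda>\<close> to the midpoint of \<open>lower \<Lambda>\<close>
  and \<open>upper \<Lambda>\<close> and extending affinely over simplices defines the map \<open>retract\<close> on the fixed points. It is
  continuous because both groups are locally constant on the space of invariant decompositions
  (\<open>closedin_invariant_level\<close>).

  In the other direction, subgroups \<open>K \<subseteq> L\<close> that are not the two extremes define the decomposition
  \<open>interval_decomposition K L\<close>: split functions on \<open>G\<close> into functions on the cosets of \<open>L\<close>, and
  each of these spaces into eigenspaces of \<open>K\<close>. Its lower and upper groups are \<open>K\<close> and \<open>L\<close>,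
  and it becomes coarser when the interval from \<open>K\<close> to \<open>L\<close> grows. Intervals of a chain, ordered by
  inclusion, form the edgewise subdivision of a simplex. In terms of weights, let \<open>Q\<close> be the quantile function
  on \<open>[0,1]\<close> of a distribution on a chain; for \<open>s\<close> uniformly distributed in \<open>[0,1/2]\<close> the intervals
  from \<open>Q (1/2 - s)\<close> to \<open>Q (1/2 + s)\<close> are nested, and averaging over both end points gives back the
  distribution. Distributing the weights on the corresponding interval decompositions is therefore
  a continuous section \<open>spread_class\<close> of \<open>retract\<close>.
\<close>

section \<open>Realizations of topological posets\<close>


lemma closedin_final_topology:
  assumes "\<And>i x. i \<in> I \<Longrightarrow> x \<in> topspace (X i) \<Longrightarrow> f i x \<in> S"
  shows "closedin (final_topology S I X f) C \<longleftrightarrow>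
           C \<subseteq> S \<and> (\<forall>i\<in>I. closedin (X i) {x \<in> topspace (X i). f i x \<in> C})"
proof -
  have "{x \<in> topspace (X i). f i x \<in> S - C} = topspace (X i) - {x \<in> topspace (X i). f i x \<in> C}"
    if "i \<in> I" for i
    using assms that by auto
  then show ?thesis
    by (auto simp: closedin_def topspace_final_topology[OF assms] openin_final_topology)
qed

lemma continuous_map_from_final_topology:
  assumes "\<And>i x. i \<in> I \<Longrightarrow> x \<in> topspace (X i) \<Longrightarrow> f i x \<in> S"
    and "g \<in> S \<rightarrow> topspace Y" and "\<And>i. i \<in> I \<Longrightarrow> continuous_map (X i) Y (\<lambda>x. g (f i x))"
  shows "continuous_map (final_topology S I X f) Y g"
proof -
  have top: "topspace (final_topology S I X f) = S"
    using assms(1) by (rule topspace_final_topology)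
  have "closedin (final_topology S I X f) {x \<in> S. g x \<in> C}" if C: "closedin Y C" for C
  proof -
    have "closedin (X i) {x \<in> topspace (X i). g (f i x) \<in> C}" if "i \<in> I" for i
      using assms(3)[OF that] C by (simp add: continuous_map_closedin)
    moreover have "{x \<in> topspace (X i). f i x \<in> {x \<in> S. g x \<in> C}} = {x \<in> topspace (X i). g (f i x) \<in> C}"
      if "i \<in> I" for i
      using assms(1) that by auto
    ultimately show ?thesis
      by (subst closedin_final_topology[OF assms(1)]) auto
  qed
  then show ?thesis using assms(2) by (simp add: continuous_map_closedin top)
qed

lemma continuous_map_into_final_topology:
  assumes "\<And>i x. i \<in> I \<Longrightarrow> x \<in> topspace (X i) \<Longrightarrow> f i x \<in> S" and "i \<in> I"
  shows "continuous_map (X i) (final_topology S I X f) (f i)"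
  unfolding continuous_map_closedin
proof (intro conjI allI impI)
  have "topspace (final_topology S I X f) = S"
    using assms(1) by (rule topspace_final_topology)
  then show "f i \<in> topspace (X i) \<rightarrow> topspace (final_topology S I X f)"
    using assms by auto
  fix C assume "closedin (final_topology S I X f) C"
  then have "C \<subseteq> S \<and> (\<forall>i\<in>I. closedin (X i) {x \<in> topspace (X i). f i x \<in> C})"
    using closedin_final_topology[where I = I and X = X and f = f and S = S and C = C] assms(1) by blast
  then show "closedin (X i) {x \<in> topspace (X i). f i x \<in> C}"
    using assms(2) by blast
qed

type_synonym 'a cell = "nat \<times> (nat \<Rightarrow> 'a) \<times> (nat \<Rightarrow> real)"

abbreviation objects :: "'a top_poset \<Rightarrow> 'a set" where
  "objects P \<equiv> topspace (Objects P)"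

abbreviation arrows :: "'a top_poset \<Rightarrow> ('a \<times> 'a) set" where
  "arrows P \<equiv> topspace (Morphisms P)"

abbreviation simplex_space :: "nat \<Rightarrow> (nat \<Rightarrow> real) topology" where
  "simplex_space m \<equiv> subtopology (powertop_real UNIV) (standard_simplex m)"

abbreviation cell_space :: "'a top_poset \<Rightarrow> 'a cell topology" where
  "cell_space P \<equiv> sum_topology (\<lambda>m. prod_topology (nerve P m) (simplex_space m)) UNIV"

definition cells :: "'a top_poset \<Rightarrow> 'a cell set" where
  "cells P = {(m, x, t). x \<in> topspace (nerve P m) \<and> t \<in> standard_simplex m}"

definition point :: "'a top_poset \<Rightarrow> 'a cell \<Rightarrow> 'a cell set" where
  "point P z = (realization_rel P \<union> (realization_rel P)\<inverse>)\<^sup>* `` {z}"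

text \<open>The affine extension to simplices of a function on vertices. Taking indicator functions yields the
  barycentric weights. Both are constant on the classes that are identified in the realization, and the weights
  separate these classes (\<open>class_weight_inject\<close>).\<close>

definition average :: "('a \<Rightarrow> real) \<Rightarrow> 'a cell \<Rightarrow> real" where
  "average F = (\<lambda>(m, x, t). \<Sum>i\<le>m. t i * F (x i))"

definition class_average :: "('a \<Rightarrow> real) \<Rightarrow> 'a cell set \<Rightarrow> real" where
  "class_average F c = average F (SOME z. z \<in> c)"

definition weight :: "'a cell \<Rightarrow> 'a \<Rightarrow> real" where
  "weight z v = average (\<lambda>u. of_bool (u = v)) z"

definition class_weight :: "'a cell set \<Rightarrow> 'a \<Rightarrow> real" where
  "class_weight c v = class_average (\<lambda>u. of_bool (u = v)) c"

text \<open>The points of the realization of the full subposet on \<open>A\<close>, seen in the realization of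
  \<open>P\<close>.\<close>

definition carried :: "'a top_poset \<Rightarrow> 'a set \<Rightarrow> 'a cell set set" where
  "carried P A = {c \<in> topspace (realization P). \<forall>v. v \<notin> A \<longrightarrow> class_weight c v = 0}"

lemma topspace_nerve:
  "topspace (nerve P m) =
     {x \<in> extensional {..m}. (\<forall>i\<le>m. x i \<in> objects P) \<and>
        (\<forall>i<m. (x i, x (Suc i)) \<in> arrows P)}"
  unfolding nerve_def topspace_pullback_topology
  by (auto simp: extensional_def)

lemma continuous_map_nerve_vertex:
  assumes "i \<le> m" shows "continuous_map (nerve P m) (Objects P) (\<lambda>x. x i)"
proof -
  have "continuous_map (nerve P m) (Objects P)
          ((\<lambda>y. fst y i) \<circ> (\<lambda>x. (x, \<lambda>i\<in>{..<m}. (x i, x (Suc i)))))"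
    unfolding nerve_def
    by (intro continuous_map_pullback
          continuous_map_compose[OF continuous_map_fst continuous_map_product_projection, unfolded o_def])
       (use assms in auto)
  then show ?thesis by (simp add: o_def)
qed

lemma realization_relI:
  assumes "mono_on {..m} \<theta>" "\<theta> ` {..m} \<subseteq> {..l}" "x \<in> topspace (nerve P l)" "t \<in> standard_simplex m"
    and "x' = restrict (x \<circ> \<theta>) {..m}" "t' = simplex_push m \<theta> t"
  shows "((m, x', t), (l, x, t')) \<in> realization_rel P"
  unfolding realization_rel_def assms(5,6) using assms(1-4)
  by (intro CollectI exI[of _ m] exI[of _ l] exI[of _ \<theta>] exI[of _ x] exI[of _ t] conjI) simp_all

text \<open>Both sides sum \<open>t i * F (x (\<theta> i))\<close>; pushing forward along
  \<open>\<theta>\<close> only groups the summands by the fibres of \<open>\<theta>\<close>.\<close>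

lemma average_invariant:
  assumes "(z, z') \<in> realization_rel P" shows "average F z = average F z'"
proof -
  obtain m l \<theta> x t where z: "z = (m, restrict (x \<circ> \<theta>) {..m}, t)" "z' = (l, x, simplex_push m \<theta> t)"
    and \<theta>: "\<theta> ` {..m} \<subseteq> {..l}"
    using assms by (auto simp: realization_rel_def)
  have "average F z' = (\<Sum>j\<le>l. \<Sum>i | i \<in> {..m} \<and> \<theta> i = j. t i * F (x (\<theta> i)))"
    by (auto simp: z average_def simplex_push_def sum_distrib_right intro!: sum.cong)
  also have "\<dots> = (\<Sum>i\<le>m. t i * F (x (\<theta> i)))"
    by (rule sum.group) (use \<theta> in auto)
  also have "\<dots> = average F z"
    by (simp add: z average_def)
  finally show ?thesis ..
qed

lemma point_eq_iff: "point P z = point P z' \<longleftrightarrow> (z, z') \<in> (realization_rel P \<union> (realization_rel P)\<inverse>)\<^sup>*"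
proof -
  let ?E = "(realization_rel P \<union> (realization_rel P)\<inverse>)\<^sup>*"
  have "sym (realization_rel P \<union> (realization_rel P)\<inverse>)" by (auto simp: sym_def)
  then have "sym ?E" by (rule sym_rtrancl)
  moreover have "refl ?E" by (rule refl_rtrancl)
  moreover have "trans ?E" by (rule trans_rtrancl)
  ultimately have "equiv UNIV ?E" by (intro equivI) auto
  then show ?thesis unfolding point_def by (simp add: eq_equiv_class_iff)
qed

lemma self_in_point: "z \<in> point P z" by (simp add: point_def)

lemma in_point_iff: "z' \<in> point P z \<longleftrightarrow> point P z' = point P z"
proof -
  have "z' \<in> point P z \<longleftrightarrow> point P z = point P z'"
    unfolding point_eq_iff by (simp add: point_def)
  also have "\<dots> \<longleftrightarrow> point P z' = point P z" by (rule eq_commute)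
  finally show ?thesis .
qed

lemma point_eq_if_rel: "(z, z') \<in> realization_rel P \<Longrightarrow> point P z = point P z'"
  unfolding point_eq_iff by (rule r_into_rtrancl) simp

lemma average_point:
  assumes "point P z = point P z'" shows "average F z = average F z'"
proof -
  have "(z, z') \<in> (realization_rel P \<union> (realization_rel P)\<inverse>)\<^sup>*" using assms by (simp add: point_eq_iff)
  then show ?thesis by induction (auto dest: average_invariant[of _ _ P F])
qed

lemma class_average_point [simp]: "class_average F (point P z) = average F z"
proof -
  have "(SOME z'. z' \<in> point P z) \<in> point P z" by (rule someI[where P = "\<lambda>z'. z' \<in> point P z", OF self_in_point])
  then show ?thesis unfolding class_average_def by (metis in_point_iff average_point)
qed

lemma class_weight_point [simp]: "class_weight (point P z) = weight z"
  by (rule ext) (simp add: class_weight_def weight_def)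

lemma realization_eq_final:
  "realization P = final_topology (point P ` cells P) {()}
     (\<lambda>_. cell_space P) (\<lambda>_. point P)"
  and topspace_sum_cells:
  "topspace (cell_space P) = cells P"
proof -
  show c: "topspace (cell_space P) = cells P"
    by (auto simp: cells_def topspace_standard_simplex)
  show "realization P = final_topology (point P ` cells P) {()}
     (\<lambda>_. cell_space P) (\<lambda>_. point P)"
    unfolding realization_def quotient_space_def c Let_def point_def[abs_def] by (rule refl)
qed

lemma topspace_realization: "topspace (realization P) = point P ` cells P"
  unfolding realization_eq_final
  by (rule topspace_final_topology) (simp only: topspace_sum_cells imageI)

lemma closedin_sum_topology:
  "closedin (sum_topology X I) C \<longleftrightarrow>
     C \<subseteq> Sigma I (topspace \<circ> X) \<and> (\<forall>i\<in>I. closedin (X i) {x. (i, x) \<in> C})"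
proof -
  have *: "C \<subseteq> Sigma I (topspace \<circ> X) \<Longrightarrow> i \<in> I \<Longrightarrow>
      {x. (i, x) \<in> Sigma I (topspace \<circ> X) - C} = topspace (X i) - {x. (i, x) \<in> C}" for i by auto
  show ?thesis
    unfolding closedin_def openin_sum_topology topspace_sum_topology
    by (auto simp: * Collect_conj_eq set_diff_eq)
qed

lemma closedin_realization:
  assumes "C \<subseteq> topspace (realization P)"
    and "\<And>m. closedin (prod_topology (nerve P m) (simplex_space m))
           {(x, t). (m, x, t) \<in> cells P \<and> point P (m, x, t) \<in> C}"
  shows "closedin (realization P) C"
proof -
  have "closedin (cell_space P) {z \<in> cells P. point P z \<in> C}"
    unfolding closedin_sum_topology topspace_sum_topology[symmetric] topspace_sum_cells
    using assms(2) by (auto simp: case_prod_unfold)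
  then show ?thesis
    unfolding realization_eq_final
    by (subst closedin_final_topology)
       (use assms(1) in \<open>auto simp: topspace_sum_cells topspace_realization simp del: topspace_sum_topology\<close>)
qed

lemma continuous_map_cell:
  assumes "y \<in> topspace (nerve P n)"
  shows "continuous_map (simplex_space n) (realization P)
           (\<lambda>t. point P (n, y, t))"
proof -
  let ?S = "cell_space P"
  have "continuous_map (simplex_space n)
     (prod_topology (nerve P n) (simplex_space n)) (\<lambda>t. (y, t))"
    by (intro continuous_map_pairedI) (use assms in auto)
  moreover have "continuous_map (prod_topology (nerve P n) (simplex_space n))
     ?S (Pair n)"
    using continuous_map_component_injection[of n UNIV "\<lambda>m. prod_topology (nerve P m)
             (simplex_space m)"] by simp
  moreover have "continuous_map ?S (realization P) (point P)"
    unfolding realization_eq_final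
    by (rule continuous_map_into_final_topology[where i = "()" and X = "\<lambda>_. ?S" and f = "\<lambda>_. point P"])
       (simp_all only: topspace_sum_cells imageI singletonI)
  ultimately have "continuous_map (simplex_space n) (realization P)
      (point P \<circ> (Pair n \<circ> (\<lambda>t. (y, t))))"
    by (intro continuous_map_compose)
  then show ?thesis by (simp add: o_def)
qed

lemma weight_eq_0_iff:
  assumes "(m, x, t) \<in> cells P"
  shows "weight (m, x, t) v = 0 \<longleftrightarrow> (\<forall>i\<le>m. x i = v \<longrightarrow> t i = 0)"
proof -
  have t: "0 \<le> t i" for i using assms by (simp add: cells_def standard_simplex_def)
  have "weight (m, x, t) v = (\<Sum>i\<le>m. t i * of_bool (x i = v))"
    by (simp add: weight_def average_def)
  also have "\<dots> = 0 \<longleftrightarrow> (\<forall>i\<in>{..m}. t i * of_bool (x i = v) = 0)"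
    by (rule sum_nonneg_eq_0_iff) (use t in auto)
  finally show ?thesis by auto
qed

lemma carried_point_iff:
  assumes "(m, x, t) \<in> cells P"
  shows "point P (m, x, t) \<in> carried P A \<longleftrightarrow> (\<forall>i\<le>m. t i = 0 \<or> x i \<in> A)"
  using assms weight_eq_0_iff[OF assms] by (auto simp: carried_def topspace_realization)

text \<open>This supplies the continuity of averages without any quotient map for subspaces. On the part of a
  cell space where the vertices of positive weight have prescribed levels of \<open>F\<close> and the other
  weights vanish, the average is a linear function of the weights. These parts are closed and finite in number
  because \<open>F\<close> has finitely many values.\<close>

lemma closedin_class_average:
  assumes V: "finite V" "F ` A \<subseteq> V" and A: "\<And>v. v \<in> V \<Longrightarrow> closedin (Objects P) {x \<in> A. F x = v}"
    and C: "closed C"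
  shows "closedin (realization P) {c \<in> carried P A. class_average F c \<in> C}"
proof (rule closedin_realization)
  show "{c \<in> carried P A. class_average F c \<in> C} \<subseteq> topspace (realization P)"
    by (auto simp: carried_def)
  fix m
  let ?X = "prod_topology (nerve P m) (simplex_space m)"
  \<comment> \<open>\<open>\<tau> i = None\<close> stands for weight zero at the \<open>i\<close>-th vertex, \<open>\<tau> i = Some v\<close> for a vertex of level \<open>v\<close>\<close>
  define val :: "real option \<Rightarrow> real" where "val = (\<lambda>o'. case o' of None \<Rightarrow> 0 | Some v \<Rightarrow> v)"
  define piece where "piece = (\<lambda>\<tau>. {z \<in> topspace ?X.
      (\<Sum>i\<le>m. snd z i * val (\<tau> i)) \<in> C} \<inter>
      (\<Inter>i\<in>{..m}. {z \<in> topspace ?X. fst z i \<in> {x. case \<tau> i of None \<Rightarrow> True | Some v \<Rightarrow> x \<in> A \<and> F x = v}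
           \<and> (\<tau> i = None \<longrightarrow> snd z i = 0)}))"
  have t: "continuous_map ?X euclideanreal (\<lambda>z. snd z i)" for i
    by (rule continuous_map_compose[OF continuous_map_snd, unfolded o_def])
       (auto intro!: continuous_map_from_subtopology continuous_map_product_projection)
  have x: "continuous_map ?X (Objects P) (\<lambda>z. fst z i)" if "i \<le> m" for i
    by (rule continuous_map_compose[OF continuous_map_fst, unfolded o_def])
       (rule continuous_map_nerve_vertex[OF that])
  have closed_piece: "closedin ?X (piece \<tau>)" if \<tau>: "\<tau> \<in> {..m} \<rightarrow> insert None (Some ` V)" for \<tau>
    unfolding piece_def
  proof (intro closedin_Int closedin_INT)
    show "closedin ?X {z \<in> topspace ?X. (\<Sum>i\<le>m. snd z i * val (\<tau> i)) \<in> C}"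
      by (rule closedin_continuous_map_preimage[of _ euclideanreal])
         (use C t in \<open>auto intro!: continuous_map_sum continuous_map_real_mult\<close>)
    fix i assume i: "i \<in> {..m}"
    show "closedin ?X {z \<in> topspace ?X. fst z i \<in> {x. case \<tau> i of None \<Rightarrow> True | Some v \<Rightarrow> x \<in> A \<and> F x = v}
           \<and> (\<tau> i = None \<longrightarrow> snd z i = 0)}"
    proof (cases "\<tau> i")
      case None
      have "closedin ?X {z \<in> topspace ?X. snd z i \<in> {0}}"
        by (rule closedin_continuous_map_preimage[OF t]) auto
      then show ?thesis using None by auto
    next
      case (Some v)
      have "\<tau> i \<in> insert None (Some ` V)" using \<tau> i by blast
      then have "v \<in> V" using Some by auto
      have "closedin ?X {z \<in> topspace ?X. fst z i \<in> {x \<in> A. F x = v}}"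
        by (rule closedin_continuous_map_preimage[OF x A]) (use i \<open>v \<in> V\<close> in auto)
      then show ?thesis using Some by auto
    qed
  qed auto
  have "{(x, t). (m, x, t) \<in> cells P \<and> point P (m, x, t) \<in> {c \<in> carried P A. class_average F c \<in> C}}
     = (\<Union>\<tau>\<in>{..m} \<rightarrow>\<^sub>E insert None (Some ` V). piece \<tau>)" (is "?L = ?R")
  proof (rule Set.set_eqI)
    fix z :: "(nat \<Rightarrow> 'a) \<times> (nat \<Rightarrow> real)"
    obtain x t where z: "z = (x, t)" by (cases z)
    have top: "z \<in> topspace ?X \<longleftrightarrow> (m, x, t) \<in> cells P"
      by (auto simp: z cells_def topspace_standard_simplex)
    have piece_iff: "z \<in> piece \<tau> \<longleftrightarrow> z \<in> topspace ?X \<and> (\<Sum>i\<le>m. t i * val (\<tau> i)) \<in> C \<and>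
        (\<forall>i\<le>m. case \<tau> i of None \<Rightarrow> t i = 0 | Some v \<Rightarrow> x i \<in> A \<and> F (x i) = v)" for \<tau>
      unfolding piece_def z by (auto split: option.splits)
    have "z \<in> ?L \<longleftrightarrow> z \<in> topspace ?X \<and> (\<forall>i\<le>m. t i = 0 \<or> x i \<in> A) \<and> (\<Sum>i\<le>m. t i * F (x i)) \<in> C"
      unfolding top using carried_point_iff[of m x t P A] by (auto simp: z average_def)
    also have "\<dots> \<longleftrightarrow> z \<in> ?R"
    proof (intro iffI)
      assume *: "z \<in> topspace ?X \<and> (\<forall>i\<le>m. t i = 0 \<or> x i \<in> A) \<and> (\<Sum>i\<le>m. t i * F (x i)) \<in> C"
      define \<tau> where "\<tau> = restrict (\<lambda>i. if t i = 0 then None else Some (F (x i))) {..m}"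
      have "(\<Sum>i\<le>m. t i * val (\<tau> i)) = (\<Sum>i\<le>m. t i * F (x i))"
        by (rule sum.cong) (auto simp: \<tau>_def val_def)
      with * have "z \<in> piece \<tau>" unfolding piece_iff by (auto simp: \<tau>_def)
      have \<tau>i: "\<tau> i \<in> insert None (Some ` V)" if "i \<le> m" for i
        using * that V(2) by (cases "t i = 0") (auto simp: \<tau>_def)
      have "\<tau> \<in> {..m} \<rightarrow>\<^sub>E insert None (Some ` V)"
        by (rule PiE_I) (use \<tau>i in simp, simp add: \<tau>_def)
      then show "z \<in> ?R" using \<open>z \<in> piece \<tau>\<close> by (rule UN_I[where B = piece])
    next
      assume "z \<in> ?R"
      then obtain \<tau> where *: "z \<in> piece \<tau>" by (rule UN_E)
      then have v: "case \<tau> i of None \<Rightarrow> t i = 0 | Some v \<Rightarrow> x i \<in> A \<and> F (x i) = v" if "i \<le> m" for i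
        using that by (simp add: piece_iff)
      have "t i * val (\<tau> i) = t i * F (x i)" "t i = 0 \<or> x i \<in> A" if "i \<le> m" for i
        using v[OF that] by (auto simp: val_def split: option.splits)
      then have "(\<Sum>i\<le>m. t i * val (\<tau> i)) = (\<Sum>i\<le>m. t i * F (x i))" "\<forall>i\<le>m. t i = 0 \<or> x i \<in> A"
        by (auto intro!: sum.cong)
      with * show "z \<in> topspace ?X \<and> (\<forall>i\<le>m. t i = 0 \<or> x i \<in> A) \<and> (\<Sum>i\<le>m. t i * F (x i)) \<in> C"
        by (simp add: piece_iff)
    qed
    finally show "z \<in> ?L \<longleftrightarrow> z \<in> ?R" .
  qed
  moreover have "closedin ?X ?R"
  proof (rule closedin_Union)
    show "finite (piece ` ({..m} \<rightarrow>\<^sub>E insert None (Some ` V)))"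
      using V(1) by (intro finite_imageI finite_PiE) auto
    fix S assume "S \<in> piece ` ({..m} \<rightarrow>\<^sub>E insert None (Some ` V))"
    then obtain \<tau> where "S = piece \<tau>" and \<tau>: "\<tau> \<in> {..m} \<rightarrow>\<^sub>E insert None (Some ` V)" by (rule imageE)
    moreover have "\<tau> \<in> {..m} \<rightarrow> insert None (Some ` V)" using \<tau> unfolding PiE_def by (rule IntD1)
    ultimately show "closedin ?X S" using closed_piece by simp
  qed
  ultimately show "closedin ?X {(x, t). (m, x, t) \<in> cells P \<and>
      point P (m, x, t) \<in> {c \<in> carried P A. class_average F c \<in> C}}" by (simp only:)
qed

lemma continuous_map_class_average:
  assumes "finite V" "F ` A \<subseteq> V" and "\<And>v. v \<in> V \<Longrightarrow> closedin (Objects P) {x \<in> A. F x = v}"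
  shows "continuous_map (subtopology (realization P) (carried P A)) euclideanreal (class_average F)"
  unfolding continuous_map_closedin
proof (intro conjI allI impI)
  fix C :: "real set" assume "closedin euclideanreal C"
  then have "closedin (realization P) {c \<in> carried P A. class_average F c \<in> C}"
    using closedin_class_average[OF assms, of C] by simp
  then have "closedin (subtopology (realization P) (carried P A))
     (carried P A \<inter> {c \<in> carried P A. class_average F c \<in> C})"
    by (rule closedin_subtopology_Int_closed)
  moreover have "carried P A \<inter> {c \<in> carried P A. class_average F c \<in> C}
     = {c \<in> topspace (subtopology (realization P) (carried P A)). class_average F c \<in> C}"
    by (auto simp: carried_def)
  ultimately show "closedin (subtopology (realization P) (carried P A))
     {c \<in> topspace (subtopology (realization P) (carried P A)). class_average F c \<in> C}"
    by (rule back_subst)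
qed simp

text \<open>A finite chain is listed in increasing order by splitting off a maximal element
  repeatedly.\<close>

lemma ex_chain_list:
  assumes "finite C" and "\<And>a b. a \<in> C \<Longrightarrow> b \<in> C \<Longrightarrow> r a b \<or> r b a"
    and "\<And>a b c. a \<in> C \<Longrightarrow> b \<in> C \<Longrightarrow> c \<in> C \<Longrightarrow> r a b \<Longrightarrow> r b c \<Longrightarrow> r a c"
  shows "\<exists>xs. set xs = C \<and> distinct xs \<and> sorted_wrt r xs"
  using assms
proof (induction "card C" arbitrary: C)
  case 0
  then have "C = {}" by (metis card_0_eq)
  then show ?case by (intro exI[of _ "[]"]) simp
next
  case (Suc n)
  then have "C \<noteq> {}" by (metis card.empty nat.distinct(1))
  have "\<exists>a\<in>C. \<forall>b\<in>C. r b a"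
    using \<open>finite C\<close> \<open>C \<noteq> {}\<close> Suc.prems(2,3)
  proof (induction C rule: finite_ne_induct)
    case (singleton x)
    then show ?case by blast
  next
    case (insert x F)
    have "\<exists>a\<in>F. \<forall>b\<in>F. r b a"
      by (rule insert.IH) (use insert.prems in blast)+
    then obtain a where a: "a \<in> F" "\<forall>b\<in>F. r b a" by blast
    show ?case
    proof (cases "r x a")
      case True then show ?thesis using a by blast
    next
      case False
      have "r a x" using False insert.prems(1)[of a x] a by blast
      moreover have "r x x" using insert.prems(1)[of x x] by blast
      moreover have "r b x" if "b \<in> F" for b
        by (rule insert.prems(2)[of b a x]) (use that a \<open>r a x\<close> in auto)
      ultimately show ?thesis by blast
    qed
  qed
  then obtain a where a: "a \<in> C" "\<forall>b\<in>C. r b a" by blast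
  have "n = card (C - {a})" using a Suc.hyps(2) by simp
  have "\<exists>xs. set xs = C - {a} \<and> distinct xs \<and> sorted_wrt r xs"
    by (rule Suc.hyps(1)) (use \<open>n = _\<close> Suc.prems in blast)+
  then obtain xs where xs: "set xs = C - {a}" "distinct xs" "sorted_wrt r xs" by blast
  have "set (xs @ [a]) = C" "distinct (xs @ [a])" using a xs by auto
  moreover have "sorted_wrt r (xs @ [a])" using a xs by (simp add: sorted_wrt_append)
  ultimately show ?case by blast
qed

text \<open>A topological category whose underlying category is a poset; \<open>arrows P\<close> is its order
  relation.\<close>

locale realized_poset =
  fixes P :: "'a top_poset"
  assumes morphism_objects: "(a, b) \<in> arrows P \<Longrightarrow> a \<in> objects P \<and> b \<in> objects P"
    and identity: "a \<in> objects P \<Longrightarrow> (a, a) \<in> arrows P"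
    and composition: "(a, b) \<in> arrows P \<Longrightarrow> (b, c) \<in> arrows P \<Longrightarrow> (a, c) \<in> arrows P"
    and antisymmetry: "(a, b) \<in> arrows P \<Longrightarrow> (b, a) \<in> arrows P \<Longrightarrow> a = b"
begin

lemma nerve_mono:
  assumes "x \<in> topspace (nerve P m)" "i \<le> j" "j \<le> m"
  shows "(x i, x j) \<in> arrows P"
  using assms(2,3)
proof (induction j)
  case 0 then show ?case using assms(1) identity by (auto simp: topspace_nerve)
next
  case (Suc j)
  show ?case
  proof (cases "i = Suc j")
    case True then show ?thesis using Suc assms(1) identity by (auto simp: topspace_nerve)
  next
    case False
    then have "(x i, x j) \<in> arrows P" using Suc by auto
    moreover have "(x j, x (Suc j)) \<in> arrows P"
      using Suc assms(1) by (auto simp: topspace_nerve)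
    ultimately show ?thesis by (rule composition)
  qed
qed

lemma nerveI:
  assumes "x \<in> extensional {..m}" "\<And>i. i \<le> m \<Longrightarrow> x i \<in> objects P"
    "\<And>i j. i \<le> j \<Longrightarrow> j \<le> m \<Longrightarrow> (x i, x j) \<in> arrows P"
  shows "x \<in> topspace (nerve P m)"
  unfolding topspace_nerve using assms(1,2) assms(3)[OF le_SucI[OF order_refl]] by simp

lemma rel_cells: "realization_rel P \<subseteq> cells P \<times> cells P"
proof
  fix p assume "p \<in> realization_rel P"
  then obtain m l \<theta> x t where p: "p = ((m, restrict (x \<circ> \<theta>) {..m}, t), (l, x, simplex_push m \<theta> t))"
    and \<theta>: "mono_on {..m} \<theta>" "\<theta> ` {..m} \<subseteq> {..l}" and x: "x \<in> topspace (nerve P l)"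
    and t: "t \<in> standard_simplex m"
    by (auto simp: realization_rel_def)
  have "restrict (x \<circ> \<theta>) {..m} \<in> topspace (nerve P m)"
  proof (rule nerveI)
    fix i j assume "i \<le> j" "j \<le> m"
    then have "(x (\<theta> i), x (\<theta> j)) \<in> arrows P"
      using \<theta> by (intro nerve_mono[OF x]) (auto simp: mono_on_def)
    then show "(restrict (x \<circ> \<theta>) {..m} i, restrict (x \<circ> \<theta>) {..m} j) \<in> arrows P"
      using \<open>i \<le> j\<close> \<open>j \<le> m\<close> by auto
  qed (use x \<theta> in \<open>auto simp: topspace_nerve\<close>)
  moreover have "simplex_push m \<theta> t \<in> standard_simplex l"
  proof -
    have t': "0 \<le> t i" "(\<Sum>i\<le>m. t i) = 1" for i using t by (auto simp: standard_simplex_def)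
    have *: "(\<Sum>j\<le>l. simplex_push m \<theta> t j) = 1"
    proof -
      have "(\<Sum>j\<le>l. \<Sum>i | i \<in> {..m} \<and> \<theta> i = j. t i) = (\<Sum>i\<le>m. t i)"
        by (rule sum.group) (use \<theta> in auto)
      then show ?thesis using t' by (simp add: simplex_push_def)
    qed
    moreover have n: "simplex_push m \<theta> t j \<ge> 0" for j
      unfolding simplex_push_def by (rule sum_nonneg) (use t' in auto)
    moreover have z: "simplex_push m \<theta> t j = 0" if "l < j" for j
    proof -
      have "{i. i \<le> m \<and> \<theta> i = j} = {}" using \<theta> that by force
      then show ?thesis unfolding simplex_push_def by (simp only: sum.empty)
    qed
    moreover have "simplex_push m \<theta> t j \<le> 1" for j
    proof (cases "j \<le> l")
      case True
      then have "simplex_push m \<theta> t j \<le> (\<Sum>j\<le>l. simplex_push m \<theta> t j)"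
        by (intro member_le_sum) (use n in auto)
      then show ?thesis using * by simp
    qed (simp add: z)
    ultimately show ?thesis by (simp add: standard_simplex_def)
  qed
  ultimately show "p \<in> cells P \<times> cells P" using x t by (auto simp: p cells_def)
qed

lemma point_subset_cells:
  assumes "z \<in> cells P" shows "point P z \<subseteq> cells P"
proof
  fix z' assume "z' \<in> point P z"
  then have "(z, z') \<in> (realization_rel P \<union> (realization_rel P)\<inverse>)\<^sup>*" by (simp add: point_def)
  then show "z' \<in> cells P" by induction (use assms rel_cells in auto)
qed

text \<open>Every cell is identified with the cell of any injective chain that covers its support. Two
  identifications suffice: a face map removes the vertices of weight zero, and a map of simplices into the given
  chain then merges repeated vertices.\<close>

lemma point_eq_normal_form:
  assumes z: "z \<in> cells P" and y: "y \<in> topspace (nerve P n)" "inj_on y {..n}"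
    and supp: "\<And>v. weight z v \<noteq> 0 \<Longrightarrow> v \<in> y ` {..n}"
  shows "point P z = point P (n, y, \<lambda>j. if j \<le> n then weight z (y j) else 0)"
proof -
  obtain m x t where z_eq: "z = (m, x, t)" by (cases z)
  have x: "x \<in> topspace (nerve P m)" and t: "t \<in> standard_simplex m"
    using z by (auto simp: z_eq cells_def)
  have t': "0 \<le> t i" "i > m \<Longrightarrow> t i = 0" "(\<Sum>i\<le>m. t i) = 1" for i
    using t by (auto simp: standard_simplex_def)
  define S where "S = {i. i \<le> m \<and> t i \<noteq> 0}"
  have "finite S" by (simp add: S_def)
  have "S \<noteq> {}"
  proof
    assume "S = {}"
    then have "(\<Sum>i\<le>m. t i) = 0" by (intro sum.neutral) (auto simp: S_def)
    then show False using t' by simp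
  qed
  \<comment> \<open>restrict to the face spanned by the vertices of positive weight\<close>
  obtain \<delta> where \<delta>: "bij_betw \<delta> {..<card S} S" "strict_mono_on {..<card S} \<delta>"
    by (rule ex_bij_betw_strict_mono_card[OF \<open>finite S\<close>])
  define q where "q = card S - 1"
  have "card S > 0" using \<open>finite S\<close> \<open>S \<noteq> {}\<close> by (simp add: card_gt_0_iff)
  then have q: "{..<card S} = {..q}" by (auto simp: q_def)
  note \<delta> = \<delta>[unfolded q]
  define s where "s = (\<lambda>j. if j \<le> q then t (\<delta> j) else 0)"
  have \<delta>S: "\<delta> i \<in> S" if "i \<le> q" for i using \<delta>(1) that by (auto simp: bij_betw_def)
  have "(\<Sum>i\<le>q. s i) = (\<Sum>i\<in>S. t i)"
    using sum.reindex_bij_betw[OF \<delta>(1), of t] by (simp add: s_def)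
  also have "\<dots> = (\<Sum>i\<le>m. t i)" by (rule sum.mono_neutral_left) (auto simp: S_def)
  finally have "(\<Sum>i\<le>q. s i) = 1" using t' by simp
  then have s: "s \<in> standard_simplex q"
    using t by (auto simp: standard_simplex_def s_def)
  have push: "simplex_push q \<delta> s = t"
  proof
    fix j
    show "simplex_push q \<delta> s j = t j"
    proof (cases "j \<in> S")
      case True
      then obtain i where i: "i \<le> q" "\<delta> i = j" using \<delta>(1) by (auto simp: bij_betw_def)
      then have "{i'. i' \<le> q \<and> \<delta> i' = j} = {i}" using \<delta>(1) by (auto simp: bij_betw_def inj_on_def)
      then have "simplex_push q \<delta> s j = s i" unfolding simplex_push_def by (simp only: sum.insert_remove sum.empty finite.emptyI) simp
      then show ?thesis using i by (simp add: s_def)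
    next
      case False
      then have "{i'. i' \<le> q \<and> \<delta> i' = j} = {}" using \<delta>S by auto
      then have "simplex_push q \<delta> s j = 0" unfolding simplex_push_def by (simp only: sum.empty)
      then show ?thesis using False t'(2)[of j] by (cases "j \<le> m") (auto simp: S_def)
    qed
  qed
  let ?z1 = "(q, restrict (x \<circ> \<delta>) {..q}, s)"
  have "mono_on {..q} \<delta>" using \<delta>(2) by (rule strict_mono_on_imp_mono_on)
  then have "(?z1, (m, x, t)) \<in> realization_rel P"
    by (rule realization_relI) (use \<delta>S x s push in \<open>auto simp: S_def\<close>)
  then have 1: "point P ?z1 = point P z" by (simp add: z_eq point_eq_if_rel)
  have "\<exists>j\<le>n. y j = x (\<delta> i)" if "i \<le> q" for i
  proof -
    have "\<delta> i \<in> S" using \<delta>S that by blast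
    then have "weight z (x (\<delta> i)) \<noteq> 0"
      using z weight_eq_0_iff[of m x t P] by (auto simp: z_eq S_def)
    from supp[OF this] show ?thesis by auto
  qed
  \<comment> \<open>then send each remaining vertex to its position in \<open>y\<close>\<close>
  then obtain \<theta> where \<theta>: "\<And>i. i \<le> q \<Longrightarrow> \<theta> i \<le> n \<and> y (\<theta> i) = x (\<delta> i)" by metis
  have "mono_on {..q} \<theta>"
  proof (rule mono_onI, rule ccontr)
    fix i j assume ij: "i \<in> {..q}" "j \<in> {..q}" "i \<le> j" "\<not> \<theta> i \<le> \<theta> j"
    then have "\<delta> i \<le> \<delta> j" "\<delta> j \<le> m" using \<open>mono_on {..q} \<delta>\<close> \<delta>S by (auto simp: mono_on_def S_def)
    then have "(x (\<delta> i), x (\<delta> j)) \<in> arrows P" using nerve_mono[OF x] by blast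
    then have "(y (\<theta> i), y (\<theta> j)) \<in> arrows P" using \<theta> ij by auto
    moreover have "(y (\<theta> j), y (\<theta> i)) \<in> arrows P"
      by (rule nerve_mono[OF y(1)]) (use ij \<theta> in auto)
    ultimately have "y (\<theta> i) = y (\<theta> j)" by (rule antisymmetry)
    then have "\<theta> i = \<theta> j" using y(2) \<theta> ij by (auto simp: inj_on_def)
    then show False using ij by simp
  qed
  moreover have "restrict (y \<circ> \<theta>) {..q} = restrict (x \<circ> \<delta>) {..q}" using \<theta> by auto
  ultimately have "(?z1, (n, y, simplex_push q \<theta> s)) \<in> realization_rel P"
    by (intro realization_relI) (use \<theta> y s in auto)
  then have 2: "point P ?z1 = point P (n, y, simplex_push q \<theta> s)" by (rule point_eq_if_rel)
  have "simplex_push q \<theta> s = (\<lambda>j. if j \<le> n then weight z (y j) else 0)"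
  proof
    fix j
    show "simplex_push q \<theta> s j = (if j \<le> n then weight z (y j) else 0)"
    proof (cases "j \<le> n")
      case True
      have "weight z (y j) = weight (n, y, simplex_push q \<theta> s) (y j)"
        using 1 2 unfolding weight_def by (metis average_point)
      also have "\<dots> = (\<Sum>i\<le>n. if i = j then simplex_push q \<theta> s i else 0)"
        unfolding weight_def average_def prod.case
        by (rule sum.cong) (use True y(2) in \<open>auto simp: inj_on_eq_iff\<close>)
      also have "\<dots> = simplex_push q \<theta> s j" using True by simp
      finally show ?thesis using True by simp
    next
      case False
      then have "{i. i \<le> q \<and> \<theta> i = j} = {}" using \<theta> by auto
      then have "simplex_push q \<theta> s j = 0" unfolding simplex_push_def by (simp only: sum.empty)
      then show ?thesis using False by simp
    qed
  qed
  then have "point P (n, y, simplex_push q \<theta> s) = point P (n, y, \<lambda>j. if j \<le> n then weight z (y j) else 0)"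
    by (rule arg_cong)
  then show ?thesis by (rule trans[OF trans[OF sym[OF 1] 2]])
qed

lemma chain_enumeration:
  assumes "finite C" "C \<noteq> {}" "C \<subseteq> objects P"
    and "\<And>a b. a \<in> C \<Longrightarrow> b \<in> C \<Longrightarrow> (a, b) \<in> arrows P \<or> (b, a) \<in> arrows P"
  obtains n y where "y \<in> topspace (nerve P n)" "bij_betw y {..n} C"
proof -
  obtain xs where xs: "set xs = C" "distinct xs" "sorted_wrt (\<lambda>a b. (a, b) \<in> arrows P) xs"
    using ex_chain_list[of C "\<lambda>a b. (a, b) \<in> arrows P"] assms composition by blast
  define n where "n = length xs - 1"
  have len: "length xs = Suc n" using xs assms(2) by (cases xs) (auto simp: n_def)
  define y where "y = restrict (\<lambda>i. xs ! i) {..n}"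
  have "y \<in> topspace (nerve P n)"
  proof (rule nerveI)
    fix i j assume "i \<le> j" "j \<le> n"
    then show "(y i, y j) \<in> arrows P"
    proof (cases "i = j")
      case True
      have "xs ! j \<in> objects P" using \<open>j \<le> n\<close> xs(1) assms(3) len nth_mem[of j xs] by auto
      then show ?thesis using True \<open>j \<le> n\<close> identity by (simp add: y_def)
    next
      case False then show ?thesis using \<open>j \<le> n\<close> \<open>i \<le> j\<close> xs(3) len by (auto simp: y_def sorted_wrt_iff_nth_less)
    qed
  qed (use xs assms(3) len in \<open>auto simp: y_def\<close>)
  moreover have "bij_betw y {..n} C"
    unfolding bij_betw_def
  proof
    show "inj_on y {..n}" using xs(2) len by (auto simp: y_def inj_on_def nth_eq_iff_index_eq)
    show "y ` {..n} = C" using xs(1) len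
      by (auto simp: y_def in_set_conv_nth less_Suc_eq_le image_iff)
  qed
  ultimately show thesis by (rule that)
qed

lemma normal_form_cell:
  assumes y: "y \<in> topspace (nerve P n)" "bij_betw y {..n} C"
    and W: "\<And>v. 0 \<le> W v" "\<And>v. W v \<noteq> 0 \<Longrightarrow> v \<in> C" "(\<Sum>v\<in>C. W v) = (1::real)"
  defines "z \<equiv> (n, y, \<lambda>j. if j \<le> n then W (y j) else 0)"
  shows "z \<in> cells P" and "weight z = W" and "average F z = (\<Sum>v\<in>C. W v * F v)"
proof -
  have "finite C" using y(2) bij_betw_finite by blast
  have s: "(\<Sum>j\<le>n. W (y j)) = 1" using sum.reindex_bij_betw[OF y(2), of W] W by simp
  have "W v \<le> 1" for v
  proof (cases "v \<in> C")
    case True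
    then have "W v \<le> (\<Sum>v\<in>C. W v)" using \<open>finite C\<close> W by (intro member_le_sum) auto
    then show ?thesis using W by simp
  next
    case False then show ?thesis using W(2)[of v] by fastforce
  qed
  then show "z \<in> cells P" using y W(1) s by (auto simp: z_def cells_def standard_simplex_def)
  show a: "average F z = (\<Sum>v\<in>C. W v * F v)" for F
    using sum.reindex_bij_betw[OF y(2), of "\<lambda>v. W v * F v"] by (simp add: z_def average_def)
  show "weight z = W"
  proof
    fix v
    have "weight z v = (\<Sum>u\<in>C. if u = v then W v else 0)"
      unfolding weight_def a by (rule sum.cong) auto
    then show "weight z v = W v" using \<open>finite C\<close> W(2)[of v] by auto
  qed
qed

text \<open>Both classes have a normal form over one enumeration of the common support.\<close>

lemma class_weight_inject:
  assumes "c \<in> topspace (realization P)" "c' \<in> topspace (realization P)"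
    "class_weight c = class_weight c'"
  shows "c = c'"
proof -
  obtain z z' where z: "z \<in> cells P" "c = point P z" and z': "z' \<in> cells P" "c' = point P z'"
    using assms by (auto simp: topspace_realization)
  obtain m x t where zx: "z = (m, x, t)" by (cases z)
  have x: "x \<in> topspace (nerve P m)" using z by (auto simp: zx cells_def)
  obtain n y where y: "y \<in> topspace (nerve P n)" "bij_betw y {..n} (x ` {..m})"
  proof (rule chain_enumeration)
    fix a b assume "a \<in> x ` {..m}" "b \<in> x ` {..m}"
    then obtain i j where ij: "a = x i" "b = x j" "i \<le> m" "j \<le> m" by auto
    then show "(a, b) \<in> arrows P \<or> (b, a) \<in> arrows P"
      using nerve_mono[OF x, of i j] nerve_mono[OF x, of j i] by (cases "i \<le> j") auto
  qed (use x in \<open>auto simp: topspace_nerve\<close>)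
  have w: "weight z = weight z'" using assms z z' by simp
  have s: "v \<in> y ` {..n}" if "weight z v \<noteq> 0" for v
    using that weight_eq_0_iff[of m x t P v] z(1) y(2) by (auto simp: zx bij_betw_def)
  have "point P z = point P (n, y, \<lambda>j. if j \<le> n then weight z (y j) else 0)"
    by (rule point_eq_normal_form[OF z(1) y(1) bij_betw_imp_inj_on[OF y(2)] s])
  moreover have "point P z' = point P (n, y, \<lambda>j. if j \<le> n then weight z' (y j) else 0)"
    by (rule point_eq_normal_form[OF z'(1) y(1) bij_betw_imp_inj_on[OF y(2)]]) (simp add: s w)
  ultimately show ?thesis unfolding z z' w by (rule trans[OF _ sym])
qed

end

section \<open>Edgewise subdivision of distributions on chains\<close>

definition chain_weights :: "'b set set \<Rightarrow> ('b set \<Rightarrow> real) set" where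
  "chain_weights S = {w. (\<forall>K. 0 \<le> w K) \<and> (\<forall>K. w K \<noteq> 0 \<longrightarrow> K \<in> S) \<and>
     (\<forall>K L. w K \<noteq> 0 \<longrightarrow> w L \<noteq> 0 \<longrightarrow> K \<subseteq> L \<or> L \<subseteq> K) \<and> (\<Sum>K\<in>S. w K) = 1}"

lemma chain_weights_D:
  assumes "w \<in> chain_weights S"
  shows "0 \<le> w K" "K \<notin> S \<Longrightarrow> w K = 0" "w K \<noteq> 0 \<Longrightarrow> K \<in> S"
    "w K \<noteq> 0 \<Longrightarrow> w L \<noteq> 0 \<Longrightarrow> K \<subseteq> L \<or> L \<subseteq> K" "(\<Sum>K\<in>S. w K) = 1"
  using assms unfolding chain_weights_def by blast+

text \<open>The numbers \<open>below S w K\<close> and \<open>below S w K + w K\<close> are the end points of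
  the subinterval of \<open>[0,1]\<close> on which the quantile function of \<open>w\<close> has the value
  \<open>K\<close>, for \<open>K\<close> in the support of \<open>w\<close>.\<close>

definition below :: "'b set set \<Rightarrow> ('b set \<Rightarrow> real) \<Rightarrow> 'b set \<Rightarrow> real" where
  "below S w K = (\<Sum>L\<in>{L \<in> S. L \<subset> K}. w L)"

text \<open>The length of the intersection of the intervals \<open>[a,b]\<close> and
  \<open>[c,d]\<close>.\<close>

definition overlap :: "real \<Rightarrow> real \<Rightarrow> real \<Rightarrow> real \<Rightarrow> real" where
  "overlap a b c d = max 0 (min b d - max a c)"

text \<open>With \<open>Q\<close> the quantile function of \<open>w\<close>, this is the probability that
  \<open>Q (1/2 - s) = K\<close> and \<open>Q (1/2 + s) = L\<close> when \<open>s\<close> is uniformly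
  distributed in \<open>[0,1/2]\<close>: each of the two conditions confines \<open>s\<close> to an interval,
  and the factor \<open>2\<close> is the density of \<open>s\<close>.\<close>

definition pair_weight :: "'b set set \<Rightarrow> ('b set \<Rightarrow> real) \<Rightarrow> 'b set \<Rightarrow> 'b set \<Rightarrow> real" where
  "pair_weight S w K L =
     2 * overlap (max 0 (1/2 - (below S w K + w K))) (max 0 (1/2 - below S w K))
                 (max 0 (below S w L - 1/2)) (max 0 (below S w L + w L - 1/2))"

text \<open>Written as an increment of a clamping function, the overlap telescopes along a chain.\<close>

lemma overlap_eq:
  assumes "a \<le> b" "c \<le> d"
  shows "overlap a b c d = max a (min b d) - max a (min b c)"
  using assms by (auto simp: overlap_def max_def min_def)

lemma overlap_commute: "overlap a b c d = overlap c d a b"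
  by (auto simp: overlap_def max_def min_def)

lemma overlap_neq_0_D:
  "overlap a b c d \<noteq> 0 \<Longrightarrow> a < b \<and> c < d \<and> c < b \<and> a < d"
  by (auto simp: overlap_def max_def min_def split: if_splits)

lemma max_0_less_iff: "max 0 x < max 0 y \<longleftrightarrow> x < y \<and> 0 < (y::real)"
  by (auto simp: max_def)

lemma pair_weight_neq_0_D:
  assumes "pair_weight S w K L \<noteq> 0"
  shows "w K \<noteq> 0" "w L \<noteq> 0" "below S w K < 1/2" "1/2 < below S w L + w L"
    "below S w K + below S w L < 1" "1 < (below S w K + w K) + (below S w L + w L)"
  using assms overlap_neq_0_D unfolding pair_weight_def
  by (fastforce simp: max_0_less_iff)+

lemma pair_weight_nonneg: "0 \<le> pair_weight S w K L"
  by (simp add: pair_weight_def overlap_def)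

lemma telescope_list:
  assumes "sorted_wrt (\<subseteq>) xs" "distinct xs"
  shows "(\<Sum>K\<in>set xs. \<phi> (below (set xs) w K + w K) - \<phi> (below (set xs) w K)) =
           \<phi> (\<Sum>K\<in>set xs. w K) - (\<phi> 0 :: real)"
  using assms
proof (induction xs rule: rev_induct)
  case (snoc M xs)
  have less: "L \<subset> M" if "L \<in> set xs" for L
    using snoc.prems that by (auto simp: sorted_wrt_append)
  have M: "M \<notin> set xs" using snoc.prems by auto
  have "{L \<in> set (xs @ [M]). L \<subset> M} = set xs" using less by auto
  then have b1: "below (set (xs @ [M])) w M = (\<Sum>K\<in>set xs. w K)" by (simp add: below_def)
  have b2: "below (set (xs @ [M])) w K = below (set xs) w K" if "K \<in> set xs" for K
  proof -
    have "{L \<in> set (xs @ [M]). L \<subset> K} = {L \<in> set xs. L \<subset> K}" using less[OF that] by auto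
    then show ?thesis by (simp add: below_def)
  qed
  have "(\<Sum>K\<in>set (xs @ [M]). \<phi> (below (set (xs @ [M])) w K + w K) - \<phi> (below (set (xs @ [M])) w K))
     = (\<phi> (below (set (xs @ [M])) w M + w M) - \<phi> (below (set (xs @ [M])) w M)) +
       (\<Sum>K\<in>set xs. \<phi> (below (set (xs @ [M])) w K + w K) - \<phi> (below (set (xs @ [M])) w K))"
    using M by simp
  also have "(\<Sum>K\<in>set xs. \<phi> (below (set (xs @ [M])) w K + w K) - \<phi> (below (set (xs @ [M])) w K))
     = (\<Sum>K\<in>set xs. \<phi> (below (set xs) w K + w K) - \<phi> (below (set xs) w K))"
    by (rule sum.cong) (simp_all only: b2)
  also have "\<dots> = \<phi> (\<Sum>K\<in>set xs. w K) - \<phi> 0"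
    using snoc by (simp add: sorted_wrt_append)
  finally show ?case using M unfolding b1 by (simp add: add.commute)
qed simp

text \<open>The quantile intervals of the members of the support tile \<open>[0,1]\<close>, and members
  outside of the support contribute nothing.\<close>

lemma telescope:
  assumes S: "finite S" and w: "w \<in> chain_weights S"
  shows "(\<Sum>K\<in>S. \<phi> (below S w K + w K) - \<phi> (below S w K)) = \<phi> 1 - (\<phi> 0 :: real)"
proof -
  define C where "C = {K \<in> S. w K \<noteq> 0}"
  have "finite C" using S by (simp add: C_def)
  have "\<exists>xs. set xs = C \<and> distinct xs \<and> sorted_wrt (\<subseteq>) xs"
    by (rule ex_chain_list[OF \<open>finite C\<close>]) (use w in \<open>auto simp: C_def chain_weights_def\<close>)
  then obtain xs where xs: "set xs = C" "distinct xs" "sorted_wrt (\<subseteq>) xs" by blast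
  have b: "below S w K = below C w K" for K
    unfolding below_def by (rule sum.mono_neutral_right) (use S in \<open>auto simp: C_def\<close>)
  have "(\<Sum>K\<in>S. \<phi> (below S w K + w K) - \<phi> (below S w K)) =
        (\<Sum>K\<in>C. \<phi> (below S w K + w K) - \<phi> (below S w K))"
    by (rule sum.mono_neutral_right) (use S in \<open>auto simp: C_def\<close>)
  also have "\<dots> = \<phi> (\<Sum>K\<in>C. w K) - \<phi> 0"
    using telescope_list[OF xs(3,2), of \<phi> w] by (simp add: b xs(1))
  also have "(\<Sum>K\<in>C. w K) = (\<Sum>K\<in>S. w K)"
    by (rule sum.mono_neutral_left) (use S in \<open>auto simp: C_def\<close>)
  finally show ?thesis using w by (simp add: chain_weights_def)
qed

lemma below_le:
  assumes "finite S" "w \<in> chain_weights S" shows "0 \<le> below S w K" "below S w K + w K \<le> 1"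
proof -
  have w: "0 \<le> w L" for L using assms by (simp add: chain_weights_def)
  show "0 \<le> below S w K" unfolding below_def by (rule sum_nonneg) (use w in auto)
  show "below S w K + w K \<le> 1"
  proof (cases "K \<in> S")
    case True
    have "below S w K + w K = (\<Sum>L\<in>insert K {L \<in> S. L \<subset> K}. w L)"
      using assms by (simp add: below_def)
    also have "\<dots> \<le> (\<Sum>L\<in>S. w L)" by (rule sum_mono2) (use assms w True in auto)
    finally show ?thesis using assms by (simp add: chain_weights_def)
  next
    case False
    have "below S w K \<le> (\<Sum>L\<in>S. w L)"
      unfolding below_def by (rule sum_mono2) (use assms w in auto)
    moreover have "w K = 0" using False assms by (auto simp: chain_weights_def)
    ultimately show ?thesis using assms by (simp add: chain_weights_def)
  qed
qed

lemma below_psubset: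
  assumes "finite S" "w \<in> chain_weights S" "L \<subset> K" shows "below S w L + w L \<le> below S w K"
proof -
  have w: "0 \<le> w L" for L using assms by (simp add: chain_weights_def)
  show ?thesis
  proof (cases "L \<in> S")
    case True
    have "below S w L + w L = (\<Sum>M\<in>insert L {M \<in> S. M \<subset> L}. w M)"
      using assms by (simp add: below_def)
    also have "\<dots> \<le> below S w K" unfolding below_def
      by (rule sum_mono2) (use assms w True in auto)
    finally show ?thesis .
  next
    case False
    have "below S w L \<le> below S w K"
      unfolding below_def by (rule sum_mono2) (use assms w in auto)
    moreover have "w L = 0" using False assms by (auto simp: chain_weights_def)
    ultimately show ?thesis by simp
  qed
qed

text \<open>The intervals of the various \<open>L\<close> tile \<open>[0,1/2]\<close>, so the overlaps add up
  to the length of the part of the interval of \<open>K\<close> below the median.\<close>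

lemma sum_pair_weight_right:
  assumes "finite S" "w \<in> chain_weights S"
  shows "(\<Sum>L\<in>S. pair_weight S w K L) =
    2 * (max 0 (1/2 - below S w K) - max 0 (1/2 - (below S w K + w K)))"
proof -
  define a where "a = max 0 (1/2 - (below S w K + w K))"
  define b where "b = max 0 (1/2 - below S w K)"
  define \<phi> where "\<phi> = (\<lambda>x. max a (min b (max 0 (x - 1/2))))"
  have w: "0 \<le> w L" for L using assms by (simp add: chain_weights_def)
  have ab: "0 \<le> a" "a \<le> b" "b \<le> 1/2" using w[of K] below_le[OF assms, of K] by (auto simp: a_def b_def max_def)
  have "pair_weight S w K L = 2 * (\<phi> (below S w L + w L) - \<phi> (below S w L))" for L
    unfolding pair_weight_def a_def[symmetric] b_def[symmetric] \<phi>_def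
    by (subst overlap_eq) (use ab w[of L] in \<open>auto simp: add.commute\<close>)
  then have "(\<Sum>L\<in>S. pair_weight S w K L) = 2 * (\<Sum>L\<in>S. \<phi> (below S w L + w L) - \<phi> (below S w L))"
    by (simp add: sum_distrib_left)
  also have "\<dots> = 2 * (b - a)"
    unfolding telescope[OF assms] using ab by (simp add: \<phi>_def)
  finally show ?thesis by (simp add: a_def b_def)
qed

text \<open>The mirror image of the previous computation: reflection at the median reverses the order of the
  tiles, whence the sign in the auxiliary function.\<close>

lemma sum_pair_weight_left:
  assumes "finite S" "w \<in> chain_weights S"
  shows "(\<Sum>K\<in>S. pair_weight S w K L) =
    2 * (max 0 (below S w L + w L - 1/2) - max 0 (below S w L - 1/2))"
proof -
  define c where "c = max 0 (below S w L - 1/2)"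
  define d where "d = max 0 (below S w L + w L - 1/2)"
  define \<phi> where "\<phi> = (\<lambda>x. - max c (min d (max 0 (1/2 - x))))"
  have w: "0 \<le> w L" for L using assms by (simp add: chain_weights_def)
  have cd: "0 \<le> c" "c \<le> d" "d \<le> 1/2" using w[of L] below_le[OF assms, of L] by (auto simp: c_def d_def max_def)
  have "pair_weight S w K L = 2 * (\<phi> (below S w K + w K) - \<phi> (below S w K))" for K
    unfolding pair_weight_def c_def[symmetric] d_def[symmetric] \<phi>_def
    by (subst overlap_commute, subst overlap_eq) (use cd w[of K] in \<open>auto simp: add.commute\<close>)
  then have "(\<Sum>K\<in>S. pair_weight S w K L) = 2 * (\<Sum>K\<in>S. \<phi> (below S w K + w K) - \<phi> (below S w K))"
    by (simp add: sum_distrib_left)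
  also have "\<dots> = 2 * (d - c)"
    unfolding telescope[OF assms] using cd by (simp add: \<phi>_def)
  finally show ?thesis by (simp add: c_def d_def)
qed

text \<open>The parts of the interval of \<open>K\<close> below and above the median together have length
  \<open>w K\<close>. This identity makes the section a right inverse of the retraction.\<close>

lemma sum_pair_weight:
  assumes "finite S" "w \<in> chain_weights S"
  shows "(\<Sum>L\<in>S. pair_weight S w K L) + (\<Sum>L\<in>S. pair_weight S w L K) = 2 * w K"
  unfolding sum_pair_weight_right[OF assms] sum_pair_weight_left[OF assms] by (simp add: max_def)

lemma pair_weight_support:
  assumes "finite S" "w \<in> chain_weights S" and P: "pair_weight S w K L \<noteq> 0"
  shows "w K \<noteq> 0" "w L \<noteq> 0" "K \<subseteq> L"
proof -
  note pos = pair_weight_neq_0_D[OF P]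
  show K: "w K \<noteq> 0" and L: "w L \<noteq> 0" using pos(1,2) .
  show "K \<subseteq> L"
  proof (rule ccontr)
    assume "\<not> K \<subseteq> L"
    moreover have "K \<subseteq> L \<or> L \<subseteq> K" using K L assms(2) unfolding chain_weights_def by blast
    ultimately have "L \<subset> K" by blast
    from below_psubset[OF assms(1,2) this] pos(3,4) show False by linarith
  qed
qed

text \<open>Nestedness of the intervals from \<open>Q (1/2 - s)\<close> to \<open>Q (1/2 + s)\<close>. If
  \<open>K' \<subset> K\<close> and \<open>L' \<subset> L\<close> both held, the parameters \<open>s\<close> of
  the two pairs would have to be ordered in both ways.\<close>

lemma pair_weight_comparable:
  assumes "finite S" "w \<in> chain_weights S" and P: "pair_weight S w K L \<noteq> 0" "pair_weight S w K' L' \<noteq> 0"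
  shows "K' \<subseteq> K \<and> L \<subseteq> L' \<or> K \<subseteq> K' \<and> L' \<subseteq> L"
proof -
  have no: False
    if P: "pair_weight S w K L \<noteq> 0" "pair_weight S w K' L' \<noteq> 0" and lt: "K' \<subset> K" "L' \<subset> L" for K L K' L'
  proof -
    show False
      using pair_weight_neq_0_D(5)[OF P(1)] pair_weight_neq_0_D(6)[OF P(2)]
        below_psubset[OF assms(1,2) lt(1)] below_psubset[OF assms(1,2) lt(2)] by linarith
  qed
  have c: "A \<subseteq> B \<or> B \<subseteq> A" if "w A \<noteq> 0" "w B \<noteq> 0" for A B
    using that assms(2) by (auto simp: chain_weights_def)
  note s = pair_weight_support[OF assms(1,2)]
  have "K \<subseteq> K' \<or> K' \<subseteq> K" "L \<subseteq> L' \<or> L' \<subseteq> L"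
    using c s(1)[OF P(1)] s(1)[OF P(2)] s(2)[OF P(1)] s(2)[OF P(2)] by blast+
  then show ?thesis using no[OF P] no[OF P(2,1)] by blast
qed

lemma continuous_map_pair_weight:
  assumes "finite S"
  shows "continuous_map (powertop_real UNIV) euclideanreal (\<lambda>w. pair_weight S w K L)"
proof -
  have p: "continuous_map (powertop_real UNIV) euclideanreal (\<lambda>w. w K)" for K :: "'a set"
    by (rule continuous_map_product_projection) simp
  have b: "continuous_map (powertop_real UNIV) euclideanreal (\<lambda>w. below S w K)" for K
    unfolding below_def by (intro continuous_map_sum p) (use assms in auto)
  show ?thesis
    unfolding pair_weight_def overlap_def
    by (intro continuous_map_real_mult continuous_map_real_max continuous_map_real_min
        continuous_map_diff continuous_map_add b p) auto
qed

section \<open>The suspension of an order complex as a space of weights\<close>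

text \<open>The finitely many injective chains of a finite poset give finitely many compact simplices, and by
  \<open>point_eq_normal_form\<close> these cover the realization.\<close>

lemma (in realized_poset) compact_space_realization:
  assumes "finite (objects P)"
  shows "compact_space (realization P)"
proof -
  define CC where "CC = {C. C \<subseteq> objects P \<and> C \<noteq> {} \<and>
     (\<forall>a\<in>C. \<forall>b\<in>C. (a, b) \<in> arrows P \<or> (b, a) \<in> arrows P)}"
  have "finite CC" using assms by (auto simp: CC_def intro: finite_subset[of _ "Pow (objects P)"])
  have "\<exists>e. snd e \<in> topspace (nerve P (fst e)) \<and> bij_betw (snd e) {..fst e} C" if C: "C \<in> CC" for C
  proof -
    obtain n y where "y \<in> topspace (nerve P n)" "bij_betw y {..n} C"
      by (rule chain_enumeration[of C]) (use C assms in \<open>auto simp: CC_def intro: finite_subset\<close>)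
    then show ?thesis by (intro exI[of _ "(n, y)"]) simp
  qed
  then obtain e where e: "\<And>C. C \<in> CC \<Longrightarrow> snd (e C) \<in> topspace (nerve P (fst (e C)))"
     "\<And>C. C \<in> CC \<Longrightarrow> bij_betw (snd (e C)) {..fst (e C)} C"
    by metis
  define K where "K = (\<lambda>C. (\<lambda>t. point P (fst (e C), snd (e C), t)) ` standard_simplex (fst (e C)))"
  have "compactin (realization P) (K C)" if "C \<in> CC" for C
    unfolding K_def
    by (rule image_compactin[OF _ continuous_map_cell[OF e(1)[OF that]]])
       (simp add: compactin_subtopology compactin_standard_simplex)
  then have "compactin (realization P) (\<Union> (K ` CC))"
    using \<open>finite CC\<close> by (intro compactin_Union) auto
  moreover have "topspace (realization P) \<subseteq> \<Union> (K ` CC)"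
  proof
    fix c assume "c \<in> topspace (realization P)"
    then obtain m x t where z: "(m, x, t) \<in> cells P" "c = point P (m, x, t)"
      by (auto simp: topspace_realization)
    have x: "x \<in> topspace (nerve P m)" using z by (simp add: cells_def)
    have C: "x ` {..m} \<in> CC"
    proof -
      have "(x i, x j) \<in> arrows P \<or> (x j, x i) \<in> arrows P"
        if "i \<le> m" "j \<le> m" for i j
        using nerve_mono[OF x, of i j] nerve_mono[OF x, of j i] that by (cases "i \<le> j") auto
      then show ?thesis using x by (auto simp: CC_def topspace_nerve)
    qed
    obtain n y where ny: "e (x ` {..m}) = (n, y)" by (cases "e (x ` {..m})")
    have y: "y \<in> topspace (nerve P n)" "bij_betw y {..n} (x ` {..m})"
      using e(1)[OF C] e(2)[OF C] by (simp_all add: ny)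
    have "c = point P (n, y, \<lambda>j. if j \<le> n then weight (m, x, t) (y j) else 0)"
      unfolding z(2)
    proof (rule point_eq_normal_form[OF z(1) y(1) bij_betw_imp_inj_on[OF y(2)]])
      fix v assume "weight (m, x, t) v \<noteq> 0"
      then show "v \<in> y ` {..n}"
        using weight_eq_0_iff[OF z(1), of v] y(2) by (auto simp: bij_betw_def)
    qed
    moreover have "(\<lambda>j. if j \<le> n then weight (m, x, t) (y j) else 0) \<in> standard_simplex n"
    proof -
      have "(n, y, \<lambda>j. if j \<le> n then weight (m, x, t) (y j) else 0) \<in> point P (m, x, t)"
        using calculation z(2) in_point_iff by metis
      then show ?thesis using point_subset_cells[OF z(1)] by (auto simp: cells_def)
    qed
    ultimately have "c \<in> K (x ` {..m})" unfolding K_def ny by auto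
    then show "c \<in> \<Union> (K ` CC)" using C by blast
  qed
  ultimately show ?thesis
    unfolding compact_space_def by (metis compactin_subset_topspace subset_antisym)
qed

definition inclusion_poset :: "'b set set \<Rightarrow> 'b set top_poset" where
  "inclusion_poset T = \<lparr>Objects = discrete_topology T,
     Morphisms = discrete_topology {(K, L). K \<in> T \<and> L \<in> T \<and> K \<subseteq> L}\<rparr>"

lemma realized_inclusion_poset: "realized_poset (inclusion_poset T)"
  by unfold_locales (auto simp: inclusion_poset_def)

lemma class_weight_inclusion_poset:
  assumes "finite T" "c \<in> topspace (realization (inclusion_poset T))"
  shows "class_weight c \<in> chain_weights T"
proof -
  interpret realized_poset "inclusion_poset T" by (rule realized_inclusion_poset)
  obtain m x t where z: "(m, x, t) \<in> cells (inclusion_poset T)" "c = point (inclusion_poset T) (m, x, t)"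
    using assms by (auto simp: topspace_realization)
  have x: "x \<in> topspace (nerve (inclusion_poset T) m)" and t: "t \<in> standard_simplex m"
    using z by (simp_all add: cells_def)
  have xT: "x i \<in> T" if "i \<le> m" for i using x that by (simp add: topspace_nerve inclusion_poset_def)
  have xx: "x i \<subseteq> x j \<or> x j \<subseteq> x i" if "i \<le> m" "j \<le> m" for i j
    using nerve_mono[OF x, of i j] nerve_mono[OF x, of j i] that
    by (cases "i \<le> j") (auto simp: inclusion_poset_def)
  have t': "0 \<le> t i" "(\<Sum>i\<le>m. t i) = 1" for i using t by (auto simp: standard_simplex_def)
  note w0 = weight_eq_0_iff[OF z(1)]
  have "0 \<le> weight (m, x, t) K" for K
    unfolding weight_def average_def prod.case by (rule sum_nonneg) (use t' in auto)
  moreover have "K \<in> T" if "weight (m, x, t) K \<noteq> 0" for K using that w0 xT by auto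
  moreover have "K \<subseteq> L \<or> L \<subseteq> K" if KL: "weight (m, x, t) K \<noteq> 0" "weight (m, x, t) L \<noteq> 0" for K L
  proof -
    obtain i j where "i \<le> m" "x i = K" "j \<le> m" "x j = L" using KL unfolding w0 by blast
    then show ?thesis using xx by blast
  qed
  moreover have "(\<Sum>K\<in>T. weight (m, x, t) K) = 1"
  proof -
    have "(\<Sum>K\<in>T. weight (m, x, t) K) = (\<Sum>i\<le>m. \<Sum>K\<in>T. t i * of_bool (x i = K))"
      unfolding weight_def average_def prod.case by (rule sum.swap)
    also have "\<dots> = (\<Sum>i\<le>m. t i)"
    proof (rule sum.cong)
      fix i assume "i \<in> {..m}"
      then have "(\<Sum>K\<in>T. t i * of_bool (x i = K)) = (\<Sum>K\<in>T. if K = x i then t i else 0)"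
        by (intro sum.cong) auto
      then show "(\<Sum>K\<in>T. t i * of_bool (x i = K)) = t i" using assms(1) xT \<open>i \<in> {..m}\<close> by simp
    qed simp
    finally show ?thesis using t' by simp
  qed
  ultimately show ?thesis by (simp add: z(2) chain_weights_def)
qed

lemma ex_class_of_chain_weights:
  assumes "finite T" "w \<in> chain_weights T"
  shows "\<exists>c \<in> topspace (realization (inclusion_poset T)). class_weight c = w"
proof -
  interpret realized_poset "inclusion_poset T" by (rule realized_inclusion_poset)
  define C where "C = {K \<in> T. w K \<noteq> 0}"
  have s: "(\<Sum>K\<in>C. w K) = 1"
  proof -
    have "(\<Sum>K\<in>C. w K) = (\<Sum>K\<in>T. w K)"
      by (rule sum.mono_neutral_left) (use assms(1) in \<open>auto simp: C_def\<close>)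
    then show ?thesis using assms(2) by (simp add: chain_weights_def)
  qed
  obtain n y where y: "y \<in> topspace (nerve (inclusion_poset T) n)" "bij_betw y {..n} C"
  proof (rule chain_enumeration[of C])
    show "finite C" using assms by (simp add: C_def)
    show "C \<noteq> {}" using s by auto
    show "C \<subseteq> objects (inclusion_poset T)" by (auto simp: C_def inclusion_poset_def)
    fix a b assume ab: "a \<in> C" "b \<in> C"
    then have "a \<subseteq> b \<or> b \<subseteq> a" using assms(2) unfolding C_def chain_weights_def by blast
    then show "(a, b) \<in> arrows (inclusion_poset T) \<or> (b, a) \<in> arrows (inclusion_poset T)"
      using ab by (auto simp: C_def inclusion_poset_def)
  qed
  have w: "0 \<le> w v" "w v \<noteq> 0 \<Longrightarrow> v \<in> C" for v
    using assms(2) unfolding C_def chain_weights_def by blast+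
  note nf = normal_form_cell[OF y w s]
  show ?thesis
    by (rule bexI[OF _ imageI[OF nf(1), of "point (inclusion_poset T)", folded topspace_realization]])
       (simp add: nf(2))
qed

abbreviation chain_space :: "'b set set \<Rightarrow> 'b set cell set topology" where
  "chain_space T \<equiv> realization (inclusion_poset T)"

text \<open>Here \<open>B\<close> and \<open>E\<close> are the bottom and the top element of \<open>S\<close>.
  Excluding chains with both of them leaves two cones over the order complex of the other elements, that is, its
  suspension.\<close>

definition pole_weights :: "'b set set \<Rightarrow> 'b set \<Rightarrow> 'b set \<Rightarrow> ('b set \<Rightarrow> real) set" where
  "pole_weights S B E = {w \<in> chain_weights S. w B = 0 \<or> w E = 0}"

text \<open>The suspension coordinate \<open>t\<close> moves weight to \<open>B\<close> for \<open>t <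
  1/2\<close> and to \<open>E\<close> for \<open>t > 1/2\<close>.\<close>

definition suspension_weight ::
  "'b set \<Rightarrow> 'b set \<Rightarrow> bool + 'b set cell set \<times> real \<Rightarrow> 'b set \<Rightarrow> real" where
  "suspension_weight B E = case_sum (\<lambda>b K. of_bool (K = (if b then E else B)))
     (\<lambda>(c, t) K. (1 - \<bar>2 * t - 1\<bar>) * class_weight c K + max 0 (1 - 2 * t) * of_bool (K = B) +
        max 0 (2 * t - 1) * of_bool (K = E))"

context
  fixes T S :: "'b set set" and B E :: "'b set"
  assumes S: "S = insert B (insert E T)" and T: "finite T" and BE: "B \<noteq> E"
    and poles: "B \<notin> T" "E \<notin> T" "B \<subseteq> E" "\<And>K. K \<in> T \<Longrightarrow> B \<subseteq> K" "\<And>K. K \<in> T \<Longrightarrow> K \<subseteq> E"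
begin

definition glue :: "'b set cell set \<times> real \<Rightarrow> bool + 'b set cell set \<times> real" where
  "glue = (\<lambda>(x, t). if t = 0 then Inl False else if t = 1 then Inl True else Inr (x, t))"

lemma suspension_eq:
  "unreduced_suspension (chain_space T) = final_topology (range Inl \<union> Inr ` (topspace (chain_space T) \<times> {0<..<1})) {()}
       (\<lambda>_. prod_topology (chain_space T) (top_of_set {0..1})) (\<lambda>_. glue)"
  unfolding unreduced_suspension_def glue_def ..

lemma glue_in:
  assumes "z \<in> topspace (prod_topology (chain_space T) (top_of_set {0..1}))"
  shows "glue z \<in> range Inl \<union> Inr ` (topspace (chain_space T) \<times> {0<..<1})"
  using assms by (auto simp: glue_def split: prod.splits)

lemma topspace_suspension:
  "topspace (unreduced_suspension (chain_space T)) = range Inl \<union> Inr ` (topspace (chain_space T) \<times> {0<..<1})"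
  unfolding suspension_eq by (rule topspace_final_topology) (rule glue_in)

lemma suspension_weight_glue:
  assumes "0 \<le> t" "t \<le> 1"
  shows "suspension_weight B E (glue (c, t)) K =
    (1 - \<bar>2 * t - 1\<bar>) * class_weight c K + max 0 (1 - 2 * t) * of_bool (K = B) +
        max 0 (2 * t - 1) * of_bool (K = E)"
  using assms by (auto simp: suspension_weight_def glue_def)

lemma continuous_map_suspension_weight:
  "continuous_map (unreduced_suspension (chain_space T)) (powertop_real UNIV) (suspension_weight B E)"
  unfolding suspension_eq
proof (rule continuous_map_from_final_topology)
  fix i :: unit and z
  show "glue z \<in> range Inl \<union> Inr ` (topspace (chain_space T) \<times> {0<..<1})"
    if "z \<in> topspace (prod_topology (chain_space T) (top_of_set {0..1}))"
    using that by (rule glue_in)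
next
  show "continuous_map (prod_topology (chain_space T) (top_of_set {0..1})) (powertop_real UNIV)
      (\<lambda>z. suspension_weight B E (glue z))"
    unfolding continuous_map_componentwise_UNIV
  proof
    fix K
    let ?P = "prod_topology (chain_space T) (top_of_set {0..1::real})"
    have "carried (inclusion_poset T) T = topspace (chain_space T)"
      using chain_weights_D(2)[OF class_weight_inclusion_poset[OF T]] by (auto simp: carried_def)
    moreover have "continuous_map (subtopology (chain_space T) (carried (inclusion_poset T) T)) euclideanreal (class_average (\<lambda>L. of_bool (L = K)))"
      by (rule continuous_map_class_average[where V = "{0, 1}"])
         (auto simp: inclusion_poset_def)
    moreover have "class_average (\<lambda>L. of_bool (L = K)) = (\<lambda>c. class_weight c K)"
      by (simp add: class_weight_def fun_eq_iff)
    ultimately have "continuous_map (chain_space T) euclideanreal (\<lambda>c. class_weight c K)"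
      by simp
    then have 1: "continuous_map ?P euclideanreal (\<lambda>z. class_weight (fst z) K)"
      using continuous_map_compose[OF continuous_map_fst] by (auto simp: o_def)
    have 2: "continuous_map ?P euclideanreal snd"
      by (rule continuous_map_into_fulltopology[OF continuous_map_snd])
    let ?f = "\<lambda>z. (1 - \<bar>2 * snd z - 1\<bar>) * class_weight (fst z) K + max 0 (1 - 2 * snd z) * of_bool (K = B) +
        max 0 (2 * snd z - 1) * of_bool (K = E)"
    have "continuous_map ?P euclideanreal (\<lambda>z.
       (1 - \<bar>2 * snd z - 1\<bar>) * class_weight (fst z) K + max 0 (1 - 2 * snd z) * of_bool (K = B) +
        max 0 (2 * snd z - 1) * of_bool (K = E))"
      by (intro continuous_map_add continuous_map_real_mult continuous_map_diff continuous_map_real_max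
          continuous_map_real_abs 1 2) auto
    then show "continuous_map ?P euclideanreal (\<lambda>z. suspension_weight B E (glue z) K)"
    proof (rule continuous_map_eq)
      fix z assume "z \<in> topspace ?P"
      then obtain c t where "z = (c, t)" "0 \<le> t" "t \<le> 1" by auto
      then show "?f z = suspension_weight B E (glue z) K" by (simp add: suspension_weight_glue)
    qed
  qed
qed auto

text \<open>The gluing map need not be onto: for empty \<open>T\<close> its source is empty, while the
  suspension still contains the two poles. These are added separately.\<close>

lemma compact_space_suspension: "compact_space (unreduced_suspension (chain_space T))"
proof -
  interpret realized_poset "inclusion_poset T" by (rule realized_inclusion_poset)
  let ?P = "prod_topology (chain_space T) (top_of_set {0..1::real})"
  have "compact_space (chain_space T)" by (rule compact_space_realization) (simp add: inclusion_poset_def T)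
  then have "compact_space ?P"
    by (simp add: compact_space_prod_topology compact_space_subtopology)
  then have "compactin ?P (topspace ?P)" by (simp add: compact_space_def)
  moreover have "continuous_map ?P (unreduced_suspension (chain_space T)) glue"
    unfolding suspension_eq
  proof (rule continuous_map_into_final_topology[where i = "()" and X = "\<lambda>_. ?P" and f = "\<lambda>_. glue"])
    show "glue z \<in> range Inl \<union> Inr ` (topspace (chain_space T) \<times> {0<..<1})" if "z \<in> topspace ?P" for z
      using that by (rule glue_in)
  qed simp
  ultimately have "compactin (unreduced_suspension (chain_space T)) (glue ` topspace ?P)"
    by (rule image_compactin)
  moreover have "compactin (unreduced_suspension (chain_space T)) (range Inl)"
    by (rule finite_imp_compactin) (auto simp: topspace_suspension)
  ultimately have "compactin (unreduced_suspension (chain_space T)) (glue ` topspace ?P \<union> range Inl)"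
    by (rule compactin_Un)
  moreover have "topspace (unreduced_suspension (chain_space T)) = glue ` topspace ?P \<union> range Inl"
  proof
    show "topspace (unreduced_suspension (chain_space T)) \<subseteq> glue ` topspace ?P \<union> range Inl"
    proof
      fix z assume "z \<in> topspace (unreduced_suspension (chain_space T))"
      then consider "z \<in> range Inl" | c t where "z = Inr (c, t)" "c \<in> topspace (chain_space T)" "0 < t" "t < 1"
        by (auto simp: topspace_suspension)
      then show "z \<in> glue ` topspace ?P \<union> range Inl"
      proof cases
        case 2
        then have "z = glue (c, t)" "(c, t) \<in> topspace ?P" by (auto simp: glue_def)
        then show ?thesis by blast
      qed simp
    qed
    show "glue ` topspace ?P \<union> range Inl \<subseteq> topspace (unreduced_suspension (chain_space T))"
      using glue_in unfolding topspace_suspension by blast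
  qed
  ultimately show ?thesis by (simp add: compact_space_def)
qed

lemma suspension_weight_props:
  assumes "c \<in> topspace (chain_space T)" "0 < t" "t < 1"
  defines "w \<equiv> suspension_weight B E (Inr (c, t))"
  shows "w B = max 0 (1 - 2 * t)" "w E = max 0 (2 * t - 1)"
    "K \<noteq> B \<Longrightarrow> K \<noteq> E \<Longrightarrow> w K = (1 - \<bar>2 * t - 1\<bar>) * class_weight c K"
    "(\<Sum>K\<in>T. w K) = 1 - \<bar>2 * t - 1\<bar>"
proof -
  have c: "class_weight c \<in> chain_weights T" using T assms(1) by (rule class_weight_inclusion_poset)
  have 0: "class_weight c B = 0" "class_weight c E = 0"
    using c poles(1,2) by (auto simp: chain_weights_def)
  show "w B = max 0 (1 - 2 * t)" "w E = max 0 (2 * t - 1)"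
    using BE by (simp_all add: w_def suspension_weight_def 0)
  show w: "w K = (1 - \<bar>2 * t - 1\<bar>) * class_weight c K" if "K \<noteq> B" "K \<noteq> E" for K
    using that by (simp add: w_def suspension_weight_def)
  have "(\<Sum>K\<in>T. w K) = (\<Sum>K\<in>T. (1 - \<bar>2 * t - 1\<bar>) * class_weight c K)"
  proof (rule sum.cong)
    fix L assume "L \<in> T"
    then have "L \<noteq> B" "L \<noteq> E" using poles(1,2) by blast+
    then show "w L = (1 - \<bar>2 * t - 1\<bar>) * class_weight c L" by (rule w)
  qed simp
  also have "\<dots> = 1 - \<bar>2 * t - 1\<bar>"
    using c by (simp add: chain_weights_def flip: sum_distrib_left)
  finally show "(\<Sum>K\<in>T. w K) = 1 - \<bar>2 * t - 1\<bar>" .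
qed

lemma sum_S: "(\<Sum>K\<in>S. w K) = w B + w E + (\<Sum>K\<in>T. w K :: real)"
  using poles T BE by (simp add: S)

lemma inj_suspension_weight: "inj_on (suspension_weight B E) (topspace (unreduced_suspension (chain_space T)))"
proof (rule inj_onI)
  interpret realized_poset "inclusion_poset T" by (rule realized_inclusion_poset)
  fix x y assume xy: "x \<in> topspace (unreduced_suspension (chain_space T))" "y \<in> topspace (unreduced_suspension (chain_space T))"
    and eq: "suspension_weight B E x = suspension_weight B E y"
  have Inl_sum: "(\<Sum>K\<in>T. suspension_weight B E (Inl b) K) = 0" for b
    by (rule sum.neutral) (use poles in \<open>auto simp: suspension_weight_def\<close>)
  have pole: "x = y" if xy: "suspension_weight B E x = suspension_weight B E y" "x = Inl b"
    "y \<in> topspace (unreduced_suspension (chain_space T))" for x y b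
  proof (cases y)
    case (Inl b')
    then have "(suspension_weight B E x B = suspension_weight B E y B)" using xy by simp
    then show ?thesis using BE xy(2) Inl by (auto simp: suspension_weight_def split: if_splits)
  next
    case (Inr ct)
    then obtain c t where y: "y = Inr (c, t)" "c \<in> topspace (chain_space T)" "0 < t" "t < 1"
      using xy(3) by (auto simp: topspace_suspension)
    have "1 - \<bar>2 * t - 1\<bar> = 0"
      using suspension_weight_props(4)[OF y(2-4)] Inl_sum[of b] xy(1,2) y(1) by simp
    then show ?thesis using y by auto
  qed
  show "x = y"
  proof (cases "\<exists>b. x = Inl b \<or> y = Inl b")
    case True
    then show ?thesis using pole[of x y] pole[of y x] eq xy by metis
  next
    case False
    then obtain c t c' t' where x: "x = Inr (c, t)" "c \<in> topspace (chain_space T)" "0 < t" "t < 1"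
      and y: "y = Inr (c', t')" "c' \<in> topspace (chain_space T)" "0 < t'" "t' < 1"
      using xy by (auto simp: topspace_suspension)
    note px = suspension_weight_props[OF x(2-4)] and py = suspension_weight_props[OF y(2-4)]
    have "max 0 (1 - 2 * t) = max 0 (1 - 2 * t')" "max 0 (2 * t - 1) = max 0 (2 * t' - 1)"
      using px(1,2) py(1,2) eq x(1) y(1) by simp_all
    then have t: "t = t'" by (auto simp: max_def split: if_splits)
    have "class_weight c K = class_weight c' K" for K
    proof (cases "K = B \<or> K = E")
      case True
      then show ?thesis
        using class_weight_inclusion_poset[OF T x(2)] class_weight_inclusion_poset[OF T y(2)] poles(1,2)
        unfolding chain_weights_def by (metis (mono_tags, lifting) mem_Collect_eq)
    next
      case False
      then have "(1 - \<bar>2 * t - 1\<bar>) * class_weight c K = (1 - \<bar>2 * t - 1\<bar>) * class_weight c' K"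
        using px(3)[of K] py(3)[of K] eq x(1) y(1) t by metis
      then show ?thesis using x(3,4) by (auto simp: abs_if split: if_splits)
    qed
    then have "c = c'" using x(2) y(2) by (intro class_weight_inject) auto
    then show ?thesis using x(1) y(1) t by simp
  qed
qed

lemma suspension_weight_image:
  "suspension_weight B E ` topspace (unreduced_suspension (chain_space T)) = pole_weights S B E"
proof (intro Set.set_eqI iffI)
  fix w assume "w \<in> suspension_weight B E ` topspace (unreduced_suspension (chain_space T))"
  then consider b where "w = suspension_weight B E (Inl b)"
    | c t where "w = suspension_weight B E (Inr (c, t))" "c \<in> topspace (chain_space T)" "0 < t" "t < 1"
    by (auto simp: topspace_suspension)
  then show "w \<in> pole_weights S B E"
  proof cases
    case 1
    define M where "M = (if b then E else B)"
    have w: "w = (\<lambda>K. of_bool (K = M))" by (simp add: 1 M_def suspension_weight_def)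
    have "M \<in> S" "finite S" using T by (auto simp: M_def S)
    then show ?thesis using BE by (auto simp: w pole_weights_def chain_weights_def of_bool_def)
  next
    case 2
    have c: "class_weight c \<in> chain_weights T" using T 2(2) by (rule class_weight_inclusion_poset)
    note p = suspension_weight_props[OF 2(2-4), folded 2(1)]
    have nonneg: "0 \<le> w K" for K
      using c 2(3,4) by (auto simp: 2(1) suspension_weight_def chain_weights_def)
    have supp: "K = B \<or> K = E \<or> K \<in> T \<and> class_weight c K \<noteq> 0" if "w K \<noteq> 0" for K
      using p(3)[of K] that chain_weights_D(3)[OF c, of K] by (cases "K = B \<or> K = E") auto
    have "K \<subseteq> L \<or> L \<subseteq> K" if "w K \<noteq> 0" "w L \<noteq> 0" for K L
    proof -
      have "class_weight c K \<noteq> 0 \<Longrightarrow> class_weight c L \<noteq> 0 \<Longrightarrow> K \<subseteq> L \<or> L \<subseteq> K"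
        using c unfolding chain_weights_def by blast
      then show ?thesis using supp[OF that(1)] supp[OF that(2)] poles(3-5) by blast
    qed
    moreover have "(\<Sum>K\<in>S. w K) = 1"
      unfolding sum_S p(1,2,4) by (auto simp: max_def)
    moreover have "w B = 0 \<or> w E = 0" unfolding p(1,2) by (auto simp: max_def)
    moreover have "K \<in> S" if "w K \<noteq> 0" for K using supp[OF that] unfolding S by blast
    ultimately show ?thesis
      using nonneg unfolding pole_weights_def chain_weights_def by blast
  qed
next
  fix w assume w: "w \<in> pole_weights S B E"
  have w0: "0 \<le> w K" "w K \<noteq> 0 \<Longrightarrow> K = B \<or> K = E \<or> K \<in> T" for K
    using w by (auto simp: pole_weights_def chain_weights_def S)
  have chain: "K \<subseteq> L \<or> L \<subseteq> K" if "w K \<noteq> 0" "w L \<noteq> 0" for K L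
    using w that unfolding pole_weights_def chain_weights_def by blast
  have one: "w B = 0 \<or> w E = 0" and sum1: "w B + w E + (\<Sum>K\<in>T. w K) = 1"
    using w sum_S[of w] by (simp_all add: pole_weights_def chain_weights_def)
  define s where "s = (\<Sum>K\<in>T. w K)"
  have "0 \<le> s" unfolding s_def by (rule sum_nonneg) (rule w0)
  show "w \<in> suspension_weight B E ` topspace (unreduced_suspension (chain_space T))"
  proof (cases "s = 0")
    case True
    then have wT: "w K = 0" if "K \<in> T" for K
      using sum_nonneg_eq_0_iff[OF T, of w] w0 that by (simp add: s_def)
    define b where "b = (w B = 0)"
    have "w K = suspension_weight B E (Inl b) K" for K
      using wT w0(2)[of K] one sum1 True BE by (auto simp: b_def suspension_weight_def s_def)
    then have "w = suspension_weight B E (Inl b)" by blast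
    moreover have "Inl b \<in> topspace (unreduced_suspension (chain_space T))" by (simp add: topspace_suspension)
    ultimately show ?thesis by (rule image_eqI)
  next
    case False
    then have "0 < s" using \<open>0 \<le> s\<close> by simp
    define v where "v = (\<lambda>K. if K \<in> T then w K / s else 0)"
    have "v \<in> chain_weights T"
    proof -
      have "(\<Sum>K\<in>T. v K) = 1"
        using \<open>0 < s\<close> by (simp add: v_def s_def flip: sum_divide_distrib)
      moreover have "0 \<le> v K" for K using w0 \<open>0 < s\<close> by (simp add: v_def)
      moreover have "w K \<noteq> 0 \<and> K \<in> T" if "v K \<noteq> 0" for K using that by (auto simp: v_def split: if_splits)
      ultimately show ?thesis using chain unfolding chain_weights_def by blast
    qed
    then obtain c where c: "c \<in> topspace (chain_space T)" "class_weight c = v"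
      using ex_class_of_chain_weights[OF T] by blast
    \<comment> \<open>the only \<open>t\<close> with \<open>w B = max 0 (1 - 2 * t)\<close> and \<open>w E = max 0 (2 * t - 1)\<close>\<close>
    define t where "t = (1 + w E - w B) / 2"
    have BE1: "w B < 1" "w E < 1" "0 \<le> w B" "0 \<le> w E" using sum1 one w0 \<open>0 < s\<close> by (auto simp: s_def)
    have t: "0 < t" "t < 1" "1 - 2 * t = w B - w E"
      using BE1 one by (auto simp: t_def field_simps)
    have ws: "1 - \<bar>2 * t - 1\<bar> = s" "max 0 (1 - 2 * t) = w B" "max 0 (2 * t - 1) = w E"
      using t(3) one sum1 BE1 by (auto simp: s_def)
    have vBE: "v B = 0" "v E = 0" using poles(1,2) by (simp_all add: v_def)
    have "w K = suspension_weight B E (Inr (c, t)) K" for K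
    proof (cases "K = B \<or> K = E")
      case True
      then show ?thesis using BE by (auto simp: suspension_weight_def c(2) ws vBE)
    next
      case False
      then show ?thesis using w0(2)[of K] \<open>0 < s\<close> by (auto simp: suspension_weight_def c(2) ws v_def)
    qed
    then have "w = suspension_weight B E (Inr (c, t))" by blast
    moreover have "Inr (c, t) \<in> topspace (unreduced_suspension (chain_space T))"
      using c t by (simp add: topspace_suspension)
    ultimately show ?thesis by (rule image_eqI)
  qed
qed

text \<open>A continuous injection from a compact space into a Hausdorff space is an embedding, so no
  continuity has to be checked for the inverse, whose formula divides by the weight of \<open>T\<close> and
  degenerates at the poles.\<close>

lemma suspension_homeomorphic_pole_weights:
  "unreduced_suspension (chain_space T) homeomorphic_space subtopology (powertop_real UNIV) (pole_weights S B E)"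
proof -
  have "Hausdorff_space (powertop_real (UNIV :: 'b set set))"
    by (simp add: Hausdorff_space_product_topology)
  then have "embedding_map (unreduced_suspension (chain_space T)) (powertop_real UNIV) (suspension_weight B E)"
    by (intro continuous_imp_embedding_map continuous_map_suspension_weight compact_space_suspension
        inj_suspension_weight)
  then show ?thesis
    using suspension_weight_image unfolding embedding_map_def homeomorphic_space by auto
qed

end

section \<open>Orthogonal decompositions\<close>

abbreviation move :: "complex^'n^'n \<Rightarrow> (complex^'n) set \<Rightarrow> (complex^'n) set" where
  "move A V \<equiv> (\<lambda>v. A *v v) ` V"

lemma hermitian_add_left: "hermitian_inner (u + v) w = hermitian_inner u w + hermitian_inner v w"
  by (simp add: hermitian_inner_def sum.distrib algebra_simps)

lemma hermitian_diff_left: "hermitian_inner (u - v) w = hermitian_inner u w - hermitian_inner v w"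
  by (simp add: hermitian_inner_def sum_subtractf algebra_simps)

lemma hermitian_scale_left: "hermitian_inner (c *s u) w = c * hermitian_inner u w"
  by (simp add: hermitian_inner_def sum_distrib_left algebra_simps)

lemma hermitian_scale_right: "hermitian_inner u (c *s w) = cnj c * hermitian_inner u w"
  by (simp add: hermitian_inner_def sum_distrib_left algebra_simps)

lemma hermitian_sym: "hermitian_inner w v = cnj (hermitian_inner v w)"
  by (simp add: hermitian_inner_def algebra_simps)

lemma hermitian_sym_0: "hermitian_inner w v = 0 \<longleftrightarrow> hermitian_inner v w = 0"
  by (subst hermitian_sym) simp

lemma hermitian_zero [simp]: "hermitian_inner 0 w = 0" "hermitian_inner w 0 = 0"
  by (simp_all add: hermitian_inner_def)

lemma hermitian_sum_left: "hermitian_inner (\<Sum>i\<in>I. f i) w = (\<Sum>i\<in>I. hermitian_inner (f i) w)"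
  by (induction I rule: infinite_finite_induct) (simp_all add: hermitian_add_left)

lemma hermitian_Re: "Re (hermitian_inner v w) = v \<bullet> w"
  by (simp add: hermitian_inner_def inner_vec_def inner_complex_def)

lemma hermitian_self_0 [simp]: "hermitian_inner v v = 0 \<longleftrightarrow> v = 0"
  using hermitian_Re[of v v] by auto

lemma hermitian_orthogonal_span:
  assumes "\<And>v. v \<in> S \<Longrightarrow> hermitian_inner v w = 0" "x \<in> vec.span S"
  shows "hermitian_inner x w = 0"
  using assms(2)
  by (induction rule: vec.span_induct_alt)
     (simp_all add: assms(1) hermitian_add_left hermitian_scale_left)

lemma hermitian_adjoint: "hermitian_inner (A *v v) w = hermitian_inner v (conjugate_transpose A *v w)"
proof -
  have "hermitian_inner (A *v v) w = (\<Sum>i\<in>UNIV. \<Sum>j\<in>UNIV. A $ i $ j * v $ j * cnj (w $ i))"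
    by (simp add: hermitian_inner_def matrix_vector_mult_def sum_distrib_right)
  also have "\<dots> = (\<Sum>j\<in>UNIV. \<Sum>i\<in>UNIV. A $ i $ j * v $ j * cnj (w $ i))" by (rule sum.swap)
  also have "\<dots> = hermitian_inner v (conjugate_transpose A *v w)"
    by (simp add: hermitian_inner_def conjugate_transpose_def matrix_vector_mult_def sum_distrib_left algebra_simps)
  finally show ?thesis .
qed

lemma unitary_hermitian:
  assumes "A \<in> unitary_group" shows "hermitian_inner (A *v v) (A *v w) = hermitian_inner v w"
  using assms by (simp add: hermitian_adjoint unitary_group_def matrix_vector_mul_assoc)

lemma unitary_inverse:
  assumes "A \<in> unitary_group"
  shows "conjugate_transpose A *v (A *v v) = v" "A *v (conjugate_transpose A *v v) = v"
  using assms by (simp_all add: unitary_group_def matrix_vector_mul_assoc)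

lemma proper_decomposition_orthogonal:
  assumes "proper_decomposition \<Lambda>" "V \<in> \<Lambda>" "W \<in> \<Lambda>" "V \<noteq> W" "v \<in> V" "w \<in> W"
  shows "hermitian_inner v w = 0"
  using assms unfolding proper_decomposition_def pairwise_def by blast

lemma proper_decomposition_component:
  assumes "proper_decomposition \<Lambda>" "V \<in> \<Lambda>"
  shows "vec.subspace V" "V \<noteq> UNIV" "0 \<in> V" "\<exists>v\<in>V. v \<noteq> 0"
proof -
  show "vec.subspace V" "V \<noteq> UNIV" using assms unfolding proper_decomposition_def by blast+
  then show "0 \<in> V" by (simp add: vec.subspace_0)
  then show "\<exists>v\<in>V. v \<noteq> 0" using assms unfolding proper_decomposition_def by blast
qed

lemma proper_decomposition_eqI:
  assumes "proper_decomposition \<Lambda>" "V \<in> \<Lambda>" "W \<in> \<Lambda>" "v \<in> V" "v \<in> W" "v \<noteq> 0"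
  shows "V = W"
  using proper_decomposition_orthogonal[OF assms(1-3) _ assms(4,5)] assms(6) by auto

lemma proper_decomposition_subset_eq:
  assumes "proper_decomposition \<Lambda>" "V \<in> \<Lambda>" "W \<in> \<Lambda>" "V \<subseteq> W" shows "V = W"
proof -
  obtain v where "v \<in> V" "v \<noteq> 0" using proper_decomposition_component(4)[OF assms(1,2)] by blast
  then show ?thesis using proper_decomposition_eqI[OF assms(1-3), of v] assms(4) by blast
qed

lemma orthogonal_to_decomposition:
  assumes "proper_decomposition \<Lambda>" and "\<And>V v. V \<in> \<Lambda> \<Longrightarrow> v \<in> V \<Longrightarrow> hermitian_inner v x = 0"
  shows "x = 0"
proof -
  have "x \<in> vec.span (\<Union>\<Lambda>)" using assms(1) by (simp add: proper_decomposition_def)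
  then have "hermitian_inner x x = 0" by (rule hermitian_orthogonal_span[rotated]) (use assms(2) in auto)
  then show ?thesis by simp
qed

text \<open>The vectors with an orthogonal projection to \<open>V\<close> form a subspace that contains
  \<open>V\<close> and all other components, hence everything.\<close>

lemma ex_component_projection:
  assumes \<Lambda>: "proper_decomposition \<Lambda>" and V: "V \<in> \<Lambda>"
  shows "\<exists>w\<in>V. \<forall>u\<in>V. hermitian_inner (x - w) u = 0"
proof -
  note sub = proper_decomposition_component(1)[OF \<Lambda> V]
  have "x \<in> vec.span (\<Union>\<Lambda>)" using \<Lambda> by (simp add: proper_decomposition_def)
  then show ?thesis
  proof (induction rule: vec.span_induct_alt)
    case base
    then show ?case using vec.subspace_0[OF sub] by (intro bexI[of _ 0]) auto
  next
    case (step c y x)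
    then obtain w where w: "w \<in> V" "\<forall>u\<in>V. hermitian_inner (x - w) u = 0" by blast
    obtain W where W: "W \<in> \<Lambda>" "y \<in> W" using step by blast
    show ?case
    proof (cases "W = V")
      case True
      then have "c *s y + w \<in> V" using sub W w by (intro vec.subspace_add vec.subspace_scale) auto
      moreover have "c *s y + x - (c *s y + w) = x - w" by simp
      ultimately show ?thesis using w by metis
    next
      case False
      have "hermitian_inner (c *s y + x - w) u = 0" if "u \<in> V" for u
      proof -
        have "c *s y + x - w = c *s y + (x - w)" by simp
        then show ?thesis
          using proper_decomposition_orthogonal[OF \<Lambda> W(1) V False W(2) that] w that
          by (simp only: hermitian_add_left hermitian_scale_left) simp
      qed
      then show ?thesis using w by blast
    qed
  qed
qed

text \<open>A component is the orthogonal complement of the other ones. It is thereby described by equations,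
  which makes conditions on components closed.\<close>

lemma proper_decomposition_memI:
  assumes \<Lambda>: "proper_decomposition \<Lambda>" and V: "V \<in> \<Lambda>"
    and x: "\<And>W w. W \<in> \<Lambda> \<Longrightarrow> W \<noteq> V \<Longrightarrow> w \<in> W \<Longrightarrow> hermitian_inner x w = 0"
  shows "x \<in> V"
proof -
  obtain w where w: "w \<in> V" "\<forall>u\<in>V. hermitian_inner (x - w) u = 0"
    using ex_component_projection[OF \<Lambda> V] by blast
  have "x - w = 0"
  proof (rule orthogonal_to_decomposition[OF \<Lambda>])
    fix W v assume W: "W \<in> \<Lambda>" "v \<in> W"
    have "hermitian_inner (x - w) v = 0"
    proof (cases "W = V")
      case False
      then have "hermitian_inner w v = 0"
        using proper_decomposition_orthogonal[OF \<Lambda> V W(1) _ w(1) W(2)] by simp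
      then show ?thesis using x[OF W(1) False W(2)] by (simp add: hermitian_diff_left)
    qed (use w W in blast)
    then show "hermitian_inner v (x - w) = 0" by (simp add: hermitian_sym_0)
  qed
  then show ?thesis using w by simp
qed

text \<open>Nonzero vectors chosen from the components are pairwise orthogonal, hence independent.\<close>

lemma finite_proper_decomposition:
  assumes "proper_decomposition \<Lambda>" shows "finite \<Lambda>"
proof -
  have "\<forall>V\<in>\<Lambda>. \<exists>v. v \<in> V \<and> v \<noteq> 0" using proper_decomposition_component(4)[OF assms] by blast
  then obtain f where f: "\<And>V. V \<in> \<Lambda> \<Longrightarrow> f V \<in> V \<and> f V \<noteq> 0" by metis
  have inj: "inj_on f \<Lambda>"
    by (rule inj_onI) (metis f proper_decomposition_eqI[OF assms])
  have "f V \<bullet> f W = 0" if "V \<in> \<Lambda>" "W \<in> \<Lambda>" "f V \<noteq> f W" for V W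
  proof -
    have "hermitian_inner (f V) (f W) = 0"
      by (rule proper_decomposition_orthogonal[OF assms, of V W]) (use f that in auto)
    then show ?thesis by (simp flip: hermitian_Re)
  qed
  then have "pairwise orthogonal (f ` \<Lambda>)"
    unfolding pairwise_def orthogonal_def by blast
  then have "independent (f ` \<Lambda>)"
    by (rule pairwise_orthogonal_independent) (use f in auto)
  then have "finite (f ` \<Lambda>)" by (rule finiteI_independent)
  then show ?thesis using inj by (rule finite_imageD)
qed

lemma refines_refl: "refines \<Lambda> \<Lambda>" unfolding refines_def by blast

lemma refines_trans: "refines \<Lambda> M \<Longrightarrow> refines M N \<Longrightarrow> refines \<Lambda> N"
  unfolding refines_def by (meson subset_trans)

lemma refines_antisym:
  assumes "proper_decomposition \<Lambda>" "proper_decomposition M" "refines \<Lambda> M" "refines M \<Lambda>"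
  shows "\<Lambda> = M"
proof -
  have *: "\<Lambda> \<subseteq> M" if r: "proper_decomposition \<Lambda>" "proper_decomposition M" "refines \<Lambda> M" "refines M \<Lambda>" for \<Lambda> M :: "(complex^'n) set set"
  proof
    fix V assume V: "V \<in> \<Lambda>"
    then obtain W where W: "W \<in> M" "V \<subseteq> W" using r(3) by (auto simp: refines_def)
    then obtain V' where V': "V' \<in> \<Lambda>" "W \<subseteq> V'" using r(4) by (auto simp: refines_def)
    then have "V = V'" using proper_decomposition_subset_eq[OF r(1) V V'(1)] W by blast
    then show "V \<in> M" using W V' by auto
  qed
  show ?thesis using *[OF assms] *[OF assms(2,1,4,3)] by blast
qed

lemma decomposition_act_mult: "decomposition_act (A ** B) \<Lambda> = decomposition_act A (decomposition_act B \<Lambda>)"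
  by (simp add: decomposition_act_def image_image matrix_vector_mul_assoc)

lemma decomposition_act_one [simp]: "decomposition_act (mat 1) \<Lambda> = \<Lambda>"
  by (simp add: decomposition_act_def)

lemma refines_act: "refines \<Lambda> M \<Longrightarrow> refines (decomposition_act A \<Lambda>) (decomposition_act A M)"
  unfolding refines_def decomposition_act_def by (auto dest: image_mono)

lemma proper_decomposition_act:
  assumes A: "A \<in> unitary_group" and \<Lambda>: "proper_decomposition \<Lambda>"
  shows "proper_decomposition (decomposition_act A \<Lambda>)"
  unfolding proper_decomposition_def
proof (intro conjI ballI)
  fix W assume "W \<in> decomposition_act A \<Lambda>"
  then obtain V where V: "V \<in> \<Lambda>" and W: "W = move A V" by (auto simp: decomposition_act_def)
  note c = proper_decomposition_component[OF \<Lambda> V]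
  show "vec.subspace W" unfolding W
    by (rule vec.subspace_image[OF c(1)])
  show "W \<noteq> {0}"
  proof
    assume "W = {0}"
    moreover obtain v where "v \<in> V" "v \<noteq> 0" using c(4) by blast
    ultimately have "A *v v = 0" by (auto simp: W)
    then show False using unitary_inverse(1)[OF A, of v] \<open>v \<noteq> 0\<close> by simp
  qed
  show "W \<noteq> UNIV"
  proof
    assume "W = UNIV"
    have "v \<in> V" for v
    proof -
      have "A *v v \<in> W" using \<open>W = UNIV\<close> by simp
      then obtain u where "u \<in> V" "A *v v = A *v u" by (auto simp: W)
      then show ?thesis using unitary_inverse(1)[OF A] by metis
    qed
    then show False using c(2) by auto
  qed
next
  show "pairwise (\<lambda>V W. \<forall>v\<in>V. \<forall>w\<in>W. hermitian_inner v w = 0) (decomposition_act A \<Lambda>)"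
    unfolding pairwise_def decomposition_act_def
    using proper_decomposition_orthogonal[OF \<Lambda>] unitary_hermitian[OF A] by fastforce
  show "vec.span (\<Union> (decomposition_act A \<Lambda>)) = UNIV"
  proof -
    have "y \<in> vec.span (\<Union> (decomposition_act A \<Lambda>))" for y
    proof -
      have "A *v x \<in> vec.span (\<Union> (decomposition_act A \<Lambda>))" if "x \<in> vec.span (\<Union>\<Lambda>)" for x
        using that
      proof (induction rule: vec.span_induct_alt)
        case base show ?case by (simp add: vec.span_zero)
      next
        case (step c y x)
        have "A *v y \<in> \<Union> (decomposition_act A \<Lambda>)" using step by (auto simp: decomposition_act_def)
        then have "c *s (A *v y) + A *v x \<in> vec.span (\<Union> (decomposition_act A \<Lambda>))"
          by (rule vec.span_add[OF vec.span_scale[OF vec.span_base] step.IH])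
        then show ?case by (simp add: matrix_vector_right_distrib vector_scalar_commute)
      qed
      moreover have "conjugate_transpose A *v y \<in> vec.span (\<Union>\<Lambda>)"
        using \<Lambda> by (simp add: proper_decomposition_def)
      ultimately show ?thesis using unitary_inverse(2)[OF A, of y] by metis
    qed
    then show ?thesis by blast
  qed
qed

lemma topspace_decomposition_objects:
  "objects decomposition_poset = {\<Lambda>. proper_decomposition \<Lambda>}"
  unfolding decomposition_poset_def orbit_topology_def
  by simp (rule topspace_final_topology, auto intro: proper_decomposition_act)

lemma topspace_decomposition_morphisms:
  "arrows decomposition_poset =
     {(\<Lambda>, M). proper_decomposition \<Lambda> \<and> proper_decomposition M \<and> refines \<Lambda> M}"
  unfolding decomposition_poset_def orbit_topology_def
  by simp (rule topspace_final_topology, auto intro: proper_decomposition_act refines_act)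

text \<open>In the disjoint union of the orbits a set is closed as soon as its preimages in
  \<open>U(n)\<close> under all orbit maps are closed.\<close>

lemma closedin_decomposition_objects:
  assumes "C \<subseteq> {\<Lambda>. proper_decomposition \<Lambda>}"
    and "\<And>\<Lambda>. proper_decomposition \<Lambda> \<Longrightarrow>
      closedin (top_of_set unitary_group) {u \<in> unitary_group. decomposition_act u \<Lambda> \<in> C}"
  shows "closedin (Objects decomposition_poset) C"
proof -
  have "closedin (final_topology {\<Lambda>. proper_decomposition \<Lambda>} {\<Lambda>. proper_decomposition \<Lambda>}
     (\<lambda>_. top_of_set unitary_group) (\<lambda>x g. decomposition_act g x)) C"
    by (subst closedin_final_topology) (use assms in \<open>auto intro: proper_decomposition_act\<close>)
  then show ?thesis by (simp add: decomposition_poset_def orbit_topology_def)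
qed

lemma realized_decomposition_poset: "realized_poset decomposition_poset"
proof unfold_locales
  fix a b c :: "(complex^'n) set set"
  show "(a, b) \<in> arrows decomposition_poset \<Longrightarrow>
      a \<in> objects decomposition_poset \<and> b \<in> objects decomposition_poset"
    by (simp add: topspace_decomposition_objects topspace_decomposition_morphisms)
  show "a \<in> objects decomposition_poset \<Longrightarrow> (a, a) \<in> arrows decomposition_poset"
    by (simp add: topspace_decomposition_objects topspace_decomposition_morphisms refines_refl)
  show "(a, b) \<in> arrows decomposition_poset \<Longrightarrow>
      (b, c) \<in> arrows decomposition_poset \<Longrightarrow> (a, c) \<in> arrows decomposition_poset"
    using refines_trans by (simp add: topspace_decomposition_morphisms) blast
  show "(a, b) \<in> arrows decomposition_poset \<Longrightarrow>
      (b, a) \<in> arrows decomposition_poset \<Longrightarrow> a = b"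
    by (simp add: topspace_decomposition_morphisms refines_antisym)
qed

lemma closedin_unitary_hermitian_0:
  "closedin (top_of_set unitary_group) {u \<in> unitary_group. hermitian_inner (A *v (u *v v)) (u *v w) = 0}"
  "closedin (top_of_set unitary_group) {u \<in> unitary_group. hermitian_inner (u *v v) w = 0}"
proof -
  have 1: "continuous_on UNIV (\<lambda>u. hermitian_inner (A *v (u *v v)) (u *v w))"
    by (simp add: hermitian_inner_def matrix_vector_mult_def) (intro continuous_intros)
  have 2: "continuous_on UNIV (\<lambda>u. hermitian_inner (u *v v) w)"
    by (simp add: hermitian_inner_def matrix_vector_mult_def) (intro continuous_intros)
  have *: "closedin (top_of_set unitary_group) {u \<in> unitary_group. f u = 0}"
    if "continuous_on UNIV f" for f :: "complex^'n^'n \<Rightarrow> complex"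
    using continuous_closedin_preimage_constant[of unitary_group f 0] that continuous_on_subset by blast
  show "closedin (top_of_set unitary_group) {u \<in> unitary_group. hermitian_inner (A *v (u *v v)) (u *v w) = 0}"
    using 1 by (rule *)
  show "closedin (top_of_set unitary_group) {u \<in> unitary_group. hermitian_inner (u *v v) w = 0}"
    using 2 by (rule *)
qed

section \<open>The regular representation of a finite abelian group\<close>

text \<open>A finite abelian group whose characters are identified with its elements by a symmetric
  nondegenerate pairing \<open>ch\<close>, so that group elements serve as indices of characters as well. The
  bijection \<open>b\<close> labels the coordinates of \<open>\<complex>\<^sup>n\<close> by group elements and
  makes the group finite.\<close>

locale character_pairing = comm_group G for G (structure) +
  fixes b :: "'n::finite \<Rightarrow> 'a" and ch :: "'a \<Rightarrow> 'a \<Rightarrow> complex"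
  assumes bij: "bij_betw b UNIV (carrier G)"
    and ch_mult_left: "x \<in> carrier G \<Longrightarrow> y \<in> carrier G \<Longrightarrow> z \<in> carrier G \<Longrightarrow> ch (x \<otimes> y) z = ch x z * ch y z"
    and ch_sym: "x \<in> carrier G \<Longrightarrow> y \<in> carrier G \<Longrightarrow> ch x y = ch y x"
    and ch_norm: "x \<in> carrier G \<Longrightarrow> y \<in> carrier G \<Longrightarrow> cmod (ch x y) = 1"
    and ch_nondegenerate: "x \<in> carrier G \<Longrightarrow> x \<noteq> \<one> \<Longrightarrow> \<exists>y\<in>carrier G. ch y x \<noteq> 1"
begin

lemma finite_carrier: "finite (carrier G)"
  using bij_betw_finite[OF bij] by simp

lemma ch_mult_right: "x \<in> carrier G \<Longrightarrow> y \<in> carrier G \<Longrightarrow> z \<in> carrier G \<Longrightarrow> ch x (y \<otimes> z) = ch x y * ch x z"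
  by (metis ch_mult_left ch_sym m_closed)

lemma ch_nonzero: "x \<in> carrier G \<Longrightarrow> y \<in> carrier G \<Longrightarrow> ch x y \<noteq> 0"
  using ch_norm by force

lemma ch_one_left [simp]: "x \<in> carrier G \<Longrightarrow> ch \<one> x = 1"
  using ch_mult_left[of \<one> \<one> x] ch_nonzero[of \<one> x] by simp

lemma ch_one_right [simp]: "x \<in> carrier G \<Longrightarrow> ch x \<one> = 1"
  by (metis ch_one_left ch_sym one_closed)

lemma ch_cnj: "x \<in> carrier G \<Longrightarrow> y \<in> carrier G \<Longrightarrow> ch x y * cnj (ch x y) = 1"
  using ch_norm complex_norm_square[of "ch x y"] by simp

lemma ch_inv_right: "x \<in> carrier G \<Longrightarrow> y \<in> carrier G \<Longrightarrow> ch x (inv y) = cnj (ch x y)"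
proof -
  assume x: "x \<in> carrier G" "y \<in> carrier G"
  then have "ch x y * ch x (inv y) = 1" by (simp flip: ch_mult_right)
  then have "ch x y * ch x (inv y) = ch x y * cnj (ch x y)" using ch_cnj[OF x] by simp
  then show ?thesis using ch_nonzero[OF x] by simp
qed

definition coord :: "complex^'n \<Rightarrow> 'a \<Rightarrow> complex" where
  "coord v x = v $ inv_into UNIV b x"

definition vector_of :: "('a \<Rightarrow> complex) \<Rightarrow> complex^'n" where
  "vector_of f = (\<chi> i. f (b i))"

abbreviation rho :: "'a \<Rightarrow> complex^'n^'n" where "rho \<equiv> regular_rep G b"

lemma b_in [simp]: "b i \<in> carrier G"
  using bij by (auto simp: bij_betw_def)

lemma b_inv [simp]: "x \<in> carrier G \<Longrightarrow> b (inv_into UNIV b x) = x"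
  using bij by (simp add: bij_betw_def f_inv_into_f)

lemma coord_b [simp]: "coord v (b i) = v $ i"
  using bij by (simp add: coord_def bij_betw_def inv_into_f_f)

lemma coord_vector_of [simp]: "x \<in> carrier G \<Longrightarrow> coord (vector_of f) x = f x"
  by (simp add: coord_def vector_of_def)

lemma vector_eqI: "(\<And>x. x \<in> carrier G \<Longrightarrow> coord v x = coord w x) \<Longrightarrow> v = w"
  by (metis coord_b b_in vec_eq_iff)

lemma coord_linear [simp]: "coord (v + w) x = coord v x + coord w x" "coord (v - w) x = coord v x - coord w x"
  "coord (c *s v) x = c * coord v x" "coord 0 x = 0"
  by (simp_all add: coord_def)

lemma coord_sum: "coord (\<Sum>i\<in>I. f i) x = (\<Sum>i\<in>I. coord (f i) x)"
  by (simp add: coord_def)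

lemma hermitian_coord: "hermitian_inner v w = (\<Sum>x\<in>carrier G. coord v x * cnj (coord w x))"
  using sum.reindex_bij_betw[OF bij, of "\<lambda>x. coord v x * cnj (coord w x)"] by (simp add: hermitian_inner_def)

lemma coord_rho:
  assumes "g \<in> carrier G" "x \<in> carrier G"
  shows "coord (rho g *v v) x = coord v (inv g \<otimes> x)"
proof -
  have "coord (rho g *v v) x = (\<Sum>j\<in>UNIV. if j = inv_into UNIV b (inv g \<otimes> x) then v $ j else 0)"
    unfolding coord_def matrix_vector_mult_def regular_rep_def vec_lambda_beta
  proof (rule sum.cong)
    fix j
    have "x = g \<otimes> b j \<longleftrightarrow> b j = inv g \<otimes> x"
      using assms by (metis b_in inv_solve_left)
    also have "\<dots> \<longleftrightarrow> j = inv_into UNIV b (inv g \<otimes> x)"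
      using assms bij by (metis b_inv coord_b bij_betw_def inv_closed inv_into_f_f m_closed UNIV_I)
    finally show "(if b (inv_into UNIV b x) = g \<otimes> b j then 1 else 0) * v $ j
       = (if j = inv_into UNIV b (inv g \<otimes> x) then v $ j else 0)" using assms by simp
  qed simp
  then show ?thesis by (simp add: coord_def)
qed

lemma rho_one [simp]: "rho \<one> *v v = v"
  by (rule vector_eqI) (simp add: coord_rho)

lemma rho_mult: "g \<in> carrier G \<Longrightarrow> h \<in> carrier G \<Longrightarrow> rho g *v (rho h *v v) = rho (g \<otimes> h) *v v"
  by (rule vector_eqI) (simp add: coord_rho inv_mult_group m_assoc)

lemma rho_inv: "g \<in> carrier G \<Longrightarrow> rho g *v (rho (inv g) *v v) = v" "g \<in> carrier G \<Longrightarrow> rho (inv g) *v (rho g *v v) = v"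
  by (simp_all add: rho_mult)

lemma rho_mult_matrix: "g \<in> carrier G \<Longrightarrow> h \<in> carrier G \<Longrightarrow> rho g ** rho h = rho (g \<otimes> h)"
  by (subst matrix_eq) (simp add: rho_mult flip: matrix_vector_mul_assoc)

lemma rho_one_matrix: "rho \<one> = mat 1"
  by (subst matrix_eq) simp

lemma rho_conj_transpose: "g \<in> carrier G \<Longrightarrow> conjugate_transpose (rho g) = rho (inv g)"
proof -
  assume g: "g \<in> carrier G"
  have "b j = g \<otimes> b i \<longleftrightarrow> b i = inv g \<otimes> b j" for i j using g by (metis b_in inv_solve_left)
  then show ?thesis by (simp add: conjugate_transpose_def regular_rep_def vec_eq_iff)
qed

lemma rho_unitary: "g \<in> carrier G \<Longrightarrow> rho g \<in> unitary_group"
  by (simp add: unitary_group_def rho_conj_transpose rho_mult_matrix rho_one_matrix)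

lemma rho_hermitian: "g \<in> carrier G \<Longrightarrow> hermitian_inner (rho g *v v) (rho g *v w) = hermitian_inner v w"
  by (rule unitary_hermitian) (rule rho_unitary)

text \<open>The complex conjugate makes \<open>ch x\<close> itself the character by which \<open>G\<close>
  acts on this vector.\<close>

definition eigenvector :: "'a \<Rightarrow> complex^'n" where
  "eigenvector x = vector_of (\<lambda>y. cnj (ch x y))"

lemma rho_eigenvector:
  assumes "g \<in> carrier G" "x \<in> carrier G"
  shows "rho g *v eigenvector x = ch x g *s eigenvector x"
  by (rule vector_eqI)
     (use assms in \<open>simp add: coord_rho eigenvector_def ch_mult_right ch_inv_right\<close>)

lemma hermitian_rho_eigenvector:
  assumes "g \<in> carrier G" "x \<in> carrier G"
  shows "hermitian_inner (rho g *v v) (eigenvector x) = ch x g * hermitian_inner v (eigenvector x)"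
proof -
  have "hermitian_inner v (eigenvector x) = cnj (ch x g) * hermitian_inner (rho g *v v) (eigenvector x)"
    using rho_hermitian[OF assms(1), of v "eigenvector x"]
    by (simp add: rho_eigenvector[OF assms] hermitian_scale_right)
  then show ?thesis using ch_cnj[OF assms(2,1)] by (simp add: mult.assoc[symmetric])
qed

text \<open>Averaging the translates of \<open>v\<close> against a character projects \<open>v\<close> to the
  line of that character, because every character occurs exactly once in the regular representation. In this way
  the eigenvectors are tied to the orbits of components.\<close>

lemma sum_translates:
  assumes x: "x \<in> carrier G"
  shows "(\<Sum>g\<in>carrier G. cnj (ch x g) *s (rho g *v v)) = hermitian_inner v (eigenvector x) *s eigenvector x"
proof (rule vector_eqI)
  fix y assume y: "y \<in> carrier G"
  have "coord (\<Sum>g\<in>carrier G. cnj (ch x g) *s (rho g *v v)) y = (\<Sum>g\<in>carrier G. cnj (ch x g) * coord v (inv g \<otimes> y))"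
    using y by (simp add: coord_sum coord_rho)
  also have "\<dots> = (\<Sum>z\<in>carrier G. cnj (ch x (y \<otimes> inv z)) * coord v z)"
  proof (rule sum.reindex_bij_witness[where i = "\<lambda>z. y \<otimes> inv z" and j = "\<lambda>g. inv g \<otimes> y"])
    fix g assume g: "g \<in> carrier G"
    show "y \<otimes> inv (inv g \<otimes> y) = g" using g y by (simp add: inv_mult_group m_assoc[symmetric])
  next
    fix z assume z: "z \<in> carrier G"
    show "inv (y \<otimes> inv z) \<otimes> y = z" using z y by (simp add: inv_mult_group m_assoc)
  qed (use y in \<open>simp_all add: inv_mult_group m_assoc[symmetric]\<close>)
  also have "\<dots> = (\<Sum>z\<in>carrier G. coord v z * ch x z) * cnj (ch x y)"
    unfolding sum_distrib_right
    by (rule sum.cong) (use x y in \<open>simp_all add: ch_mult_right ch_inv_right\<close>)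
  also have "\<dots> = coord (hermitian_inner v (eigenvector x) *s eigenvector x) y"
    using y by (simp add: hermitian_coord eigenvector_def)
  finally show "coord (\<Sum>g\<in>carrier G. cnj (ch x g) *s (rho g *v v)) y =
     coord (hermitian_inner v (eigenvector x) *s eigenvector x) y" .
qed

text \<open>For \<open>g \<noteq> \<one>\<close>, multiplying the summation variable by some \<open>y\<close>
  with \<open>ch y g \<noteq> 1\<close> shows that the sum equals \<open>ch y g\<close> times itself.\<close>

lemma sum_characters:
  assumes "g \<in> carrier G"
  shows "(\<Sum>x\<in>carrier G. ch x g) = (if g = \<one> then of_nat (card (carrier G)) else 0)"
proof (cases "g = \<one>")
  case False
  then obtain y where y: "y \<in> carrier G" "ch y g \<noteq> 1" using ch_nondegenerate[OF assms] by blast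
  have "(\<Sum>x\<in>carrier G. ch x g) = (\<Sum>x\<in>carrier G. ch (y \<otimes> x) g)"
    by (rule sum.reindex_bij_witness[where i = "\<lambda>x. y \<otimes> x" and j = "\<lambda>x. inv y \<otimes> x"])
       (use y in \<open>simp_all add: m_assoc[symmetric]\<close>)
  also have "\<dots> = ch y g * (\<Sum>x\<in>carrier G. ch x g)"
    unfolding sum_distrib_left by (rule sum.cong) (use y assms in \<open>simp_all add: ch_mult_left\<close>)
  finally show ?thesis using y False by simp
qed simp

lemma card_carrier_nonzero: "of_nat (card (carrier G)) \<noteq> (0 :: complex)"
  using finite_carrier one_closed by (auto simp: card_eq_0_iff)

lemma eigenvectors_complete:
  assumes "\<And>x. x \<in> carrier G \<Longrightarrow> hermitian_inner v (eigenvector x) = 0"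
  shows "v = 0"
proof (rule vector_eqI)
  fix y assume y: "y \<in> carrier G"
  have "0 = (\<Sum>x\<in>carrier G. hermitian_inner v (eigenvector x) * cnj (ch x y))"
    using assms by simp
  also have "\<dots> = (\<Sum>x\<in>carrier G. \<Sum>z\<in>carrier G. coord v z * (ch x z * cnj (ch x y)))"
    by (simp add: hermitian_coord eigenvector_def sum_distrib_right mult.assoc)
  also have "\<dots> = (\<Sum>z\<in>carrier G. \<Sum>x\<in>carrier G. coord v z * (ch x z * cnj (ch x y)))" by (rule sum.swap)
  also have "\<dots> = (\<Sum>z\<in>carrier G. coord v z * (\<Sum>x\<in>carrier G. ch x (z \<otimes> inv y)))"
    by (rule sum.cong) (use y in \<open>simp_all add: sum_distrib_left ch_mult_right ch_inv_right\<close>)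
  also have "\<dots> = (\<Sum>z\<in>carrier G. if z = y then coord v z * of_nat (card (carrier G)) else 0)"
  proof (rule sum.cong)
    fix z assume z: "z \<in> carrier G"
    have "z \<otimes> inv y = \<one> \<longleftrightarrow> z = y"
      using y z by (metis inv_closed inv_equality inv_inv r_inv)
    then show "coord v z * (\<Sum>x\<in>carrier G. ch x (z \<otimes> inv y)) = (if z = y then coord v z * of_nat (card (carrier G)) else 0)"
      using y z by (simp add: sum_characters)
  qed simp
  also have "\<dots> = coord v y * of_nat (card (carrier G))" using y finite_carrier by simp
  finally show "coord v y = coord 0 y" using card_carrier_nonzero by simp
qed

definition annihilator :: "'a set \<Rightarrow> 'a set" where
  "annihilator S = {g \<in> carrier G. \<forall>x\<in>S. ch x g = 1}"

lemma annihilator_antimono: "S \<subseteq> T \<Longrightarrow> annihilator T \<subseteq> annihilator S"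
  by (auto simp: annihilator_def)

lemma subgroup_annihilator:
  assumes "S \<subseteq> carrier G" shows "subgroup (annihilator S) G"
proof (rule subgroupI)
  show "annihilator S \<noteq> {}" using assms by (auto simp: annihilator_def intro!: exI[of _ \<one>])
qed (use assms in \<open>auto simp: annihilator_def ch_inv_right ch_mult_right subset_iff\<close>)

text \<open>Let \<open>v\<close> be the indicator function of \<open>H\<close>. Being fixed by
  \<open>H\<close>, it involves only eigenvectors of characters that are trivial on \<open>H\<close>. An element
  that these characters do not detect fixes \<open>v\<close>, and so it lies in \<open>H\<close>.\<close>

lemma double_annihilator:
  assumes H: "subgroup H G" shows "annihilator (annihilator H) = H"
proof
  note HG = subgroup.subset[OF H]
  show "H \<subseteq> annihilator (annihilator H)"
    using HG ch_sym by (auto simp: annihilator_def subset_iff)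
  show "annihilator (annihilator H) \<subseteq> H"
  proof
    fix g assume g: "g \<in> annihilator (annihilator H)"
    then have gG: "g \<in> carrier G" by (simp add: annihilator_def)
    define v where "v = vector_of (\<lambda>x. of_bool (x \<in> H))"
    have inv: "rho h *v v = v" if h: "h \<in> H" for h
    proof (rule vector_eqI)
      fix x assume x: "x \<in> carrier G"
      have hG: "h \<in> carrier G" using h HG by blast
      have "inv h \<otimes> x \<in> H \<longleftrightarrow> x \<in> H"
      proof
        assume "inv h \<otimes> x \<in> H"
        then have "h \<otimes> (inv h \<otimes> x) \<in> H" using h subgroup.m_closed[OF H] by blast
        then show "x \<in> H" using hG x by (simp add: m_assoc[symmetric])
      next
        assume "x \<in> H"
        then show "inv h \<otimes> x \<in> H" using h subgroup.m_closed[OF H] subgroup.m_inv_closed[OF H] by blast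
      qed
      then show "coord (rho h *v v) x = coord v x" using hG x by (simp add: coord_rho v_def)
    qed
    have "rho g *v v - v = 0"
    proof (rule eigenvectors_complete)
      fix x assume x: "x \<in> carrier G"
      show "hermitian_inner (rho g *v v - v) (eigenvector x) = 0"
      proof (cases "hermitian_inner v (eigenvector x) = 0")
        case True
        then show ?thesis by (simp add: hermitian_diff_left hermitian_rho_eigenvector gG x)
      next
        case False
        have "ch h x = 1" if h: "h \<in> H" for h
        proof -
          have hG: "h \<in> carrier G" using h HG by blast
          have "ch x h * hermitian_inner v (eigenvector x) = hermitian_inner v (eigenvector x)"
            using hermitian_rho_eigenvector[OF hG x, of v] inv[OF h] by simp
          then show ?thesis using False ch_sym[OF hG x] by simp
        qed
        then have "x \<in> annihilator H" using x by (simp add: annihilator_def)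
        then have "ch x g = 1" using g by (simp add: annihilator_def)
        then show ?thesis by (simp add: hermitian_diff_left hermitian_rho_eigenvector gG x)
      qed
    qed
    then have "coord (rho g *v v) g = coord v g" by simp
    then show "g \<in> H" using gG subgroup.one_closed[OF H] by (simp add: coord_rho v_def split: if_splits)
  qed
qed

lemma annihilator_one: "annihilator {\<one>} = carrier G"
  by (auto simp: annihilator_def)

abbreviation translate :: "'a \<Rightarrow> (complex^'n) set \<Rightarrow> (complex^'n) set" where
  "translate g V \<equiv> move (rho g) V"

section \<open>The two subgroups attached to an invariant decomposition\<close>

definition invariant :: "(complex^'n) set set \<Rightarrow> bool" where
  "invariant \<Lambda> \<longleftrightarrow> proper_decomposition \<Lambda> \<and> (\<forall>g\<in>carrier G. decomposition_act (rho g) \<Lambda> = \<Lambda>)"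

text \<open>For an invariant decomposition, being met by a common component is an equivalence relation on the
  characters. Its classes correspond to the orbits of components, since all components of one orbit meet the
  same characters (\<open>meets_translate\<close>) and components that meet a common character lie in one orbit
  (\<open>meets_same_orbit\<close>).\<close>

definition meets :: "(complex^'n) set \<Rightarrow> 'a \<Rightarrow> bool" where
  "meets V x \<longleftrightarrow> (\<exists>v\<in>V. hermitian_inner v (eigenvector x) \<noteq> 0)"

text \<open>The characters by which one can multiply without leaving any class of characters that are met by a
  common component.\<close>

definition shifts :: "(complex^'n) set set \<Rightarrow> 'a set" where
  "shifts \<Lambda> = {x \<in> carrier G. \<forall>y\<in>carrier G. \<exists>V\<in>\<Lambda>. meets V y \<and> meets V (x \<otimes> y)}"

definition isotropies :: "(complex^'n) set set \<Rightarrow> 'a set" where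
  "isotropies \<Lambda> = {g \<in> carrier G. \<exists>V\<in>\<Lambda>. translate g V = V}"

definition lower :: "(complex^'n) set set \<Rightarrow> 'a set" where
  "lower \<Lambda> = annihilator (shifts \<Lambda>)"

text \<open>By duality the double annihilator of a set is the subgroup that it generates.\<close>

definition upper :: "(complex^'n) set set \<Rightarrow> 'a set" where
  "upper \<Lambda> = annihilator (annihilator (isotropies \<Lambda>))"

lemma subgroup_lower: "subgroup (lower \<Lambda>) G"
  unfolding lower_def by (rule subgroup_annihilator) (auto simp: shifts_def)

lemma subgroup_upper: "subgroup (upper \<Lambda>) G"
  unfolding upper_def by (rule subgroup_annihilator) (auto simp: annihilator_def)

lemma eigenvector_nonzero: "x \<in> carrier G \<Longrightarrow> eigenvector x \<noteq> 0"
  using coord_vector_of[of \<one> "\<lambda>y. cnj (ch x y)"] by (auto simp: eigenvector_def[symmetric])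

lemma meets_translate:
  assumes "g \<in> carrier G" "x \<in> carrier G" shows "meets (translate g V) x \<longleftrightarrow> meets V x"
  using assms by (simp add: meets_def hermitian_rho_eigenvector ch_nonzero)

lemma ex_meets:
  assumes "proper_decomposition \<Lambda>" "x \<in> carrier G" shows "\<exists>V\<in>\<Lambda>. meets V x"
proof (rule ccontr)
  assume "\<not> ?thesis"
  then have "eigenvector x = 0"
    by (intro orthogonal_to_decomposition[OF assms(1)]) (auto simp: meets_def)
  then show False using eigenvector_nonzero assms by blast
qed

lemma invariant_proper: "invariant \<Lambda> \<Longrightarrow> proper_decomposition \<Lambda>"
  by (simp add: invariant_def)

lemma translate_in: "invariant \<Lambda> \<Longrightarrow> V \<in> \<Lambda> \<Longrightarrow> g \<in> carrier G \<Longrightarrow> translate g V \<in> \<Lambda>"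
  unfolding invariant_def decomposition_act_def by blast

lemma translate_orthogonal:
  assumes "invariant \<Lambda>" "V \<in> \<Lambda>" "g \<in> carrier G" "translate g V \<noteq> V" "v \<in> V" "w \<in> V"
  shows "hermitian_inner (rho g *v v) w = 0"
  using proper_decomposition_orthogonal[OF invariant_proper[OF assms(1)] translate_in[OF assms(1-3)] assms(2,4)]
    assms(5,6) by blast

text \<open>Take \<open>v\<close> in a component that meets \<open>y\<close>. The squared length of its
  coordinate at the character \<open>z\<close> is a sum over \<open>g\<close> of \<open>cnj (ch z g)\<close>
  times the inner product of \<open>g v\<close> and \<open>v\<close>. Only elements of the stabilizer of the
  component contribute, the other translates of the component being orthogonal to it. A character that is
  trivial on all stabilizers therefore does not change the sum.\<close>

lemma annihilator_isotropies_subset_shifts: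
  assumes \<Lambda>: "invariant \<Lambda>" shows "annihilator (isotropies \<Lambda>) \<subseteq> shifts \<Lambda>"
proof
  fix x assume x: "x \<in> annihilator (isotropies \<Lambda>)"
  then have xG: "x \<in> carrier G" by (simp add: annihilator_def)
  have "\<exists>V\<in>\<Lambda>. meets V y \<and> meets V (x \<otimes> y)" if y: "y \<in> carrier G" for y
  proof -
    obtain V v where V: "V \<in> \<Lambda>" and v: "v \<in> V" "hermitian_inner v (eigenvector y) \<noteq> 0"
      using ex_meets[OF invariant_proper[OF \<Lambda>] y] by (auto simp: meets_def)
    have norm: "(\<Sum>g\<in>carrier G. cnj (ch z g) * hermitian_inner (rho g *v v) v)
       = hermitian_inner v (eigenvector z) * cnj (hermitian_inner v (eigenvector z))" if z: "z \<in> carrier G" for z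
    proof -
      have "(\<Sum>g\<in>carrier G. cnj (ch z g) * hermitian_inner (rho g *v v) v) =
          hermitian_inner (\<Sum>g\<in>carrier G. cnj (ch z g) *s (rho g *v v)) v"
        by (simp add: hermitian_sum_left hermitian_scale_left)
      also have "\<dots> = hermitian_inner v (eigenvector z) * hermitian_inner (eigenvector z) v"
        unfolding sum_translates[OF z] by (rule hermitian_scale_left)
      finally show ?thesis by (simp add: hermitian_sym[of "eigenvector z" v])
    qed
    have "(\<Sum>g\<in>carrier G. cnj (ch (x \<otimes> y) g) * hermitian_inner (rho g *v v) v) =
        (\<Sum>g\<in>carrier G. cnj (ch y g) * hermitian_inner (rho g *v v) v)"
    proof (rule sum.cong)
      fix g assume g: "g \<in> carrier G"
      show "cnj (ch (x \<otimes> y) g) * hermitian_inner (rho g *v v) v =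
        cnj (ch y g) * hermitian_inner (rho g *v v) v"
      proof (cases "translate g V = V")
        case True
        then have "g \<in> isotropies \<Lambda>" using g V by (auto simp: isotropies_def)
        then have "ch x g = 1" using x ch_sym[OF g xG] by (simp add: annihilator_def)
        then show ?thesis using ch_mult_left[OF xG y g] by simp
      next
        case False
        then show ?thesis using translate_orthogonal[OF \<Lambda> V g False v(1) v(1)] by simp
      qed
    qed simp
    then have "hermitian_inner v (eigenvector (x \<otimes> y)) \<noteq> 0"
      using norm[OF y] norm[of "x \<otimes> y"] xG y v(2) by (metis complex_cnj_zero_iff m_closed mult_eq_0_iff)
    then show ?thesis using V v by (auto simp: meets_def)
  qed
  then show "x \<in> shifts \<Lambda>" using xG by (simp add: shifts_def)
qed

lemma lower_subset_upper:
  assumes "invariant \<Lambda>" shows "lower \<Lambda> \<subseteq> upper \<Lambda>"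
  unfolding lower_def upper_def
  by (rule annihilator_antimono[OF annihilator_isotropies_subset_shifts[OF assms]])

lemma lower_antimono:
  assumes "refines \<Lambda> M" shows "lower M \<subseteq> lower \<Lambda>"
proof -
  have "\<exists>W\<in>M. meets W y \<and> meets W z" if "V \<in> \<Lambda>" "meets V y" "meets V z" for V y z
  proof -
    obtain W where "W \<in> M" "V \<subseteq> W" using assms \<open>V \<in> \<Lambda>\<close> by (auto simp: refines_def)
    then show ?thesis using that(2,3) unfolding meets_def by blast
  qed
  then have "shifts \<Lambda> \<subseteq> shifts M" unfolding shifts_def by blast
  then show ?thesis unfolding lower_def by (rule annihilator_antimono)
qed

text \<open>An element that stabilizes a component \<open>V\<close> stabilizes the component \<open>W
  \<supseteq> V\<close>, because \<open>W\<close> and its translate share the nonzero vectors of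
  \<open>V\<close>.\<close>

lemma upper_mono:
  assumes "refines \<Lambda> M" "invariant \<Lambda>" "invariant M" shows "upper \<Lambda> \<subseteq> upper M"
proof -
  have "isotropies \<Lambda> \<subseteq> isotropies M"
  proof
    fix g assume "g \<in> isotropies \<Lambda>"
    then obtain V where g: "g \<in> carrier G" and V: "V \<in> \<Lambda>" "translate g V = V"
      by (auto simp: isotropies_def)
    obtain W where W: "W \<in> M" "V \<subseteq> W" using assms(1) V by (auto simp: refines_def)
    obtain v where v: "v \<in> V" "v \<noteq> 0"
      using proper_decomposition_component(4)[OF invariant_proper[OF assms(2)] V(1)] by blast
    have "v \<in> translate g W" using v V(2) W(2) by (metis image_mono subsetD)
    then have "translate g W = W"
      using proper_decomposition_eqI[OF invariant_proper[OF assms(3)] translate_in[OF assms(3) W(1) g] W(1)] v W(2)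
      by blast
    then show "g \<in> isotropies M" using g W by (auto simp: isotropies_def)
  qed
  then show ?thesis unfolding upper_def by (intro annihilator_antimono)
qed

text \<open>If \<open>W\<close> were not in the orbit of \<open>V\<close>, it would be orthogonal to all
  translates of \<open>V\<close>, and hence to the eigenvector at \<open>x\<close>, which by
  \<open>sum_translates\<close> is a combination of such translates.\<close>

lemma meets_same_orbit:
  assumes \<Lambda>: "invariant \<Lambda>" and V: "V \<in> \<Lambda>" "W \<in> \<Lambda>" and x: "x \<in> carrier G" "meets V x" "meets W x"
  shows "\<exists>g\<in>carrier G. W = translate g V"
proof (rule ccontr)
  assume no: "\<not> ?thesis"
  obtain v w where v: "v \<in> V" "hermitian_inner v (eigenvector x) \<noteq> 0"
    and w: "w \<in> W" "hermitian_inner w (eigenvector x) \<noteq> 0"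
    using x by (auto simp: meets_def)
  have "hermitian_inner (rho g *v v) w = 0" if g: "g \<in> carrier G" for g
    using proper_decomposition_orthogonal[OF invariant_proper[OF \<Lambda>] translate_in[OF \<Lambda> V(1) g] V(2)] no g v(1) w(1)
    by blast
  then have "hermitian_inner (\<Sum>g\<in>carrier G. cnj (ch x g) *s (rho g *v v)) w = 0"
    by (simp add: hermitian_sum_left hermitian_scale_left)
  then have "hermitian_inner v (eigenvector x) * hermitian_inner (eigenvector x) w = 0"
    unfolding sum_translates[OF x(1)] by (simp add: hermitian_scale_left)
  then show False using v(2) w(2) by (simp add: hermitian_sym_0)
qed

text \<open>Closure under products is transitivity of the relation that two indices are met by a common
  component; this is where one component has to be translated into another.\<close>

lemma subgroup_shifts:
  assumes \<Lambda>: "invariant \<Lambda>" shows "subgroup (shifts \<Lambda>) G"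
proof (rule subgroupI)
  show "shifts \<Lambda> \<subseteq> carrier G" by (auto simp: shifts_def)
  have "\<one> \<in> shifts \<Lambda>" using ex_meets[OF invariant_proper[OF \<Lambda>]] by (simp add: shifts_def)
  then show "shifts \<Lambda> \<noteq> {}" by blast
  fix x assume "x \<in> shifts \<Lambda>"
  then have xG: "x \<in> carrier G" and x: "\<And>y. y \<in> carrier G \<Longrightarrow> \<exists>V\<in>\<Lambda>. meets V y \<and> meets V (x \<otimes> y)"
    by (auto simp: shifts_def)
  have "\<exists>V\<in>\<Lambda>. meets V y \<and> meets V (inv x \<otimes> y)" if y: "y \<in> carrier G" for y
    using x[of "inv x \<otimes> y"] xG y by (auto simp: m_assoc[symmetric])
  then show "inv x \<in> shifts \<Lambda>" using xG by (simp add: shifts_def)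
  fix x' assume "x' \<in> shifts \<Lambda>"
  then have x'G: "x' \<in> carrier G" and x': "\<And>y. y \<in> carrier G \<Longrightarrow> \<exists>V\<in>\<Lambda>. meets V y \<and> meets V (x' \<otimes> y)"
    by (auto simp: shifts_def)
  have "\<exists>V\<in>\<Lambda>. meets V y \<and> meets V (x \<otimes> x' \<otimes> y)" if y: "y \<in> carrier G" for y
  proof -
    obtain V where V: "V \<in> \<Lambda>" "meets V y" "meets V (x' \<otimes> y)" using x'[OF y] by blast
    obtain W where W: "W \<in> \<Lambda>" "meets W (x' \<otimes> y)" "meets W (x \<otimes> (x' \<otimes> y))" using x[of "x' \<otimes> y"] x'G y by auto
    obtain g where g: "g \<in> carrier G" "W = translate g V"
      using meets_same_orbit[OF \<Lambda> V(1) W(1) _ V(3) W(2)] x'G y by auto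
    then have "meets V (x \<otimes> (x' \<otimes> y))" using W(3) meets_translate xG x'G y by simp
    then show ?thesis using V xG x'G y by (auto simp: m_assoc)
  qed
  then show "x \<otimes> x' \<in> shifts \<Lambda>" using xG x'G by (simp add: shifts_def)
qed

text \<open>If the lower group is trivial, duality makes every character a shift, so that all characters are
  related and there is only one orbit of components. As \<open>G\<close> is abelian, all components then have
  the same stabilizer \<open>H\<close>, which is the upper group. If \<open>H\<close> were \<open>G\<close>, the
  orbit would consist of a single component, and this would be the whole space.\<close>

lemma lower_upper_not_extreme:
  assumes \<Lambda>: "invariant \<Lambda>" shows "\<not> (lower \<Lambda> = {\<one>} \<and> upper \<Lambda> = carrier G)"
proof
  assume *: "lower \<Lambda> = {\<one>} \<and> upper \<Lambda> = carrier G"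
  have shifts: "shifts \<Lambda> = carrier G"
    using double_annihilator[OF subgroup_shifts[OF \<Lambda>]] * annihilator_one by (simp add: lower_def)
  note P = invariant_proper[OF \<Lambda>]
  obtain V where V: "V \<in> \<Lambda>" "meets V \<one>" using ex_meets[OF P one_closed] by blast
  have all: "meets V x" if x: "x \<in> carrier G" for x
  proof -
    have "x \<in> shifts \<Lambda>" using x shifts by simp
    then have "\<exists>W\<in>\<Lambda>. meets W \<one> \<and> meets W (x \<otimes> \<one>)" unfolding shifts_def by blast
    then obtain W where W: "W \<in> \<Lambda>" "meets W \<one>" "meets W x" using x by auto
    then obtain g where "g \<in> carrier G" "W = translate g V"
      using meets_same_orbit[OF \<Lambda> V(1) W(1) one_closed V(2) W(2)] by blast
    then show ?thesis using W(3) meets_translate x by simp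
  qed
  have orbit: "\<exists>g\<in>carrier G. W = translate g V" if W: "W \<in> \<Lambda>" for W
  proof -
    obtain w where w: "w \<in> W" "w \<noteq> 0" using proper_decomposition_component(4)[OF P W] by blast
    then obtain x where x: "x \<in> carrier G" "meets W x"
      using eigenvectors_complete[of w] by (auto simp: meets_def)
    then show ?thesis using meets_same_orbit[OF \<Lambda> V(1) W x(1) all[OF x(1)] x(2)] by blast
  qed
  define H where "H = {g \<in> carrier G. translate g V = V}"
  have tt: "translate g (translate h U) = translate (g \<otimes> h) U" if "g \<in> carrier G" "h \<in> carrier G" for g h U
    using that by (simp add: image_image rho_mult)
  have iso: "isotropies \<Lambda> = H"
  proof
    show "H \<subseteq> isotropies \<Lambda>" using V by (auto simp: H_def isotropies_def)
    show "isotropies \<Lambda> \<subseteq> H"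
    proof
      fix h assume "h \<in> isotropies \<Lambda>"
      then obtain W where h: "h \<in> carrier G" and W: "W \<in> \<Lambda>" "translate h W = W" by (auto simp: isotropies_def)
      obtain g where g: "g \<in> carrier G" "W = translate g V" using orbit[OF W(1)] by blast
      have "translate (inv g) (translate h (translate g V)) = translate (inv g) (translate g V)"
        using W(2) g by simp
      moreover have "inv g \<otimes> (h \<otimes> g) = h" using g(1) h by (simp add: m_comm[of h g] m_assoc[symmetric])
      ultimately have "translate h V = V"
        using g(1) h tt[of h g V] tt[of "inv g" "h \<otimes> g" V] tt[of "inv g" g V] by simp
      then show "h \<in> H" using h by (simp add: H_def)
    qed
  qed
  have "subgroup H G"
  proof (rule subgroupI)
    show "H \<noteq> {}" by (auto simp: H_def intro!: exI[of _ \<one>])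
    fix g assume "g \<in> H"
    then have g: "g \<in> carrier G" "translate g V = V" by (auto simp: H_def)
    then have "translate (inv g) V = translate (inv g) (translate g V)" by simp
    also have "\<dots> = V" using g(1) by (simp add: tt)
    finally show "inv g \<in> H" using g by (simp add: H_def)
    fix h assume "h \<in> H"
    then have h: "h \<in> carrier G" "translate h V = V" by (auto simp: H_def)
    have "translate (g \<otimes> h) V = V" using tt[OF g(1) h(1), of V] g h by simp
    then show "g \<otimes> h \<in> H" using g h by (simp add: H_def)
  qed (auto simp: H_def)
  then have "H = carrier G" using * iso double_annihilator by (simp add: upper_def)
  then have "W = V" if "W \<in> \<Lambda>" for W using orbit[OF that] by (auto simp: H_def)
  then have "\<Union>\<Lambda> \<subseteq> V" by blast
  then have "vec.span (\<Union>\<Lambda>) \<subseteq> V"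
    using proper_decomposition_component(1)[OF P V(1)] by (rule vec.span_minimal)
  then show False
    using P proper_decomposition_component(2)[OF P V(1)] by (auto simp: proper_decomposition_def)
qed

section \<open>Decompositions with prescribed subgroups\<close>

text \<open>Functions supported on the coset \<open>c L\<close> on which \<open>K\<close> acts through the
  character \<open>ch x\<close>. Different \<open>x\<close> may agree on \<open>K\<close> and different
  \<open>c\<close> may lie in one coset; then they define the same subspace.\<close>

definition component :: "'a set \<Rightarrow> 'a set \<Rightarrow> 'a \<Rightarrow> 'a \<Rightarrow> (complex^'n) set" where
  "component K L c x = {v. (\<forall>y\<in>carrier G. coord v y \<noteq> 0 \<longrightarrow> inv c \<otimes> y \<in> L) \<and>
     (\<forall>h\<in>K. rho h *v v = ch x h *s v)}"

definition interval_decomposition :: "'a set \<Rightarrow> 'a set \<Rightarrow> (complex^'n) set set" where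
  "interval_decomposition K L = {component K L c x | c x. c \<in> carrier G \<and> x \<in> carrier G}"

definition delta :: "'a \<Rightarrow> complex^'n" where "delta y = vector_of (\<lambda>z. of_bool (z = y))"

text \<open>The projection to the \<open>ch x\<close>-eigenspace of \<open>K\<close> of the delta function at
  \<open>c\<close>, up to the factor \<open>card K\<close>.\<close>

definition basic :: "'a set \<Rightarrow> 'a \<Rightarrow> 'a \<Rightarrow> complex^'n" where
  "basic K c x = vector_of (\<lambda>y. if inv c \<otimes> y \<in> K then cnj (ch x (inv c \<otimes> y)) else 0)"

lemma subspace_component: "vec.subspace (component K L c x)"
  unfolding vec.subspace_def component_def
  by (auto simp: matrix_vector_right_distrib vector_scalar_commute vec.scale_right_distrib
      vec.scale_left_commute)

lemma subgroup_shift_iff: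
  assumes "subgroup K G" "h \<in> K" "y \<in> carrier G"
  shows "h \<otimes> y \<in> K \<longleftrightarrow> y \<in> K" "inv h \<otimes> y \<in> K \<longleftrightarrow> y \<in> K"
proof -
  have *: "h \<otimes> y \<in> K \<longleftrightarrow> y \<in> K" if "h \<in> K" for h
  proof
    have hG: "h \<in> carrier G" using subgroup.mem_carrier[OF assms(1) that] .
    assume "h \<otimes> y \<in> K"
    then have "inv h \<otimes> (h \<otimes> y) \<in> K"
      using subgroup.m_closed[OF assms(1)] subgroup.m_inv_closed[OF assms(1) that] by blast
    then show "y \<in> K" using hG assms(3) by (simp add: m_assoc[symmetric])
  qed (use that subgroup.m_closed[OF assms(1)] in blast)
  show "h \<otimes> y \<in> K \<longleftrightarrow> y \<in> K" "inv h \<otimes> y \<in> K \<longleftrightarrow> y \<in> K"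
    using *[OF assms(2)] *[OF subgroup.m_inv_closed[OF assms(1,2)]] .
qed

lemma basic_in_component:
  assumes K: "subgroup K G" "K \<subseteq> L" and c: "c \<in> carrier G" and x: "x \<in> carrier G"
  shows "basic K c x \<in> component K L c x"
proof -
  have "rho h *v basic K c x = ch x h *s basic K c x" if h: "h \<in> K" for h
  proof (rule vector_eqI)
    fix y assume y: "y \<in> carrier G"
    have hG: "h \<in> carrier G" using subgroup.mem_carrier[OF K(1) h] .
    have "inv c \<otimes> (inv h \<otimes> y) = inv h \<otimes> (inv c \<otimes> y)" using c hG y by (simp add: m_lcomm)
    moreover have "inv h \<otimes> (inv c \<otimes> y) \<in> K \<longleftrightarrow> inv c \<otimes> y \<in> K"
      using subgroup_shift_iff(2)[OF K(1) h, of "inv c \<otimes> y"] c y by simp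
    ultimately show "coord (rho h *v basic K c x) y = coord (ch x h *s basic K c x) y"
      using c hG y x by (simp add: coord_rho basic_def ch_mult_right[of x "inv h"] ch_inv_right[of x h])
  qed
  then show ?thesis using K(2) by (auto simp: component_def basic_def split: if_splits)
qed

lemma coord_basic: "subgroup K G \<Longrightarrow> c \<in> carrier G \<Longrightarrow> x \<in> carrier G \<Longrightarrow> coord (basic K c x) c = 1"
  by (simp add: basic_def subgroup.one_closed)

lemma component_coset:
  assumes L: "subgroup L G" and c: "c \<in> carrier G" "c' \<in> carrier G" "inv c \<otimes> c' \<in> L"
  shows "component K L c' x = component K L c x"
proof -
  have "inv c' \<otimes> y \<in> L \<longleftrightarrow> inv c \<otimes> y \<in> L" if y: "y \<in> carrier G" for y
  proof -
    have "inv c \<otimes> y = (inv c \<otimes> c') \<otimes> (inv c' \<otimes> y)"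
      using c(1,2) y by (simp add: m_assoc) (simp add: m_assoc[symmetric])
    then show ?thesis using subgroup_shift_iff(1)[OF L c(3), of "inv c' \<otimes> y"] c(2) y by simp
  qed
  then show ?thesis by (simp add: component_def)
qed

text \<open>Components are proper: if \<open>L \<noteq> G\<close>, a delta function outside of the coset
  violates the support condition, and if \<open>K\<close> is nontrivial, no delta function is an eigenvector.
  The components span because averaging \<open>basic K c x\<close> over all characters \<open>x\<close> gives
  the delta function at \<open>c\<close>.\<close>

lemma proper_interval_decomposition:
  assumes K: "subgroup K G" and L: "subgroup L G" and KL: "K \<subseteq> L"
    and ne: "\<not> (K = {\<one>} \<and> L = carrier G)"
  shows "proper_decomposition (interval_decomposition K L)"
  unfolding proper_decomposition_def
proof (intro conjI ballI)
  fix V assume "V \<in> interval_decomposition K L"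
  then obtain c x where V: "V = component K L c x" and c: "c \<in> carrier G" and x: "x \<in> carrier G"
    by (auto simp: interval_decomposition_def)
  show "vec.subspace V" unfolding V by (rule subspace_component)
  show "V \<noteq> {0}"
  proof
    assume "V = {0}"
    then have "basic K c x = 0" using basic_in_component[OF K KL c x] V by simp
    then show False using coord_basic[OF K c x] by simp
  qed
  show "V \<noteq> UNIV"
  proof
    assume "V = UNIV"
    then have all: "v \<in> component K L c x" for v using V by simp
    show False
    proof (cases "L = carrier G")
      case True
      then obtain h where h: "h \<in> K" "h \<noteq> \<one>" using ne subgroup.one_closed[OF K] by blast
      have hG: "h \<in> carrier G" using subgroup.mem_carrier[OF K h(1)] .
      have "rho h *v delta \<one> = ch x h *s delta \<one>" using all[of "delta \<one>"] h by (simp add: component_def)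
      then have "coord (rho h *v delta \<one>) h = coord (ch x h *s delta \<one>) h" by simp
      then show False using hG h by (simp add: coord_rho delta_def)
    next
      case False
      then obtain y where y: "y \<in> carrier G" "y \<notin> L" using subgroup.subset[OF L] by blast
      have "coord (delta (c \<otimes> y)) (c \<otimes> y) \<noteq> 0" using c y by (simp add: delta_def)
      then have "inv c \<otimes> (c \<otimes> y) \<in> L" using all[of "delta (c \<otimes> y)"] c y by (simp add: component_def)
      then show False using c y by (simp add: m_assoc[symmetric])
    qed
  qed
next
  show "pairwise (\<lambda>V W. \<forall>v\<in>V. \<forall>w\<in>W. hermitian_inner v w = 0) (interval_decomposition K L)"
  proof (rule pairwiseI, intro ballI, rule ccontr)
    fix V W v w assume V: "V \<in> interval_decomposition K L" and W: "W \<in> interval_decomposition K L"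
      and "V \<noteq> W" and v: "v \<in> V" and w: "w \<in> W" and nz: "hermitian_inner v w \<noteq> 0"
    obtain c x where cx: "V = component K L c x" "c \<in> carrier G" "x \<in> carrier G"
      using V by (auto simp: interval_decomposition_def)
    obtain c' x' where cx': "W = component K L c' x'" "c' \<in> carrier G" "x' \<in> carrier G"
      using W by (auto simp: interval_decomposition_def)
    have "\<exists>y\<in>carrier G. coord v y \<noteq> 0 \<and> coord w y \<noteq> 0"
    proof (rule ccontr)
      assume "\<not> ?thesis"
      then have "hermitian_inner v w = 0" unfolding hermitian_coord by (intro sum.neutral) auto
      then show False using nz by simp
    qed
    then obtain y where y: "y \<in> carrier G" "inv c \<otimes> y \<in> L" "inv c' \<otimes> y \<in> L"
      using v w cx cx' by (auto simp: component_def)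
    have "(inv c \<otimes> y) \<otimes> inv (inv c' \<otimes> y) = inv c \<otimes> c'"
      using y(1) cx(2) cx'(2) by (simp add: inv_mult_group m_assoc) (simp add: m_assoc[symmetric])
    then have coset: "inv c \<otimes> c' \<in> L"
      using y(2,3) subgroup.m_closed[OF L] subgroup.m_inv_closed[OF L] by metis
    have "ch x h = ch x' h" if h: "h \<in> K" for h
    proof -
      have hG: "h \<in> carrier G" using subgroup.mem_carrier[OF K h] .
      have "rho h *v v = ch x h *s v" "rho h *v w = ch x' h *s w"
        using v w h cx(1) cx'(1) by (simp_all add: component_def)
      then have "hermitian_inner (ch x h *s v) (ch x' h *s w) = hermitian_inner v w"
        using rho_hermitian[OF hG, of v w] by simp
      then have "(cnj (ch x' h) * ch x h) * hermitian_inner v w = hermitian_inner v w"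
        by (simp only: hermitian_scale_left hermitian_scale_right mult.assoc)
      then have "cnj (ch x' h) * ch x h = 1" using nz by simp
      then have "(ch x' h * cnj (ch x' h)) * ch x h = ch x' h" by (simp add: mult.assoc)
      then show ?thesis using ch_cnj[OF cx'(3) hG] by simp
    qed
    then have "component K L c' x' = component K L c' x" by (simp add: component_def)
    then have "V = W" using component_coset[OF L cx(2) cx'(2) coset] cx(1) cx'(1) by simp
    then show False using \<open>V \<noteq> W\<close> by simp
  qed
  have delta: "delta c \<in> vec.span (\<Union> (interval_decomposition K L))" if c: "c \<in> carrier G" for c
  proof -
    have "basic K c x \<in> \<Union> (interval_decomposition K L)" if "x \<in> carrier G" for x
      using basic_in_component[OF K KL c that] c that by (auto simp: interval_decomposition_def)
    then have "(1 / of_nat (card (carrier G))) *s (\<Sum>x\<in>carrier G. basic K c x) \<in> vec.span (\<Union> (interval_decomposition K L))"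
      by (intro vec.span_scale vec.span_sum vec.span_base)
    moreover have "(1 / of_nat (card (carrier G))) *s (\<Sum>x\<in>carrier G. basic K c x) = delta c"
    proof (rule vector_eqI)
      fix z assume z: "z \<in> carrier G"
      have eq: "inv c \<otimes> z = \<one> \<longleftrightarrow> z = c"
        using c z by (metis inv_closed inv_equality inv_inv l_inv)
      have "coord (\<Sum>x\<in>carrier G. basic K c x) z =
          (if inv c \<otimes> z \<in> K then cnj (\<Sum>x\<in>carrier G. ch x (inv c \<otimes> z)) else 0)"
        using z by (simp add: coord_sum basic_def)
      also have "\<dots> = of_bool (z = c) * of_nat (card (carrier G))"
        using c z subgroup.one_closed[OF K] by (auto simp: sum_characters eq)
      finally show "coord ((1 / of_nat (card (carrier G))) *s (\<Sum>x\<in>carrier G. basic K c x)) z = coord (delta c) z"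
        using card_carrier_nonzero z by (simp add: delta_def)
    qed
    ultimately show ?thesis by simp
  qed
  show "vec.span (\<Union> (interval_decomposition K L)) = UNIV"
  proof -
    have "v \<in> vec.span (\<Union> (interval_decomposition K L))" for v
    proof -
      have "v = (\<Sum>c\<in>carrier G. coord v c *s delta c)"
      proof (rule vector_eqI)
        fix y assume y: "y \<in> carrier G"
        have "(\<Sum>c\<in>carrier G. coord v c * of_bool (y = c)) = (\<Sum>c\<in>carrier G. if c = y then coord v y else 0)"
          by (rule sum.cong) auto
        then show "coord v y = coord (\<Sum>c\<in>carrier G. coord v c *s delta c) y"
          using y finite_carrier by (simp add: coord_sum delta_def)
      qed
      also have "\<dots> \<in> vec.span (\<Union> (interval_decomposition K L))"
        by (intro vec.span_sum vec.span_scale delta)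
      finally show ?thesis .
    qed
    then show ?thesis by blast
  qed
qed

lemma translate_component:
  assumes g: "g \<in> carrier G" and K: "K \<subseteq> carrier G" and c: "c \<in> carrier G" and x: "x \<in> carrier G"
  shows "translate g (component K L c x) = component K L (g \<otimes> c) x"
proof
  have sub: "rho g *v v \<in> component K L (g \<otimes> c) x"
    if g: "g \<in> carrier G" and c: "c \<in> carrier G" and v: "v \<in> component K L c x" for g c v
  proof -
    have "inv (g \<otimes> c) \<otimes> y \<in> L" if y: "y \<in> carrier G" "coord (rho g *v v) y \<noteq> 0" for y
    proof -
      have "inv c \<otimes> (inv g \<otimes> y) \<in> L" using v y g by (simp add: component_def coord_rho)
      then show ?thesis using g c y by (simp add: inv_mult_group m_assoc)
    qed
    moreover have "rho h *v (rho g *v v) = ch x h *s (rho g *v v)" if h: "h \<in> K" for h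
    proof -
      have hG: "h \<in> carrier G" using h K by blast
      have "rho h *v (rho g *v v) = rho g *v (rho h *v v)" using g hG by (simp add: rho_mult m_comm)
      then show ?thesis using v h by (simp add: component_def vector_scalar_commute)
    qed
    ultimately show ?thesis by (simp add: component_def)
  qed
  show "translate g (component K L c x) \<subseteq> component K L (g \<otimes> c) x" using sub[OF g c] by blast
  show "component K L (g \<otimes> c) x \<subseteq> translate g (component K L c x)"
  proof
    fix w assume "w \<in> component K L (g \<otimes> c) x"
    then have "rho (inv g) *v w \<in> component K L (inv g \<otimes> (g \<otimes> c)) x" using g c by (intro sub) auto
    moreover have "inv g \<otimes> (g \<otimes> c) = c" using g c by (simp add: m_assoc[symmetric])
    ultimately show "w \<in> translate g (component K L c x)"
      using rho_inv(1)[OF g, of w] by (metis imageI)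
  qed
qed

lemma invariant_interval_decomposition:
  assumes K: "subgroup K G" and L: "subgroup L G" and KL: "K \<subseteq> L"
    and ne: "\<not> (K = {\<one>} \<and> L = carrier G)"
  shows "invariant (interval_decomposition K L)"
  unfolding invariant_def
proof (intro conjI ballI)
  show "proper_decomposition (interval_decomposition K L)" by (rule proper_interval_decomposition[OF assms])
  fix g assume g: "g \<in> carrier G"
  note tc = translate_component[OF g subgroup.subset[OF K]]
  show "decomposition_act (rho g) (interval_decomposition K L) = interval_decomposition K L"
  proof
    show "decomposition_act (rho g) (interval_decomposition K L) \<subseteq> interval_decomposition K L"
      using tc g by (fastforce simp: decomposition_act_def interval_decomposition_def)
    show "interval_decomposition K L \<subseteq> decomposition_act (rho g) (interval_decomposition K L)"
    proof
      fix V assume "V \<in> interval_decomposition K L"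
      then obtain c x where V: "V = component K L c x" "c \<in> carrier G" "x \<in> carrier G"
        by (auto simp: interval_decomposition_def)
      have "g \<otimes> (inv g \<otimes> c) = c" using g V by (simp add: m_assoc[symmetric])
      then have "V = translate g (component K L (inv g \<otimes> c) x)"
        using tc[of "inv g \<otimes> c" x] g V by simp
      moreover have "component K L (inv g \<otimes> c) x \<in> interval_decomposition K L"
        using g V by (auto simp: interval_decomposition_def)
      ultimately show "V \<in> decomposition_act (rho g) (interval_decomposition K L)"
        unfolding decomposition_act_def by (rule image_eqI)
    qed
  qed
qed

lemma meets_component:
  assumes K: "subgroup K G" "K \<subseteq> L" and c: "c \<in> carrier G" and x: "x \<in> carrier G" and y: "y \<in> carrier G"
  shows "meets (component K L c x) y \<longleftrightarrow> (\<forall>h\<in>K. ch x h = ch y h)"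
proof
  assume "meets (component K L c x) y"
  then obtain v where v: "v \<in> component K L c x" "hermitian_inner v (eigenvector y) \<noteq> 0"
    by (auto simp: meets_def)
  show "\<forall>h\<in>K. ch x h = ch y h"
  proof
    fix h assume h: "h \<in> K"
    have hG: "h \<in> carrier G" using subgroup.mem_carrier[OF K(1) h] .
    have "rho h *v v = ch x h *s v" using v(1) h by (simp add: component_def)
    then show "ch x h = ch y h"
      using hermitian_rho_eigenvector[OF hG y, of v] v(2) by (simp add: hermitian_scale_left)
  qed
next
  assume eq: "\<forall>h\<in>K. ch x h = ch y h"
  define N where "N = {z \<in> carrier G. inv c \<otimes> z \<in> K}"
  have "hermitian_inner (basic K c x) (eigenvector y) = (\<Sum>z\<in>carrier G. if z \<in> N then ch y c else 0)"
    unfolding hermitian_coord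
  proof (rule sum.cong)
    fix z assume z: "z \<in> carrier G"
    show "coord (basic K c x) z * cnj (coord (eigenvector y) z) = (if z \<in> N then ch y c else 0)"
    proof (cases "z \<in> N")
      case True
      have "c \<otimes> (inv c \<otimes> z) = z" using c z by (simp add: m_assoc[symmetric])
      then have "ch y z = ch y c * ch y (inv c \<otimes> z)"
        using ch_mult_right[OF y c, of "inv c \<otimes> z"] c z by simp
      moreover have "ch x (inv c \<otimes> z) = ch y (inv c \<otimes> z)" using True eq by (simp add: N_def)
      ultimately show ?thesis
        using True z c y ch_cnj[OF y, of "inv c \<otimes> z"]
        by (simp add: basic_def eigenvector_def N_def mult.left_commute mult.commute)
    qed (use z in \<open>simp add: basic_def N_def\<close>)
  qed simp
  also have "\<dots> = of_nat (card N) * ch y c"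
    using finite_carrier by (simp add: N_def sum.If_cases Int_def)
  finally have "hermitian_inner (basic K c x) (eigenvector y) = of_nat (card N) * ch y c" .
  moreover have "c \<in> N" "finite N" using c subgroup.one_closed[OF K(1)] finite_carrier by (simp_all add: N_def)
  ultimately have "hermitian_inner (basic K c x) (eigenvector y) \<noteq> 0"
    using ch_nonzero[OF y c] by (auto simp: card_eq_0_iff)
  then show "meets (component K L c x) y"
    using basic_in_component[OF K c x] by (auto simp: meets_def)
qed

text \<open>The component of \<open>x\<close> meets precisely the characters that agree with \<open>ch
  x\<close> on \<open>K\<close>. Hence the shifts are the annihilator of \<open>K\<close>, and duality gives
  back \<open>K\<close>.\<close>

lemma lower_interval_decomposition:
  assumes K: "subgroup K G" and KL: "K \<subseteq> L"
  shows "lower (interval_decomposition K L) = K"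
proof -
  note m = meets_component[OF K KL]
  have "shifts (interval_decomposition K L) = annihilator K"
  proof (intro Set.set_eqI iffI)
    fix a assume "a \<in> shifts (interval_decomposition K L)"
    then have a: "a \<in> carrier G" and "\<exists>V\<in>interval_decomposition K L. meets V \<one> \<and> meets V (a \<otimes> \<one>)"
      unfolding shifts_def by blast+
    then obtain c x where "c \<in> carrier G" "x \<in> carrier G" "meets (component K L c x) \<one>" "meets (component K L c x) a"
      by (auto simp: interval_decomposition_def)
    then have "\<forall>h\<in>K. ch \<one> h = ch a h" using a m by auto
    then show "a \<in> annihilator K"
      using a subgroup.mem_carrier[OF K] ch_sym by (auto simp: annihilator_def)
  next
    fix a assume a: "a \<in> annihilator K"
    then have aG: "a \<in> carrier G" by (simp add: annihilator_def)
    have h1: "ch a h = 1" if "h \<in> K" for h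
      using a that ch_sym[OF aG subgroup.mem_carrier[OF K that]] by (simp add: annihilator_def)
    have "\<exists>V\<in>interval_decomposition K L. meets V y \<and> meets V (a \<otimes> y)" if y: "y \<in> carrier G" for y
    proof
      show "component K L \<one> y \<in> interval_decomposition K L"
        using y by (auto simp: interval_decomposition_def)
      have "ch y h = ch (a \<otimes> y) h" if "h \<in> K" for h
        using h1[OF that] ch_mult_left[OF aG y subgroup.mem_carrier[OF K that]] by simp
      then show "meets (component K L \<one> y) y \<and> meets (component K L \<one> y) (a \<otimes> y)"
        using m[OF one_closed y] y aG by simp
    qed
    then show "a \<in> shifts (interval_decomposition K L)"
      using aG unfolding shifts_def by blast
  qed
  then show ?thesis by (simp add: lower_def double_annihilator[OF K])
qed

text \<open>Translation by \<open>g\<close> moves a component from the coset \<open>c L\<close> to \<open>g c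
  L\<close>, so every component has the stabilizer \<open>L\<close>.\<close>

lemma upper_interval_decomposition:
  assumes K: "subgroup K G" and L: "subgroup L G" and KL: "K \<subseteq> L"
  shows "upper (interval_decomposition K L) = L"
proof -
  have "isotropies (interval_decomposition K L) = L"
  proof (intro Set.set_eqI iffI)
    fix g assume "g \<in> isotropies (interval_decomposition K L)"
    then obtain c x where g: "g \<in> carrier G" and c: "c \<in> carrier G" and x: "x \<in> carrier G"
      and eq: "translate g (component K L c x) = component K L c x"
      by (auto simp: isotropies_def interval_decomposition_def)
    have "basic K c x \<in> component K L (g \<otimes> c) x"
      using basic_in_component[OF K KL c x] eq translate_component[OF g subgroup.subset[OF K] c x] by simp
    then have "inv (g \<otimes> c) \<otimes> c \<in> L" using coord_basic[OF K c x] c by (simp add: component_def)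
    moreover have "inv (g \<otimes> c) \<otimes> c = inv g" using g c by (simp add: m_comm[of g c] inv_mult_group m_assoc)
    ultimately have "inv (inv g) \<in> L" using subgroup.m_inv_closed[OF L] by metis
    then show "g \<in> L" using g by simp
  next
    fix g assume gL: "g \<in> L"
    have g: "g \<in> carrier G" using subgroup.mem_carrier[OF L gL] .
    have "translate g (component K L \<one> \<one>) = component K L (g \<otimes> \<one>) \<one>"
      by (rule translate_component[OF g subgroup.subset[OF K]]) auto
    also have "\<dots> = component K L \<one> \<one>"
      by (rule component_coset[OF L]) (use g gL in auto)
    finally show "g \<in> isotropies (interval_decomposition K L)"
      using g by (auto simp: isotropies_def interval_decomposition_def)
  qed
  then show ?thesis by (simp add: upper_def double_annihilator[OF L])
qed

lemma refines_interval_decomposition: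
  assumes "K' \<subseteq> K" "L \<subseteq> L'"
  shows "refines (interval_decomposition K L) (interval_decomposition K' L')"
proof -
  have "component K L c x \<subseteq> component K' L' c x" for c x using assms by (auto simp: component_def)
  then show ?thesis by (fastforce simp: refines_def interval_decomposition_def)
qed

end

section \<open>Local constancy of the attached subgroups\<close>

lemma closedin_Collect_ball:
  assumes "\<And>i. i \<in> I \<Longrightarrow> closedin X {u \<in> topspace X. P i u}"
  shows "closedin X {u \<in> topspace X. \<forall>i\<in>I. P i u}"
proof -
  have "closedin X (\<Inter> (insert (topspace X) ((\<lambda>i. {u \<in> topspace X. P i u}) ` I)))"
    using assms by (intro closedin_Inter) auto
  moreover have "\<Inter> (insert (topspace X) ((\<lambda>i. {u \<in> topspace X. P i u}) ` I)) = {u \<in> topspace X. \<forall>i\<in>I. P i u}"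
    by auto
  ultimately show ?thesis by simp
qed

lemma closedin_Collect_bex:
  assumes "finite I" "\<And>i. i \<in> I \<Longrightarrow> closedin X {u \<in> topspace X. P i u}"
  shows "closedin X {u \<in> topspace X. \<exists>i\<in>I. P i u}"
proof -
  have "closedin X (\<Union> ((\<lambda>i. {u \<in> topspace X. P i u}) ` I))"
    using assms by (intro closedin_Union) auto
  moreover have "\<Union> ((\<lambda>i. {u \<in> topspace X. P i u}) ` I) = {u \<in> topspace X. \<exists>i\<in>I. P i u}"
    by auto
  ultimately show ?thesis by simp
qed

context character_pairing
begin

text \<open>This set and the next one record, for \<open>u\<close> in the unitary group, how \<open>G\<close>
  permutes the components of \<open>u \<Lambda>\<close> and which characters they meet. Together they determine
  the lower and the upper group of \<open>u \<Lambda>\<close> (\<open>lower_upper_of_type\<close>).\<close>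

definition transport_type :: "(complex^'n) set set \<Rightarrow> complex^'n^'n \<Rightarrow> ('a \<times> (complex^'n) set \<times> (complex^'n) set) set" where
  "transport_type \<Lambda> u = {(g, V, W) \<in> carrier G \<times> \<Lambda> \<times> \<Lambda>. translate g (move u V) \<subseteq> move u W}"

definition meeting_type :: "(complex^'n) set set \<Rightarrow> complex^'n^'n \<Rightarrow> ((complex^'n) set \<times> 'a) set" where
  "meeting_type \<Lambda> u = {(V, x) \<in> \<Lambda> \<times> carrier G. meets (move u V) x}"

lemma closedin_transport_type:
  assumes \<Lambda>: "proper_decomposition \<Lambda>" and g: "g \<in> carrier G" and V: "V \<in> \<Lambda>" and W: "W \<in> \<Lambda>"
  shows "closedin (top_of_set unitary_group) {u \<in> unitary_group. (g, V, W) \<in> transport_type \<Lambda> u}"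
proof -
  have "{u \<in> unitary_group. (g, V, W) \<in> transport_type \<Lambda> u} =
     {u \<in> topspace (top_of_set unitary_group). \<forall>(v, w)\<in>V \<times> \<Union> (\<Lambda> - {W}). hermitian_inner (rho g *v (u *v v)) (u *v w) = 0}"
    (is "?A = ?B")
  proof (intro Set.set_eqI iffI)
    fix u assume u: "u \<in> ?A"
    have "hermitian_inner (rho g *v (u *v v)) (u *v w) = 0" if v: "v \<in> V" and W': "W' \<in> \<Lambda>" "W' \<noteq> W" "w \<in> W'" for v w W'
    proof -
      have "rho g *v (u *v v) \<in> move u W" using u v by (auto simp: transport_type_def)
      then obtain w' where "w' \<in> W" "rho g *v (u *v v) = u *v w'" by blast
      then show ?thesis
        using unitary_hermitian[of u w' w] u proper_decomposition_orthogonal[OF \<Lambda> W W'(1) _ _ W'(3), of w'] W'(2) by auto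
    qed
    then show "u \<in> ?B" using u by auto
  next
    fix u assume u: "u \<in> ?B"
    then have uU: "u \<in> unitary_group" by simp
    have "rho g *v (u *v v) \<in> move u W" if v: "v \<in> V" for v
    proof (rule proper_decomposition_memI[OF proper_decomposition_act[OF uU \<Lambda>]])
      show "move u W \<in> decomposition_act u \<Lambda>" using W by (simp add: decomposition_act_def)
      fix Z z assume Z: "Z \<in> decomposition_act u \<Lambda>" "Z \<noteq> move u W" "z \<in> Z"
      then obtain W' where "W' \<in> \<Lambda>" "Z = move u W'" by (auto simp: decomposition_act_def)
      moreover from this Z obtain w where "w \<in> W'" "z = u *v w" by auto
      ultimately show "hermitian_inner (rho g *v (u *v v)) z = 0" using u v Z by fastforce
    qed
    then show "u \<in> ?A" using uU g V W by (auto simp: transport_type_def)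
  qed
  moreover have "closedin (top_of_set unitary_group) ?B"
  proof (rule closedin_Collect_ball)
    fix p assume "p \<in> V \<times> \<Union> (\<Lambda> - {W})"
    show "closedin (top_of_set unitary_group) {u \<in> topspace (top_of_set unitary_group).
       case p of (v, w) \<Rightarrow> hermitian_inner (rho g *v (u *v v)) (u *v w) = 0}"
      using closedin_unitary_hermitian_0(1)[of "rho g" "fst p" "snd p"] by (simp add: case_prod_unfold)
  qed
  ultimately show ?thesis by simp
qed

lemma closedin_not_meeting_type:
  assumes "V \<in> \<Lambda>" "x \<in> carrier G"
  shows "closedin (top_of_set unitary_group) {u \<in> unitary_group. (V, x) \<notin> meeting_type \<Lambda> u}"
proof -
  have "{u \<in> unitary_group. (V, x) \<notin> meeting_type \<Lambda> u} =
     {u \<in> topspace (top_of_set unitary_group). \<forall>v\<in>V. hermitian_inner (u *v v) (eigenvector x) = 0}"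
    using assms by (auto simp: meeting_type_def meets_def)
  moreover have "closedin (top_of_set unitary_group)
      {u \<in> topspace (top_of_set unitary_group). \<forall>v\<in>V. hermitian_inner (u *v v) (eigenvector x) = 0}"
    by (rule closedin_Collect_ball) (simp add: closedin_unitary_hermitian_0(2))
  ultimately show ?thesis by simp
qed

lemma image_unitary_inj:
  assumes "u \<in> unitary_group" "move u V = move u W" shows "V = W"
proof -
  have "(\<lambda>v. conjugate_transpose u *v v) ` (move u V) = V" for V
    using unitary_inverse(1)[OF assms(1)] by (simp add: image_image)
  then show ?thesis using assms(2) by metis
qed

lemma invariant_act_iff:
  assumes \<Lambda>: "proper_decomposition \<Lambda>" and u: "u \<in> unitary_group"
  shows "invariant (decomposition_act u \<Lambda>) \<longleftrightarrow> (\<forall>g\<in>carrier G. \<forall>V\<in>\<Lambda>. \<exists>W\<in>\<Lambda>. (g, V, W) \<in> transport_type \<Lambda> u)"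
proof
  assume inv: "invariant (decomposition_act u \<Lambda>)"
  show "\<forall>g\<in>carrier G. \<forall>V\<in>\<Lambda>. \<exists>W\<in>\<Lambda>. (g, V, W) \<in> transport_type \<Lambda> u"
  proof (intro ballI)
    fix g V assume g: "g \<in> carrier G" and V: "V \<in> \<Lambda>"
    have "translate g (move u V) \<in> decomposition_act u \<Lambda>"
      by (rule translate_in[OF inv _ g]) (use V in \<open>simp add: decomposition_act_def\<close>)
    then obtain W where "W \<in> \<Lambda>" "translate g (move u V) = move u W"
      by (auto simp: decomposition_act_def)
    then show "\<exists>W\<in>\<Lambda>. (g, V, W) \<in> transport_type \<Lambda> u" using g V by (auto simp: transport_type_def)
  qed
next
  assume all: "\<forall>g\<in>carrier G. \<forall>V\<in>\<Lambda>. \<exists>W\<in>\<Lambda>. (g, V, W) \<in> transport_type \<Lambda> u"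
  let ?M = "decomposition_act u \<Lambda>"
  note P = proper_decomposition_act[OF u \<Lambda>]
  have r: "refines (decomposition_act (rho g) ?M) ?M" if g: "g \<in> carrier G" for g
    unfolding refines_def
  proof
    fix Z assume "Z \<in> decomposition_act (rho g) ?M"
    then obtain V where V: "V \<in> \<Lambda>" "Z = translate g (move u V)" by (auto simp: decomposition_act_def)
    obtain W where "W \<in> \<Lambda>" "(g, V, W) \<in> transport_type \<Lambda> u" using all g V(1) by blast
    then show "\<exists>W\<in>?M. Z \<subseteq> W" using V(2) by (auto simp: decomposition_act_def transport_type_def)
  qed
  show "invariant ?M"
    unfolding invariant_def
  proof (intro conjI ballI)
    fix g assume g: "g \<in> carrier G"
    have "decomposition_act (rho g) (decomposition_act (rho (inv g)) ?M) = ?M"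
      using g decomposition_act_mult[of "rho g" "rho (inv g)" ?M] by (simp add: rho_mult_matrix rho_one_matrix)
    then have "refines ?M (decomposition_act (rho g) ?M)"
      using refines_act[OF r[OF inv_closed[OF g]], of "rho g"] by simp
    then show "decomposition_act (rho g) ?M = ?M"
      using refines_antisym[OF proper_decomposition_act[OF rho_unitary[OF g] P] P r[OF g]] by blast
  qed (rule P)
qed

lemma transport_type_iff:
  assumes \<Lambda>: "proper_decomposition \<Lambda>" and u: "u \<in> unitary_group" and inv: "invariant (decomposition_act u \<Lambda>)"
    and g: "g \<in> carrier G" and V: "V \<in> \<Lambda>" and W: "W \<in> \<Lambda>"
  shows "(g, V, W) \<in> transport_type \<Lambda> u \<longleftrightarrow> translate g (move u V) = move u W"
proof
  assume "(g, V, W) \<in> transport_type \<Lambda> u"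
  then have "translate g (move u V) \<subseteq> move u W" by (simp add: transport_type_def)
  then show "translate g (move u V) = move u W"
    by (rule proper_decomposition_subset_eq[OF invariant_proper[OF inv] translate_in[OF inv _ g], rotated 2])
       (use V W in \<open>simp_all add: decomposition_act_def\<close>)
qed (use g V W in \<open>simp add: transport_type_def\<close>)

text \<open>The conditions \<open>transport_type \<Lambda> u \<subseteq> transport_type \<Lambda> u'\<close>
  and \<open>meeting_type \<Lambda> u' \<subseteq> meeting_type \<Lambda> u\<close> are closed in
  \<open>u'\<close>, but the reverse inclusions are not visibly so. They come for free: a transport type is the
  graph of a map, so an inclusion between two of them is an equality. Every character is met by some component,
  the components that meet it form one orbit, and the orbits are known from the transport type.\<close>

lemma type_rigid:
  assumes \<Lambda>: "proper_decomposition \<Lambda>" and u: "u \<in> unitary_group" "invariant (decomposition_act u \<Lambda>)"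
    and u': "u' \<in> unitary_group" "invariant (decomposition_act u' \<Lambda>)"
    and sub: "transport_type \<Lambda> u \<subseteq> transport_type \<Lambda> u'" "meeting_type \<Lambda> u' \<subseteq> meeting_type \<Lambda> u"
  shows "transport_type \<Lambda> u' = transport_type \<Lambda> u" "meeting_type \<Lambda> u' = meeting_type \<Lambda> u"
proof -
  note t = transport_type_iff[OF \<Lambda> u] and t' = transport_type_iff[OF \<Lambda> u']
  show "transport_type \<Lambda> u' = transport_type \<Lambda> u"
  proof (rule subset_antisym[OF _ sub(1)])
    show "transport_type \<Lambda> u' \<subseteq> transport_type \<Lambda> u"
    proof
      fix p assume p: "p \<in> transport_type \<Lambda> u'"
      obtain g V W where pe: "p = (g, V, W)" by (cases p) auto
      have gVW: "g \<in> carrier G" "V \<in> \<Lambda>" "W \<in> \<Lambda>" using p by (auto simp: pe transport_type_def)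
      obtain W' where W': "W' \<in> \<Lambda>" "(g, V, W') \<in> transport_type \<Lambda> u"
        using u(2) gVW unfolding invariant_act_iff[OF \<Lambda> u(1)] by blast
      then have "(g, V, W') \<in> transport_type \<Lambda> u'" using sub(1) by blast
      then have 1: "translate g (move u' V) = move u' W'"
        by (rule iffD1[OF t'[OF gVW(1,2) W'(1)]])
      have 2: "translate g (move u' V) = move u' W"
        using p unfolding pe by (rule iffD1[OF t'[OF gVW]])
      have "W = W'" by (rule image_unitary_inj[OF u'(1) trans[OF sym[OF 2] 1]])
      then show "p \<in> transport_type \<Lambda> u" using W'(2) unfolding pe by blast
    qed
  qed
  show "meeting_type \<Lambda> u' = meeting_type \<Lambda> u"
  proof (rule subset_antisym[OF sub(2)])
    show "meeting_type \<Lambda> u \<subseteq> meeting_type \<Lambda> u'"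
    proof
      fix p assume p: "p \<in> meeting_type \<Lambda> u"
      obtain V x where pe: "p = (V, x)" by (cases p)
      have V: "V \<in> \<Lambda>" and x: "x \<in> carrier G" using p by (auto simp: pe meeting_type_def)
      obtain W where W: "W \<in> \<Lambda>" "meets (move u' W) x"
        using ex_meets[OF invariant_proper[OF u'(2)] x] by (auto simp: decomposition_act_def)
      then have "(W, x) \<in> meeting_type \<Lambda> u" using x sub(2) by (auto simp: meeting_type_def)
      then obtain g where g: "g \<in> carrier G" "move u V = translate g (move u W)"
      proof -
        have mem: "move u W \<in> decomposition_act u \<Lambda>" "move u V \<in> decomposition_act u \<Lambda>"
          using V W(1) by (simp_all add: decomposition_act_def)
        have "meets (move u W) x" "meets (move u V) x"
          using p \<open>(W, x) \<in> meeting_type \<Lambda> u\<close> by (simp_all add: pe meeting_type_def)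
        then show thesis using meets_same_orbit[OF u(2) mem x] that by blast
      qed
      have "(g, W, V) \<in> transport_type \<Lambda> u" by (rule iffD2[OF t[OF g(1) W(1) V]]) (rule g(2)[symmetric])
      then have "(g, W, V) \<in> transport_type \<Lambda> u'" using sub(1) by blast
      then have "translate g (move u' W) = move u' V" by (rule iffD1[OF t'[OF g(1) W(1) V]])
      then have "meets (move u' V) x" using W(2) meets_translate[OF g(1) x, of "move u' W"] by simp
      then show "p \<in> meeting_type \<Lambda> u'" using V x by (simp add: pe meeting_type_def)
    qed
  qed
qed

lemma lower_upper_of_type:
  assumes \<Lambda>: "proper_decomposition \<Lambda>" and u: "u \<in> unitary_group" "invariant (decomposition_act u \<Lambda>)"
  shows "lower (decomposition_act u \<Lambda>) = annihilator {x \<in> carrier G. \<forall>y\<in>carrier G. \<exists>V\<in>\<Lambda>.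
      (V, y) \<in> meeting_type \<Lambda> u \<and> (V, x \<otimes> y) \<in> meeting_type \<Lambda> u}"
    and "upper (decomposition_act u \<Lambda>) =
      annihilator (annihilator {g \<in> carrier G. \<exists>V\<in>\<Lambda>. (g, V, V) \<in> transport_type \<Lambda> u})"
proof -
  have "shifts (decomposition_act u \<Lambda>) = {x \<in> carrier G. \<forall>y\<in>carrier G. \<exists>V\<in>\<Lambda>.
      (V, y) \<in> meeting_type \<Lambda> u \<and> (V, x \<otimes> y) \<in> meeting_type \<Lambda> u}"
    by (auto simp: shifts_def decomposition_act_def meeting_type_def)
  then show "lower (decomposition_act u \<Lambda>) = annihilator {x \<in> carrier G. \<forall>y\<in>carrier G. \<exists>V\<in>\<Lambda>.
      (V, y) \<in> meeting_type \<Lambda> u \<and> (V, x \<otimes> y) \<in> meeting_type \<Lambda> u}"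
    by (simp only: lower_def)
  have "isotropies (decomposition_act u \<Lambda>) = {g \<in> carrier G. \<exists>V\<in>\<Lambda>. translate g (move u V) = move u V}"
    by (simp add: isotropies_def decomposition_act_def)
  also have "\<dots> = {g \<in> carrier G. \<exists>V\<in>\<Lambda>. (g, V, V) \<in> transport_type \<Lambda> u}"
    by (intro Collect_cong conj_cong bex_cong refl) (simp add: transport_type_iff[OF \<Lambda> u])
  finally show "upper (decomposition_act u \<Lambda>) =
      annihilator (annihilator {g \<in> carrier G. \<exists>V\<in>\<Lambda>. (g, V, V) \<in> transport_type \<Lambda> u})"
    by (simp only: upper_def)
qed

text \<open>The unitary matrices \<open>u\<close> with \<open>u \<Lambda>\<close> invariant form a closed set,
  which by \<open>type_rigid\<close> is a finite disjoint union of closed sets of constant type. Any condition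
  on the lower and upper groups selects some of these sets.\<close>

lemma closedin_invariant_level:
  "closedin (Objects decomposition_poset) {\<Lambda>. invariant \<Lambda> \<and> Q (lower \<Lambda>) (upper \<Lambda>)}"
proof (rule closedin_decomposition_objects)
  show "{\<Lambda>. invariant \<Lambda> \<and> Q (lower \<Lambda>) (upper \<Lambda>)} \<subseteq> {\<Lambda>. proper_decomposition \<Lambda>}"
    using invariant_proper by blast
  fix \<Lambda> :: "(complex^'n) set set" assume \<Lambda>: "proper_decomposition \<Lambda>"
  let ?U = "top_of_set (unitary_group :: (complex^'n^'n) set)"
  let ?A = "carrier G \<times> \<Lambda> \<times> \<Lambda>" and ?B = "\<Lambda> \<times> carrier G"
  have fin: "finite ?A" "finite ?B" using finite_proper_decomposition[OF \<Lambda>] finite_carrier by auto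
  define I where "I = {u \<in> unitary_group. invariant (decomposition_act u \<Lambda>)}"
  define J where "J = {u \<in> I. Q (lower (decomposition_act u \<Lambda>)) (upper (decomposition_act u \<Lambda>))}"
  \<comment> \<open>for the types of some \<open>u\<close> in \<open>I\<close>, this is a closed description of the matrices in \<open>I\<close> with the same types\<close>
  define near where "near = (\<lambda>(A, B). {u \<in> I. A \<subseteq> transport_type \<Lambda> u \<and> meeting_type \<Lambda> u \<subseteq> B})"
  have I: "closedin ?U I"
  proof -
    have "I = {u \<in> topspace ?U. \<forall>g\<in>carrier G. \<forall>V\<in>\<Lambda>. \<exists>W\<in>\<Lambda>. (g, V, W) \<in> transport_type \<Lambda> u}"
      using invariant_act_iff[OF \<Lambda>] by (auto simp: I_def)
    also have "closedin ?U \<dots>"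
      using finite_proper_decomposition[OF \<Lambda>] closedin_transport_type[OF \<Lambda>]
      by (intro closedin_Collect_ball closedin_Collect_bex) simp_all
    finally show ?thesis .
  qed
  have near: "closedin ?U (near (A, B))" if AB: "A \<subseteq> ?A" for A B
  proof -
    have "near (A, B) = I \<inter> {u \<in> topspace ?U. \<forall>p\<in>A. p \<in> transport_type \<Lambda> u} \<inter>
        {u \<in> topspace ?U. \<forall>p\<in>?B - B. p \<notin> meeting_type \<Lambda> u}"
      by (auto simp: near_def I_def meeting_type_def)
    also have "closedin ?U \<dots>"
    proof (intro closedin_Int I closedin_Collect_ball)
      fix p assume "p \<in> A"
      then obtain g V W where "p = (g, V, W)" "g \<in> carrier G" "V \<in> \<Lambda>" "W \<in> \<Lambda>" using AB by auto
      then show "closedin ?U {u \<in> topspace ?U. p \<in> transport_type \<Lambda> u}"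
        using closedin_transport_type[OF \<Lambda>] by simp
    next
      fix p assume "p \<in> ?B - B"
      then obtain V x where "p = (V, x)" "V \<in> \<Lambda>" "x \<in> carrier G" by auto
      then show "closedin ?U {u \<in> topspace ?U. p \<notin> meeting_type \<Lambda> u}"
        using closedin_not_meeting_type by simp
    qed
    finally show ?thesis .
  qed
  have types: "transport_type \<Lambda> u \<subseteq> ?A" "meeting_type \<Lambda> u \<subseteq> ?B" for u
    by (auto simp: transport_type_def meeting_type_def)
  have "J = (\<Union>p\<in>(\<lambda>u. (transport_type \<Lambda> u, meeting_type \<Lambda> u)) ` J. near p)"
  proof (intro subset_antisym subsetI)
    fix u assume "u \<in> J"
    then have "u \<in> near (transport_type \<Lambda> u, meeting_type \<Lambda> u)" by (simp add: near_def J_def)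
    then show "u \<in> (\<Union>p\<in>(\<lambda>u. (transport_type \<Lambda> u, meeting_type \<Lambda> u)) ` J. near p)" using \<open>u \<in> J\<close> by blast
  next
    fix u' assume "u' \<in> (\<Union>p\<in>(\<lambda>u. (transport_type \<Lambda> u, meeting_type \<Lambda> u)) ` J. near p)"
    then obtain u where u: "u \<in> J" and near': "u' \<in> near (transport_type \<Lambda> u, meeting_type \<Lambda> u)" by blast
    have uI: "u \<in> unitary_group" "invariant (decomposition_act u \<Lambda>)" using u by (auto simp: J_def I_def)
    have u'I: "u' \<in> unitary_group" "invariant (decomposition_act u' \<Lambda>)" using near' by (auto simp: near_def I_def)
    have "transport_type \<Lambda> u' = transport_type \<Lambda> u" "meeting_type \<Lambda> u' = meeting_type \<Lambda> u"
      by (rule type_rigid[OF \<Lambda> uI u'I]; use near' in \<open>simp add: near_def\<close>)+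
    then have "lower (decomposition_act u' \<Lambda>) = lower (decomposition_act u \<Lambda>)"
       "upper (decomposition_act u' \<Lambda>) = upper (decomposition_act u \<Lambda>)"
      unfolding lower_upper_of_type[OF \<Lambda> uI] lower_upper_of_type[OF \<Lambda> u'I] by simp_all
    then show "u' \<in> J" using u u'I by (simp add: J_def I_def)
  qed
  moreover have "closedin ?U (\<Union>p\<in>(\<lambda>u. (transport_type \<Lambda> u, meeting_type \<Lambda> u)) ` J. near p)"
  proof (rule closedin_Union)
    have "(\<lambda>u. (transport_type \<Lambda> u, meeting_type \<Lambda> u)) ` J \<subseteq> Pow ?A \<times> Pow ?B" using types by blast
    then have "finite ((\<lambda>u. (transport_type \<Lambda> u, meeting_type \<Lambda> u)) ` J)"
      by (rule finite_subset) (intro finite_cartesian_product finite_Pow_iff[THEN iffD2] fin)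
    then show "finite (near ` (\<lambda>u. (transport_type \<Lambda> u, meeting_type \<Lambda> u)) ` J)"
      by (rule finite_imageI)
    fix Z assume "Z \<in> near ` (\<lambda>u. (transport_type \<Lambda> u, meeting_type \<Lambda> u)) ` J"
    then show "closedin ?U Z" using near[OF types(1)] by auto
  qed
  ultimately have "closedin ?U J" by simp
  moreover have "J = {u \<in> unitary_group. decomposition_act u \<Lambda> \<in> {\<Lambda>. invariant \<Lambda> \<and> Q (lower \<Lambda>) (upper \<Lambda>)}}"
    by (auto simp: J_def I_def)
  ultimately show "closedin ?U {u \<in> unitary_group. decomposition_act u \<Lambda> \<in> {\<Lambda>. invariant \<Lambda> \<and> Q (lower \<Lambda>) (upper \<Lambda>)}}"
    by (simp only:)
qed

end

section \<open>Fixed points of the realization\<close>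

text \<open>An order automorphism that fixes a point permutes the finite chain of vertices of positive weight.
  It preserves the number of elements below a vertex, and in a chain this number determines the vertex.\<close>

lemma (in realized_poset) realization_map_fixed_iff:
  assumes f: "\<And>a. a \<in> objects P \<Longrightarrow> f a \<in> objects P"
      "\<And>a. a \<in> objects P \<Longrightarrow> f' a \<in> objects P"
      "\<And>a. a \<in> objects P \<Longrightarrow> f (f' a) = a"
      "\<And>a. a \<in> objects P \<Longrightarrow> f' (f a) = a"
    and mono: "\<And>a b. (a, b) \<in> arrows P \<Longrightarrow> (f a, f b) \<in> arrows P"
      "\<And>a b. (a, b) \<in> arrows P \<Longrightarrow> (f' a, f' b) \<in> arrows P"
    and c: "c \<in> topspace (realization P)"
  shows "realization_map f c = c \<longleftrightarrow> (\<forall>v. class_weight c v \<noteq> 0 \<longrightarrow> f v = v)"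
proof -
  obtain m x t where z: "(m, x, t) \<in> cells P" "c = point P (m, x, t)"
    using c by (auto simp: topspace_realization)
  have xn: "x \<in> topspace (nerve P m)" using z(1) by (simp add: cells_def)
  have xo: "x i \<in> objects P" if "i \<le> m" for i using xn that by (simp add: topspace_nerve)
  have cell: "(m', restrict (h \<circ> x') {..m'}, t') \<in> cells P"
    if "(m', x', t') \<in> cells P" "\<And>a. a \<in> objects P \<Longrightarrow> h a \<in> objects P"
      "\<And>a b. (a, b) \<in> arrows P \<Longrightarrow> (h a, h b) \<in> arrows P" for m' x' t' h
    using that by (auto simp: cells_def topspace_nerve)
  show ?thesis
  proof
    assume mapc: "realization_map f c = c"
    have "(m, restrict (f \<circ> x) {..m}, t) \<in> realization_map f c"
      unfolding realization_map_def using self_in_point[of "(m, x, t)" P] z(2) by force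
    then have same: "point P (m, restrict (f \<circ> x) {..m}, t) = point P (m, x, t)"
      using mapc z(2) in_point_iff by metis
    have w: "weight (m, restrict (f \<circ> x) {..m}, t) = weight (m, x, t)"
      by (rule ext) (simp only: weight_def average_point[OF same])
    define S where "S = {v. weight (m, x, t) v \<noteq> 0}"
    have Sx: "\<exists>i\<le>m. x i = v \<and> t i \<noteq> 0" if "v \<in> S" for v
      using that weight_eq_0_iff[OF z(1)] by (auto simp: S_def)
    have "S \<subseteq> x ` {..m}" using Sx by fastforce
    then have "finite S" by (rule finite_subset) simp
    have So: "v \<in> objects P" if "v \<in> S" for v using Sx[OF that] xo by blast
    have fS: "f v \<in> S" if vS: "v \<in> S" for v
    proof -
      obtain i where i: "i \<le> m" "x i = v" "t i \<noteq> 0" using Sx[OF vS] by blast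
      have "weight (m, restrict (f \<circ> x) {..m}, t) (f v) \<noteq> 0"
        using i weight_eq_0_iff[OF cell[OF z(1) f(1) mono(1)], where v = "f v"] by auto
      then show ?thesis by (simp add: w S_def)
    qed
    have inj: "inj_on f S" by (rule inj_onI) (metis So f(4))
    have surj: "f ` S = S" using endo_inj_surj[OF \<open>finite S\<close> _ inj] fS by blast
    have chain: "(u, v) \<in> arrows P \<or> (v, u) \<in> arrows P" if uv: "u \<in> S" "v \<in> S" for u v
    proof -
      obtain i j where "i \<le> m" "x i = u" "j \<le> m" "x j = v" using Sx[OF uv(1)] Sx[OF uv(2)] by blast
      then show ?thesis using nerve_mono[OF xn, of i j] nerve_mono[OF xn, of j i] by (cases "i \<le> j") auto
    qed
    \<comment> \<open>the rank argument: \<open>f\<close> maps the elements below \<open>v\<close> bijectively to those below \<open>f v\<close>\<close>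
    define D where "D = (\<lambda>v. {u \<in> S. (u, v) \<in> arrows P})"
    have card: "card (D (f v)) = card (D v)" if v: "v \<in> S" for v
    proof -
      have "D (f v) = f ` D v"
      proof
        show "f ` D v \<subseteq> D (f v)" using fS mono(1) by (auto simp: D_def)
        show "D (f v) \<subseteq> f ` D v"
        proof
          fix u assume u: "u \<in> D (f v)"
          then obtain u' where u': "u' \<in> S" "u = f u'" using surj by (auto simp: D_def)
          then have "(f' (f u'), f' (f v)) \<in> arrows P" using u mono(2) by (simp add: D_def)
          then show "u \<in> f ` D v" using u' So f(4) v by (simp add: D_def)
        qed
      qed
      moreover have "inj_on f (D v)" by (rule inj_on_subset[OF inj]) (auto simp: D_def)
      ultimately show ?thesis by (simp add: card_image)
    qed
    have fin: "finite (D v)" for v using \<open>finite S\<close> by (simp add: D_def)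
    have selfD: "v \<in> D v" if "v \<in> S" for v using that So identity by (simp add: D_def)
    show "\<forall>v. class_weight c v \<noteq> 0 \<longrightarrow> f v = v"
    proof (intro allI impI)
      fix v assume "class_weight c v \<noteq> 0"
      then have v: "v \<in> S" by (simp add: S_def z(2))
      have eq: "D v = D (f v)"
      proof (cases "(v, f v) \<in> arrows P")
        case True
        then have "D v \<subseteq> D (f v)" using composition by (auto simp: D_def)
        then show ?thesis using card_subset_eq[OF fin] card[OF v] by metis
      next
        case False
        then have "(f v, v) \<in> arrows P" using chain[OF v fS[OF v]] by blast
        then have "D (f v) \<subseteq> D v" using composition by (auto simp: D_def)
        then show ?thesis using card_subset_eq[OF fin] card[OF v] by metis
      qed
      have "(f v, v) \<in> arrows P" "(v, f v) \<in> arrows P"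
        using selfD[OF v] selfD[OF fS[OF v]] eq by (auto simp: D_def)
      then show "f v = v" by (rule antisymmetry)
    qed
  next
    assume fixed: "\<forall>v. class_weight c v \<noteq> 0 \<longrightarrow> f v = v"
    have stay: "(m', restrict (h \<circ> x') {..m'}, t') \<in> c"
      if z': "(m', x', t') \<in> c" and h: "\<And>a. a \<in> objects P \<Longrightarrow> h a \<in> objects P"
        "\<And>a b. (a, b) \<in> arrows P \<Longrightarrow> (h a, h b) \<in> arrows P"
        "\<And>v. v \<in> objects P \<Longrightarrow> class_weight c v \<noteq> 0 \<Longrightarrow> h v = v" for m' x' t' h
    proof -
      have z'c: "(m', x', t') \<in> cells P" using point_subset_cells[OF z(1)] z' z(2) by blast
      have pz': "point P (m', x', t') = c" using z' z(2) in_point_iff by metis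
      have "(restrict (h \<circ> x') {..m'}) i = x' i" if "i \<le> m'" "t' i \<noteq> 0" for i
      proof -
        have "x' i \<in> objects P" using z'c that by (simp add: cells_def topspace_nerve)
        moreover have "class_weight c (x' i) \<noteq> 0"
          using that weight_eq_0_iff[OF z'c] by (auto simp flip: pz')
        ultimately show ?thesis using h(3) that by simp
      qed
      then have "average F (m', restrict (h \<circ> x') {..m'}, t') = average F (m', x', t')" for F
        unfolding average_def prod.case by (intro sum.cong) (auto, metis)
      then have "class_weight (point P (m', restrict (h \<circ> x') {..m'}, t')) = class_weight (point P (m', x', t'))"
        by (simp add: weight_def fun_eq_iff)
      then have "point P (m', restrict (h \<circ> x') {..m'}, t') = c"
        unfolding pz'[symmetric]
        by (intro class_weight_inject) (use cell[OF z'c h(1,2)] z'c in \<open>auto simp: topspace_realization\<close>)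
      then show ?thesis using self_in_point by metis
    qed
    have f'fix: "f' v = v" if "v \<in> objects P" "class_weight c v \<noteq> 0" for v
      using fixed that f(4) by metis
    show "realization_map f c = c"
    proof
      show "realization_map f c \<subseteq> c"
        unfolding realization_map_def using stay[OF _ f(1) mono(1)] fixed by auto
      show "c \<subseteq> realization_map f c"
      proof
        fix z' assume "z' \<in> c"
        moreover obtain m' x' t' where z'e: "z' = (m', x', t')" by (cases z')
        ultimately have z': "(m', x', t') \<in> c" by simp
        have z'c: "(m', x', t') \<in> cells P" using point_subset_cells[OF z(1)] z' z(2) by blast
        have "restrict (f \<circ> restrict (f' \<circ> x') {..m'}) {..m'} = x'"
        proof
          fix i
          show "restrict (f \<circ> restrict (f' \<circ> x') {..m'}) {..m'} i = x' i"
          proof (cases "i \<le> m'")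
            case True
            then have "x' i \<in> objects P" using z'c by (simp add: cells_def topspace_nerve)
            then show ?thesis using f(3) True by simp
          next
            case False
            then show ?thesis using z'c by (simp add: cells_def topspace_nerve extensional_def)
          qed
        qed
        moreover have "(m', restrict (f' \<circ> x') {..m'}, t') \<in> c"
          by (rule stay[OF z' f(2) mono(2) f'fix])
        ultimately show "z' \<in> realization_map f c"
          unfolding realization_map_def z'e by force
      qed
    qed
  qed
qed

context character_pairing
begin

interpretation dp: realized_poset "decomposition_poset :: (complex^'n) set set top_poset"
  by (rule realized_decomposition_poset)

abbreviation (input) "DP \<equiv> (decomposition_poset :: (complex^'n) set set top_poset)"

abbreviation (input) "FP \<equiv> subtopology (realization DP) (carried DP {\<Lambda>. invariant \<Lambda>})"

text \<open>The fixed point space is the realization of the subposet of invariant decompositions.\<close>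

lemma decomposition_fixed_points_eq:
  "decomposition_fixed_points (rho ` carrier G) = FP"
proof -
  have iff: "realization_map (decomposition_act (rho g)) c = c \<longleftrightarrow>
      (\<forall>v. class_weight c v \<noteq> 0 \<longrightarrow> decomposition_act (rho g) v = v)"
    if g: "g \<in> carrier G" and c: "c \<in> topspace (realization DP)" for g c
  proof (rule dp.realization_map_fixed_iff[OF _ _ _ _ _ _ c, where f' = "decomposition_act (rho (inv g))"])
    have "rho g \<in> unitary_group" "rho (inv g) \<in> unitary_group" using g rho_unitary by auto
    then show "a \<in> objects DP \<Longrightarrow> decomposition_act (rho g) a \<in> objects DP"
      "a \<in> objects DP \<Longrightarrow> decomposition_act (rho (inv g)) a \<in> objects DP"
      "(a, b) \<in> arrows DP \<Longrightarrow> (decomposition_act (rho g) a, decomposition_act (rho g) b) \<in> arrows DP"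
      "(a, b) \<in> arrows DP \<Longrightarrow> (decomposition_act (rho (inv g)) a, decomposition_act (rho (inv g)) b) \<in> arrows DP" for a b
      by (auto simp: topspace_decomposition_objects topspace_decomposition_morphisms
          intro: proper_decomposition_act refines_act)
    show "decomposition_act (rho g) (decomposition_act (rho (inv g)) a) = a"
      "decomposition_act (rho (inv g)) (decomposition_act (rho g) a) = a" for a
      using g by (simp_all add: rho_mult_matrix rho_one_matrix flip: decomposition_act_mult)
  qed
  have obj: "proper_decomposition v" if cv: "c \<in> topspace (realization DP)" "class_weight c v \<noteq> 0" for c v
  proof -
    obtain m x t where z: "(m, x, t) \<in> cells DP" "c = point DP (m, x, t)"
      using cv(1) by (auto simp: topspace_realization)
    then obtain i where "i \<le> m" "x i = v" using cv(2) weight_eq_0_iff[OF z(1), of v] by auto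
    moreover have "x i \<in> objects DP" using z(1) \<open>i \<le> m\<close> by (simp add: cells_def topspace_nerve)
    ultimately show ?thesis by (simp add: topspace_decomposition_objects)
  qed
  have "{c \<in> topspace (realization DP). \<forall>A\<in>rho ` carrier G. realization_map (decomposition_act A) c = c}
     = carried DP {\<Lambda>. invariant \<Lambda>}"
  proof (intro Set.set_eqI iffI)
    fix c assume c: "c \<in> {c \<in> topspace (realization DP). \<forall>A\<in>rho ` carrier G. realization_map (decomposition_act A) c = c}"
    have "invariant v" if "class_weight c v \<noteq> 0" for v
      using c iff obj that by (auto simp: invariant_def)
    then show "c \<in> carried DP {\<Lambda>. invariant \<Lambda>}" using c by (auto simp: carried_def)
  next
    fix c assume "c \<in> carried DP {\<Lambda>. invariant \<Lambda>}"
    then have c: "c \<in> topspace (realization DP)" and "\<And>v. class_weight c v \<noteq> 0 \<Longrightarrow> invariant v"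
      by (auto simp: carried_def)
    then have "\<forall>v. class_weight c v \<noteq> 0 \<longrightarrow> decomposition_act (rho g) v = v" if "g \<in> carrier G" for g
      using that by (simp add: invariant_def)
    then show "c \<in> {c \<in> topspace (realization DP). \<forall>A\<in>rho ` carrier G. realization_map (decomposition_act A) c = c}"
      using c iff by simp
  qed
  then show ?thesis by (simp only: decomposition_fixed_points_def fixed_point_space_def)
qed

section \<open>The retraction and its section\<close>

definition subgroups :: "'a set set" where "subgroups = {K. subgroup K G}"

abbreviation (input) "W \<equiv> pole_weights subgroups {\<one>} (carrier G)"

definition half_weight :: "'a set \<Rightarrow> (complex^'n) set set \<Rightarrow> real" where
  "half_weight K \<Lambda> = (of_bool (lower \<Lambda> = K) + of_bool (upper \<Lambda> = K)) / 2"

definition retract :: "(complex^'n) set set cell set \<Rightarrow> 'a set \<Rightarrow> real" where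
  "retract c K = class_average (half_weight K) c"

lemma finite_subgroups: "finite subgroups"
  by (rule finite_subset[of _ "Pow (carrier G)"]) (auto simp: subgroups_def finite_carrier dest: subgroup.subset)

text \<open>Along a chain of decompositions the lower groups decrease and the upper groups increase, each
  lower group being contained in its upper group. If both extremes had positive weight, the coarser one of the
  two decompositions responsible would have trivial lower group and upper group \<open>G\<close>.\<close>

lemma retract_in_weights:
  assumes c: "c \<in> carried DP {\<Lambda>. invariant \<Lambda>}" shows "retract c \<in> W"
proof -
  obtain m x t where z: "(m, x, t) \<in> cells DP" "c = point DP (m, x, t)"
    using c by (auto simp: carried_def topspace_realization)
  have xn: "x \<in> topspace (nerve DP m)" and t: "t \<in> standard_simplex m" using z(1) by (simp_all add: cells_def)
  have t0: "0 \<le> t i" "(\<Sum>i\<le>m. t i) = 1" for i using t by (auto simp: standard_simplex_def)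
  have inv: "invariant (x i)" if "i \<le> m" "t i \<noteq> 0" for i
    using c that carried_point_iff[OF z(1)] z(2) by auto
  have eq: "retract c K = (\<Sum>i\<le>m. t i * half_weight K (x i))" for K
    by (simp add: retract_def z(2) average_def)
  have nonneg: "0 \<le> retract c K" for K
    unfolding eq by (rule sum_nonneg) (use t0 in \<open>simp add: half_weight_def\<close>)
  have supp: "\<exists>i\<le>m. t i \<noteq> 0 \<and> (K = lower (x i) \<or> K = upper (x i))" if "retract c K \<noteq> 0" for K
  proof (rule ccontr)
    assume no: "\<not> ?thesis"
    have "retract c K = 0" unfolding eq
      by (rule sum.neutral) (use no in \<open>auto simp: half_weight_def\<close>)
    then show False using that by simp
  qed
  have nest: "lower (x j) \<subseteq> lower (x i) \<and> lower (x i) \<subseteq> upper (x i) \<and> upper (x i) \<subseteq> upper (x j)"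
    if "i \<le> j" "j \<le> m" "t i \<noteq> 0" "t j \<noteq> 0" for i j
  proof -
    have "refines (x i) (x j)" using dp.nerve_mono[OF xn that(1,2)] by (simp add: topspace_decomposition_morphisms)
    moreover have "invariant (x i)" "invariant (x j)" using inv that by auto
    ultimately show ?thesis using lower_antimono lower_subset_upper upper_mono by blast
  qed
  have "(\<Sum>K\<in>subgroups. retract c K) = (\<Sum>i\<le>m. \<Sum>K\<in>subgroups. t i * half_weight K (x i))"
    unfolding eq by (rule sum.swap)
  also have "\<dots> = (\<Sum>i\<le>m. t i)"
  proof (rule sum.cong)
    fix i
    have *: "(\<Sum>K\<in>subgroups. of_bool (M = K)) = (1 :: real)" if "M \<in> subgroups" for M
    proof -
      have "(\<Sum>K\<in>subgroups. of_bool (M = K)) = (\<Sum>K\<in>subgroups. if K = M then 1 else (0::real))"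
        by (rule sum.cong) auto
      then show ?thesis using that finite_subgroups by simp
    qed
    have "lower (x i) \<in> subgroups" "upper (x i) \<in> subgroups"
      by (simp_all add: subgroups_def subgroup_lower subgroup_upper)
    then have "(\<Sum>K\<in>subgroups. half_weight K (x i)) = 1"
      unfolding half_weight_def by (simp add: sum.distrib * flip: sum_divide_distrib)
    then show "(\<Sum>K\<in>subgroups. t i * half_weight K (x i)) = t i" by (simp flip: sum_distrib_left)
  qed simp
  finally have sum: "(\<Sum>K\<in>subgroups. retract c K) = 1" using t0 by simp
  have sub: "K \<in> subgroups" if "retract c K \<noteq> 0" for K
    using supp[OF that] subgroup_lower subgroup_upper by (auto simp: subgroups_def)
  have chain: "K \<subseteq> L \<or> L \<subseteq> K" if KL: "retract c K \<noteq> 0" "retract c L \<noteq> 0" for K L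
  proof -
    obtain i where i: "i \<le> m" "t i \<noteq> 0" "K = lower (x i) \<or> K = upper (x i)" using supp[OF KL(1)] by blast
    obtain j where j: "j \<le> m" "t j \<noteq> 0" "L = lower (x j) \<or> L = upper (x j)" using supp[OF KL(2)] by blast
    show ?thesis
    proof (cases "i \<le> j")
      case True then show ?thesis using nest[of i j] nest[of j j] i j by blast
    next
      case False then show ?thesis using nest[of j i] nest[of i i] i j by fastforce
    qed
  qed
  have "retract c {\<one>} = 0 \<or> retract c (carrier G) = 0"
  proof (rule ccontr)
    assume "\<not> ?thesis"
    then have ne: "retract c {\<one>} \<noteq> 0" "retract c (carrier G) \<noteq> 0" by auto
    obtain i where i: "i \<le> m" "t i \<noteq> 0" "{\<one>} = lower (x i) \<or> {\<one>} = upper (x i)" using supp[OF ne(1)] by blast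
    obtain j where j: "j \<le> m" "t j \<noteq> 0" "carrier G = lower (x j) \<or> carrier G = upper (x j)" using supp[OF ne(2)] by blast
    define n where "n = max i j"
    have n: "n \<le> m" "t n \<noteq> 0" using i j by (auto simp: n_def max_def)
    have "lower (x n) \<subseteq> {\<one>}" using nest[of i n] i n by (auto simp: n_def)
    moreover have "carrier G \<subseteq> upper (x n)" using nest[of j n] j n by (auto simp: n_def)
    ultimately have "lower (x n) = {\<one>}" "upper (x n) = carrier G"
      using subgroup.one_closed[OF subgroup_lower] subgroup.subset[OF subgroup_upper] by blast+
    then show False using lower_upper_not_extreme[OF inv[OF n]] by blast
  qed
  then show ?thesis
    using nonneg sub chain sum unfolding pole_weights_def chain_weights_def by blast
qed

lemma continuous_map_retract:
  "continuous_map FP (subtopology (powertop_real UNIV) W) retract"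
proof (rule continuous_map_into_subtopology)
  show "retract \<in> topspace FP \<rightarrow> W" using retract_in_weights by auto
  show "continuous_map FP (powertop_real UNIV) retract"
    unfolding continuous_map_componentwise_UNIV
  proof
    fix K
    have "continuous_map FP euclideanreal (class_average (half_weight K))"
    proof (rule continuous_map_class_average[where V = "{0, 1/2, 1}"])
      show "half_weight K ` {\<Lambda>. invariant \<Lambda>} \<subseteq> {0, 1/2, 1}"       proof (rule image_subsetI)
        fix \<Lambda>
        show "half_weight K \<Lambda> \<in> {0, 1/2, 1}"
          by (cases "lower \<Lambda> = K"; cases "upper \<Lambda> = K") (simp_all add: half_weight_def)
      qed
      fix v :: real
      have "{\<Lambda> \<in> {\<Lambda>. invariant \<Lambda>}. half_weight K \<Lambda> = v} = {\<Lambda>. invariant \<Lambda> \<and>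
         (of_bool (lower \<Lambda> = K) + of_bool (upper \<Lambda> = K)) / 2 = v}" by (simp add: half_weight_def)
      then show "closedin (Objects DP) {\<Lambda> \<in> {\<Lambda>. invariant \<Lambda>}. half_weight K \<Lambda> = v}"
        using closedin_invariant_level[of "\<lambda>A B. (of_bool (A = K) + of_bool (B = K)) / 2 = v"] by simp
    qed simp
    then show "continuous_map FP euclideanreal (\<lambda>c. retract c K)" by (simp add: retract_def[abs_def])
  qed
qed

definition intervals :: "('a set \<times> 'a set) set" where
  "intervals = {(K, L) \<in> subgroups \<times> subgroups. K \<subseteq> L \<and> \<not> (K = {\<one>} \<and> L = carrier G)}"

definition interval_decompositions :: "(complex^'n) set set set" where
  "interval_decompositions = (\<lambda>(K, L). interval_decomposition K L) ` intervals"

text \<open>The distribution \<open>pair_weight\<close> on intervals, transported to decompositions. An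
  interval decomposition determines its interval through its lower and upper groups.\<close>

definition spread :: "('a set \<Rightarrow> real) \<Rightarrow> (complex^'n) set set \<Rightarrow> real" where
  "spread w \<Lambda> = (if \<Lambda> \<in> interval_decompositions then pair_weight subgroups w (lower \<Lambda>) (upper \<Lambda>) else 0)"

lemma finite_interval_decompositions: "finite interval_decompositions"
proof -
  have "finite intervals"
    by (rule finite_subset[of _ "subgroups \<times> subgroups"]) (auto simp: intervals_def finite_subgroups)
  then show ?thesis by (simp add: interval_decompositions_def)
qed

lemma interval_decompositionsE:
  assumes "\<Lambda> \<in> interval_decompositions"
  obtains K L where "(K, L) \<in> intervals" "\<Lambda> = interval_decomposition K L" "lower \<Lambda> = K" "upper \<Lambda> = L" "invariant \<Lambda>"
proof -
  obtain K L where KL: "(K, L) \<in> intervals" "\<Lambda> = interval_decomposition K L"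
    using assms by (auto simp: interval_decompositions_def)
  then have "lower \<Lambda> = K" "upper \<Lambda> = L" "invariant \<Lambda>"
    using lower_interval_decomposition upper_interval_decomposition invariant_interval_decomposition
    by (auto simp: intervals_def subgroups_def)
  then show thesis using that KL by blast
qed

text \<open>The sum may range over all pairs of subgroups since \<open>pair_weight\<close> vanishes on pairs
  that are not intervals. It vanishes in particular on the pair of both extremes, which are not both in the
  support of \<open>w\<close>.\<close>

lemma spread_sum:
  assumes w: "w \<in> W"
  shows "(\<Sum>\<Lambda>\<in>interval_decompositions. spread w \<Lambda> * F (lower \<Lambda>) (upper \<Lambda>)) =
    (\<Sum>K\<in>subgroups. \<Sum>L\<in>subgroups. pair_weight subgroups w K L * F K L)"
proof -
  have wc: "w \<in> chain_weights subgroups" and pole: "w {\<one>} = 0 \<or> w (carrier G) = 0"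
    using w by (auto simp: pole_weights_def)
  have inj: "inj_on (\<lambda>(K, L). interval_decomposition K L) intervals"
  proof (rule inj_onI)
    fix p q assume p: "p \<in> intervals" "q \<in> intervals"
      and eq: "(\<lambda>(K, L). interval_decomposition K L) p = (\<lambda>(K, L). interval_decomposition K L) q"
    obtain K L K' L' where e: "p = (K, L)" "q = (K', L')" by (cases p, cases q)
    have "lower (interval_decomposition K L) = K" "upper (interval_decomposition K L) = L"
      "lower (interval_decomposition K' L') = K'" "upper (interval_decomposition K' L') = L'"
      using p lower_interval_decomposition upper_interval_decomposition
      by (auto simp: e intervals_def subgroups_def)
    then show "p = q" using eq by (simp add: e)
  qed
  have "(\<Sum>\<Lambda>\<in>interval_decompositions. spread w \<Lambda> * F (lower \<Lambda>) (upper \<Lambda>)) =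
    (\<Sum>(K, L)\<in>intervals. pair_weight subgroups w K L * F K L)"
    unfolding interval_decompositions_def sum.reindex[OF inj]
  proof (rule sum.cong)
    fix p assume p: "p \<in> intervals"
    obtain K L where e: "p = (K, L)" by (cases p)
    have "interval_decomposition K L \<in> interval_decompositions" using p by (auto simp: e interval_decompositions_def)
    moreover have "lower (interval_decomposition K L) = K" "upper (interval_decomposition K L) = L"
      using p lower_interval_decomposition upper_interval_decomposition
      by (auto simp: e intervals_def subgroups_def)
    ultimately show "((\<lambda>\<Lambda>. spread w \<Lambda> * F (lower \<Lambda>) (upper \<Lambda>)) \<circ> (\<lambda>(K, L). interval_decomposition K L)) p =
       (case p of (K, L) \<Rightarrow> pair_weight subgroups w K L * F K L)"
      by (simp add: e spread_def)
  qed simp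
  also have "\<dots> = (\<Sum>(K, L)\<in>subgroups \<times> subgroups. pair_weight subgroups w K L * F K L)"
  proof (rule sum.mono_neutral_left)
    show "\<forall>p\<in>subgroups \<times> subgroups - intervals. (case p of (K, L) \<Rightarrow> pair_weight subgroups w K L * F K L) = 0"
    proof
      fix p assume p: "p \<in> subgroups \<times> subgroups - intervals"
      obtain K L where e: "p = (K, L)" by (cases p)
      have "pair_weight subgroups w K L = 0"
      proof (rule ccontr)
        assume nz: "pair_weight subgroups w K L \<noteq> 0"
        show False
          using pair_weight_support[OF finite_subgroups wc nz] p pole by (auto simp: e intervals_def)
      qed
      then show "(case p of (K, L) \<Rightarrow> pair_weight subgroups w K L * F K L) = 0" by (simp add: e)
    qed
  qed (auto simp: intervals_def finite_subgroups)
  also have "\<dots> = (\<Sum>K\<in>subgroups. \<Sum>L\<in>subgroups. pair_weight subgroups w K L * F K L)"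
    by (simp add: sum.cartesian_product)
  finally show ?thesis .
qed

lemma spread_half_weight:
  assumes w: "w \<in> W"
  shows "(\<Sum>\<Lambda>\<in>interval_decompositions. spread w \<Lambda> * half_weight M \<Lambda>) = w M"
proof -
  have wc: "w \<in> chain_weights subgroups" using w by (simp add: pole_weights_def)
  let ?p = "pair_weight subgroups w"
  have "(\<Sum>\<Lambda>\<in>interval_decompositions. spread w \<Lambda> * half_weight M \<Lambda>) =
     (\<Sum>K\<in>subgroups. \<Sum>L\<in>subgroups. ?p K L * ((of_bool (K = M) + of_bool (L = M)) / 2))"
    unfolding half_weight_def by (rule spread_sum[OF w])
  also have "\<dots> = ((\<Sum>K\<in>subgroups. \<Sum>L\<in>subgroups. ?p K L * of_bool (K = M)) +
      (\<Sum>K\<in>subgroups. \<Sum>L\<in>subgroups. ?p K L * of_bool (L = M))) / 2"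
    by (simp add: add_divide_distrib distrib_left sum.distrib flip: sum_divide_distrib)
  also have "(\<Sum>K\<in>subgroups. \<Sum>L\<in>subgroups. ?p K L * of_bool (K = M)) =
      (\<Sum>K\<in>subgroups. if K = M then \<Sum>L\<in>subgroups. ?p M L else 0)"
    by (rule sum.cong) auto
  also have "(\<Sum>K\<in>subgroups. \<Sum>L\<in>subgroups. ?p K L * of_bool (L = M)) =
      (\<Sum>K\<in>subgroups. \<Sum>L\<in>subgroups. if L = M then ?p K M else 0)"
    by (intro sum.cong) auto
  finally have eq: "(\<Sum>\<Lambda>\<in>interval_decompositions. spread w \<Lambda> * half_weight M \<Lambda>) =
     ((\<Sum>K\<in>subgroups. if K = M then \<Sum>L\<in>subgroups. ?p M L else 0) +
      (\<Sum>K\<in>subgroups. \<Sum>L\<in>subgroups. if L = M then ?p K M else 0)) / 2" .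
  show ?thesis
  proof (cases "M \<in> subgroups")
    case True
    then show ?thesis
      unfolding eq using finite_subgroups sum_pair_weight[OF finite_subgroups wc, of M] by simp
  next
    case False
    then show ?thesis
      unfolding eq using finite_subgroups chain_weights_D(2)[OF wc False] by simp
  qed
qed

lemma spread_total:
  assumes w: "w \<in> W" shows "(\<Sum>\<Lambda>\<in>interval_decompositions. spread w \<Lambda>) = 1"
proof -
  have wc: "w \<in> chain_weights subgroups" using w by (simp add: pole_weights_def)
  have "1 = (\<Sum>M\<in>subgroups. w M)" using chain_weights_D(5)[OF wc] by simp
  also have "\<dots> = (\<Sum>M\<in>subgroups. ((\<Sum>L\<in>subgroups. pair_weight subgroups w M L) +
      (\<Sum>L\<in>subgroups. pair_weight subgroups w L M)) / 2)"
    by (simp add: sum_pair_weight[OF finite_subgroups wc])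
  also have "\<dots> = ((\<Sum>M\<in>subgroups. \<Sum>L\<in>subgroups. pair_weight subgroups w M L) +
      (\<Sum>M\<in>subgroups. \<Sum>L\<in>subgroups. pair_weight subgroups w L M)) / 2"
    by (simp add: sum.distrib flip: sum_divide_distrib)
  also have "(\<Sum>M\<in>subgroups. \<Sum>L\<in>subgroups. pair_weight subgroups w L M) =
      (\<Sum>L\<in>subgroups. \<Sum>M\<in>subgroups. pair_weight subgroups w L M)" by (rule sum.swap)
  finally have "(\<Sum>M\<in>subgroups. \<Sum>L\<in>subgroups. pair_weight subgroups w M L) = 1" by simp
  then show ?thesis using spread_sum[OF w, of "\<lambda>_ _. 1"] by simp
qed

lemma spread_nonneg: "0 \<le> spread w \<Lambda>"
  by (simp add: spread_def pair_weight_nonneg)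

lemma spread_chain:
  assumes w: "w \<in> W" and nz: "spread w \<Lambda> \<noteq> 0" "spread w M \<noteq> 0"
  shows "(\<Lambda>, M) \<in> arrows DP \<or> (M, \<Lambda>) \<in> arrows DP"
proof -
  have wc: "w \<in> chain_weights subgroups" using w by (simp add: pole_weights_def)
  have "\<Lambda> \<in> interval_decompositions" "M \<in> interval_decompositions"
    using nz by (auto simp: spread_def split: if_splits)
  then obtain K L K' L' where \<Lambda>: "\<Lambda> = interval_decomposition K L" "lower \<Lambda> = K" "upper \<Lambda> = L" "invariant \<Lambda>"
    and M: "M = interval_decomposition K' L'" "lower M = K'" "upper M = L'" "invariant M"
    by (metis interval_decompositionsE)
  have "pair_weight subgroups w K L \<noteq> 0" "pair_weight subgroups w K' L' \<noteq> 0"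
    using nz \<Lambda>(2,3) M(2,3) by (auto simp: spread_def split: if_splits)
  from pair_weight_comparable[OF finite_subgroups wc this]
  have "refines \<Lambda> M \<or> refines M \<Lambda>"
    using refines_interval_decomposition \<Lambda>(1) M(1) by blast
  then show ?thesis
    using \<Lambda>(4) M(4) invariant_proper by (auto simp: topspace_decomposition_morphisms)
qed

definition spread_class :: "('a set \<Rightarrow> real) \<Rightarrow> (complex^'n) set set cell set" where
  "spread_class w = (THE c. c \<in> topspace (realization DP) \<and> class_weight c = spread w)"

lemma spread_class_normal_form:
  assumes w: "w \<in> W" and C: "C \<subseteq> interval_decompositions" "\<And>\<Lambda>. spread w \<Lambda> \<noteq> 0 \<Longrightarrow> \<Lambda> \<in> C"
    and y: "y \<in> topspace (nerve DP n)" "bij_betw y {..n} C"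
  defines "z \<equiv> (n, y, \<lambda>j. if j \<le> n then spread w (y j) else 0)"
  shows "z \<in> cells DP" "spread_class w = point DP z"
    "class_average F (spread_class w) = (\<Sum>\<Lambda>\<in>interval_decompositions. spread w \<Lambda> * F \<Lambda>)"
proof -
  have "(\<Sum>\<Lambda>\<in>C. spread w \<Lambda>) = (\<Sum>\<Lambda>\<in>interval_decompositions. spread w \<Lambda>)"
    by (rule sum.mono_neutral_left[OF finite_interval_decompositions C(1)]) (use C(2) in blast)
  then have s: "(\<Sum>\<Lambda>\<in>C. spread w \<Lambda>) = 1" using spread_total[OF w] by simp
  note nf = dp.normal_form_cell[OF y spread_nonneg C(2) s, folded z_def]
  show "z \<in> cells DP" by (rule nf(1))
  then have top: "point DP z \<in> topspace (realization DP)" by (simp add: topspace_realization)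
  show eq: "spread_class w = point DP z"
    unfolding spread_class_def
  proof (rule the_equality)
    show "point DP z \<in> topspace (realization DP) \<and> class_weight (point DP z) = spread w"
      using top nf(2) by simp
    fix c assume "c \<in> topspace (realization DP) \<and> class_weight c = spread w"
    then show "c = point DP z" using top nf(2) by (intro dp.class_weight_inject) auto
  qed
  have "(\<Sum>\<Lambda>\<in>C. spread w \<Lambda> * F \<Lambda>) = (\<Sum>\<Lambda>\<in>interval_decompositions. spread w \<Lambda> * F \<Lambda>)"
    by (rule sum.mono_neutral_left[OF finite_interval_decompositions C(1)]) (use C(2) in auto)
  then show "class_average F (spread_class w) = (\<Sum>\<Lambda>\<in>interval_decompositions. spread w \<Lambda> * F \<Lambda>)"
    by (simp add: eq nf(3))
qed

lemma interval_decompositions_objects: "interval_decompositions \<subseteq> objects DP"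
  by (auto elim!: interval_decompositionsE simp: topspace_decomposition_objects invariant_proper)

text \<open>These finitely many chains index a closed cover of the space of distributions, on each piece of
  which \<open>spread_class\<close> is a cell with weights depending continuously on the distribution.\<close>

definition interval_chains :: "(complex^'n) set set set set" where
  "interval_chains = {C. C \<subseteq> interval_decompositions \<and> C \<noteq> {} \<and>
     (\<forall>\<Lambda>\<in>C. \<forall>M\<in>C. (\<Lambda>, M) \<in> arrows DP \<or> (M, \<Lambda>) \<in> arrows DP)}"

lemma interval_chain_enumeration:
  assumes "C \<in> interval_chains"
  obtains n y where "y \<in> topspace (nerve DP n)" "bij_betw y {..n} C"
proof (rule dp.chain_enumeration[of C])
  show "finite C" using assms finite_interval_decompositions by (auto simp: interval_chains_def intro: finite_subset)
  show "C \<subseteq> objects DP" using assms interval_decompositions_objects by (auto simp: interval_chains_def)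
qed (use assms that in \<open>auto simp: interval_chains_def\<close>)

lemma spread_support_chain:
  assumes w: "w \<in> W" shows "{\<Lambda>. spread w \<Lambda> \<noteq> 0} \<in> interval_chains"
proof -
  have "{\<Lambda>. spread w \<Lambda> \<noteq> 0} \<noteq> {}"
  proof
    assume "{\<Lambda>. spread w \<Lambda> \<noteq> 0} = {}"
    then have "(\<Sum>\<Lambda>\<in>interval_decompositions. spread w \<Lambda>) = 0" by (intro sum.neutral) auto
    then show False using spread_total[OF w] by simp
  qed
  moreover have "{\<Lambda>. spread w \<Lambda> \<noteq> 0} \<subseteq> interval_decompositions" by (auto simp: spread_def)
  ultimately show ?thesis using spread_chain[OF w] unfolding interval_chains_def by blast
qed

lemma spread_class_props:
  assumes w: "w \<in> W"
  shows "spread_class w \<in> carried DP {\<Lambda>. invariant \<Lambda>}" "retract (spread_class w) = w"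
proof -
  obtain n y where y: "y \<in> topspace (nerve DP n)" "bij_betw y {..n} {\<Lambda>. spread w \<Lambda> \<noteq> 0}"
    by (rule interval_chain_enumeration[OF spread_support_chain[OF w]])
  have sub: "{\<Lambda>. spread w \<Lambda> \<noteq> 0} \<subseteq> interval_decompositions" by (auto simp: spread_def)
  note nf = spread_class_normal_form[OF w sub _ y, simplified]
  have "invariant (y j)" if "j \<le> n" for j
  proof -
    have "y j \<in> interval_decompositions" using y(2) sub that by (auto simp: bij_betw_def)
    then show ?thesis by (rule interval_decompositionsE)
  qed
  then show "spread_class w \<in> carried DP {\<Lambda>. invariant \<Lambda>}"
    unfolding nf(2) carried_point_iff[OF nf(1)] by simp
  show "retract (spread_class w) = w"
    by (rule ext) (simp add: retract_def nf(3) spread_half_weight[OF w])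
qed

text \<open>On the closed set of distributions that spread over a given chain of decompositions, the section
  takes values in the single simplex of that chain. The pieces fit together because the weights determine a
  point.\<close>

lemma continuous_map_spread_class:
  "continuous_map (subtopology (powertop_real UNIV) W) FP spread_class"
proof (rule continuous_map_into_subtopology)
  let ?Y = "subtopology (powertop_real UNIV) W"
  show "spread_class \<in> topspace ?Y \<rightarrow> carried DP {\<Lambda>. invariant \<Lambda>}" using spread_class_props(1) by auto
  have "\<exists>e. snd e \<in> topspace (nerve DP (fst e)) \<and> bij_betw (snd e) {..fst e} C" if C: "C \<in> interval_chains" for C
  proof -
    obtain n y where "y \<in> topspace (nerve DP n)" "bij_betw y {..n} C"
      by (rule interval_chain_enumeration[OF C])
    then show ?thesis by (intro exI[of _ "(n, y)"]) simp
  qed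
  then obtain e where e: "\<And>C. C \<in> interval_chains \<Longrightarrow> snd (e C) \<in> topspace (nerve DP (fst (e C)))"
      "\<And>C. C \<in> interval_chains \<Longrightarrow> bij_betw (snd (e C)) {..fst (e C)} C"
    by metis
  define tt where "tt = (\<lambda>C w j. if j \<le> fst (e C) then spread w (snd (e C) j) else 0)"
  define piece where "piece = (\<lambda>C. {w \<in> topspace ?Y. \<forall>\<Lambda>\<in>interval_decompositions - C. spread w \<Lambda> = 0})"
  have cont: "continuous_map ?Y euclideanreal (\<lambda>w. spread w \<Lambda>)" for \<Lambda>
    by (cases "\<Lambda> \<in> interval_decompositions")
       (auto simp: spread_def intro: continuous_map_from_subtopology continuous_map_pair_weight finite_subgroups)
  have eq: "spread_class w = point DP (fst (e C), snd (e C), tt C w)" "tt C w \<in> standard_simplex (fst (e C))"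
    if C: "C \<in> interval_chains" and w: "w \<in> piece C" for C w
  proof -
    have wW: "w \<in> W" and z: "\<And>\<Lambda>. spread w \<Lambda> \<noteq> 0 \<Longrightarrow> \<Lambda> \<in> C"
      using w by (auto simp: piece_def spread_def split: if_splits)
    have sub: "C \<subseteq> interval_decompositions" using C by (simp add: interval_chains_def)
    note nf = spread_class_normal_form[OF wW sub z e(1)[OF C] e(2)[OF C]]
    show "spread_class w = point DP (fst (e C), snd (e C), tt C w)" using nf(2) by (simp add: tt_def)
    show "tt C w \<in> standard_simplex (fst (e C))" using nf(1) by (simp add: tt_def cells_def)
  qed
  show "continuous_map ?Y (realization DP) spread_class"
  proof (rule pasting_lemma_closed[where I = interval_chains and T = piece and f = "\<lambda>C. spread_class"])
    show "finite interval_chains"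
      by (rule finite_subset[of _ "Pow interval_decompositions"])
         (auto simp: interval_chains_def finite_interval_decompositions)
    fix C assume C: "C \<in> interval_chains"
    show "closedin ?Y (piece C)"
      unfolding piece_def
    proof (rule closedin_Collect_ball)
      fix \<Lambda>
      show "closedin ?Y {w \<in> topspace ?Y. spread w \<Lambda> = 0}"
        using closedin_continuous_map_preimage[OF cont, of "{0}" \<Lambda>] by simp
    qed
    have "continuous_map (subtopology ?Y (piece C)) (simplex_space (fst (e C))) (tt C)"
    proof (rule continuous_map_into_subtopology)
      show "tt C \<in> topspace (subtopology ?Y (piece C)) \<rightarrow> standard_simplex (fst (e C))" using eq(2)[OF C] by auto
      show "continuous_map (subtopology ?Y (piece C)) (powertop_real UNIV) (tt C)"
        unfolding continuous_map_componentwise_UNIV tt_def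
        using continuous_map_from_subtopology[OF cont] by (auto simp: if_distrib)
    qed
    then have "continuous_map (subtopology ?Y (piece C)) (realization DP)
        ((\<lambda>t. point DP (fst (e C), snd (e C), t)) \<circ> tt C)"
      using continuous_map_cell[OF e(1)[OF C]] by (rule continuous_map_compose)
    then show "continuous_map (subtopology ?Y (piece C)) (realization DP) spread_class"
      by (rule continuous_map_eq) (use eq(1)[OF C] in auto)
  next
    fix w assume w: "w \<in> topspace ?Y"
    then have "w \<in> W" by simp
    then show "\<exists>C. C \<in> interval_chains \<and> w \<in> piece C \<and> spread_class w = spread_class w"
      using spread_support_chain w by (intro exI[of _ "{\<Lambda>. spread w \<Lambda> \<noteq> 0}"]) (auto simp: piece_def)
  qed simp
qed

lemma retraction_maps_fixed_points:
  "retraction_maps FP (subtopology (powertop_real UNIV) W) retract spread_class"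
  unfolding retraction_maps_def
  using continuous_map_retract continuous_map_spread_class spread_class_props(2) by simp

end

section \<open>Elementary abelian groups\<close>

lemma cis_cong:
  assumes "0 < p" "m mod int p = n mod int p"
  shows "cis (2 * pi * of_int m / of_nat p) = cis (2 * pi * of_int n / of_nat p)"
proof -
  obtain q where q: "m = n + int p * q"
    using assms(2) by (metis mod_eqE)
  have "2 * pi * of_int m / of_nat p = 2 * pi * of_int n / of_nat p + 2 * pi * of_int q"
    using assms(1) by (simp add: q field_simps)
  then have "cis (2 * pi * of_int m / of_nat p) = cis (2 * pi * of_int n / of_nat p) * cis (2 * pi * of_int q)"
    by (simp only: cis_mult)
  also have "cis (2 * pi * of_int q) = 1" by (rule cis_multiple_2pi) simp
  finally show ?thesis by simp
qed

text \<open>The standard dot product of \<open>(\<int>/p)\<^sup>k\<close>, composed with the character of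
  \<open>\<int>/p\<close> that sends \<open>1\<close> to a primitive root of unity.\<close>

definition root_pairing :: "nat \<Rightarrow> nat \<Rightarrow> (nat \<Rightarrow> int) \<Rightarrow> (nat \<Rightarrow> int) \<Rightarrow> complex" where
  "root_pairing p k x y = cis (2 * pi * of_int (\<Sum>j<k. x j * y j) / of_nat p)"

lemma comm_group_elementary_abelian: "comm_group (elementary_abelian p k)"
  unfolding elementary_abelian_def
proof (rule group.group_comm_groupI)
  show "Group.group (product_group {..<k} (\<lambda>_. integer_mod_group p))" by simp
qed (auto simp: add.commute)

lemma character_pairing_elementary_abelian:
  assumes p: "1 < p" and b: "bij_betw b UNIV (carrier (elementary_abelian p k))"
  shows "character_pairing (elementary_abelian p k) b (root_pairing p k)"
proof -
  let ?G = "elementary_abelian p k"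
  interpret G: comm_group ?G by (rule comm_group_elementary_abelian)
  have carrier: "carrier ?G = {..<k} \<rightarrow>\<^sub>E {0..<int p}"
    using p by (simp add: elementary_abelian_def carrier_integer_mod_group)
  have mult: "x \<otimes>\<^bsub>?G\<^esub> y = (\<lambda>j\<in>{..<k}. (x j + y j) mod int p)" for x y
    by (simp add: elementary_abelian_def)
  have one: "\<one>\<^bsub>?G\<^esub> = (\<lambda>j\<in>{..<k}. 0)" by (simp add: elementary_abelian_def)
  show ?thesis
  proof unfold_locales
    show "bij_betw b UNIV (carrier ?G)" by (rule b)
  next
    fix x y z
    have "(\<Sum>j<k. (x \<otimes>\<^bsub>?G\<^esub> y) j * z j) mod int p = (\<Sum>j<k. (x j + y j) * z j) mod int p"
      by (subst (1 2) mod_sum_eq[symmetric]) (simp add: mult mod_mult_left_eq)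
    then have "root_pairing p k (x \<otimes>\<^bsub>?G\<^esub> y) z = cis (2 * pi * of_int (\<Sum>j<k. (x j + y j) * z j) / of_nat p)"
      unfolding root_pairing_def using p by (intro cis_cong) auto
    also have "(\<Sum>j<k. (x j + y j) * z j) = (\<Sum>j<k. x j * z j) + (\<Sum>j<k. y j * z j)"
      by (simp add: distrib_right sum.distrib)
    also have "cis (2 * pi * of_int ((\<Sum>j<k. x j * z j) + (\<Sum>j<k. y j * z j)) / of_nat p) =
        root_pairing p k x z * root_pairing p k y z"
      by (simp add: root_pairing_def cis_mult add_divide_distrib distrib_left)
    finally show "root_pairing p k (x \<otimes>\<^bsub>?G\<^esub> y) z = root_pairing p k x z * root_pairing p k y z" .
    show "root_pairing p k x y = root_pairing p k y x" by (simp add: root_pairing_def mult.commute)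
    show "cmod (root_pairing p k x y) = 1" by (simp add: root_pairing_def)
  next
    fix x assume x: "x \<in> carrier ?G" "x \<noteq> \<one>\<^bsub>?G\<^esub>"
    have "\<exists>j<k. x j \<noteq> 0"
    proof (rule ccontr)
      assume "\<not> ?thesis"
      then have "x = \<one>\<^bsub>?G\<^esub>" using x(1) unfolding carrier one by (intro ext) (auto simp: PiE_def extensional_def)
      then show False using x(2) by simp
    qed
    then obtain j where j: "j < k" "x j \<noteq> 0" by blast
    have xj: "0 < x j" "x j < int p" using x(1) j unfolding carrier by (force simp: PiE_def Pi_def)+
    define y where "y = (\<lambda>i\<in>{..<k}. if i = j then 1 else 0 :: int)"
    have "y \<in> carrier ?G" using p unfolding carrier y_def by auto
    moreover have "root_pairing p k y x \<noteq> 1"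
    proof
      assume one: "root_pairing p k y x = 1"
      have "(\<Sum>i<k. y i * x i) = (\<Sum>i<k. if i = j then x j else 0)"
        by (rule sum.cong) (auto simp: y_def)
      then have "(\<Sum>i<k. y i * x i) = x j" using j by simp
      then have "cis (2 * pi * of_int (x j) / of_nat p) = 1" using one by (simp add: root_pairing_def)
      then have "cos (2 * pi * of_int (x j) / of_nat p) = 1" by (metis cis.sel(1) one_complex.sel(1))
      then obtain n :: int where "2 * pi * of_int (x j) / of_nat p = of_int n * 2 * pi"
        using cos_one_2pi_int by blast
      then have "of_int (x j) = (of_int n * of_nat p :: real)" using p by (simp add: field_simps)
      then have "x j = n * int p" by (metis of_int_eq_iff of_int_mult of_int_of_nat_eq)
      then have "int p dvd x j" by simp
      then show False using xj zdvd_imp_le by fastforce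
    qed
    ultimately show "\<exists>y\<in>carrier ?G. root_pairing p k y x \<noteq> 1" by blast
  qed
qed

theorem theorem1p3:
  fixes p k :: nat and b :: "'n::finite \<Rightarrow> nat \<Rightarrow> int"
  assumes "prime p" and "1 \<le> k"
    and "bij_betw b (UNIV :: 'n set) (carrier (elementary_abelian p k))"
  shows "\<exists>r s. retraction_maps
           (decomposition_fixed_points (Delta p k b) ::
              (nat \<times> (nat \<Rightarrow> (complex^'n) set set) \<times> (nat \<Rightarrow> real)) set topology)
           (unreduced_suspension (tits_building p k)) r s"
proof -
  let ?G = "elementary_abelian p k"
  have p: "1 < p" using assms(1) by (rule prime_gt_1_nat)
  interpret character_pairing ?G b "root_pairing p k"
    by (rule character_pairing_elementary_abelian[OF p assms(3)])
  let ?B = "{\<one>\<^bsub>?G\<^esub>}" and ?E = "carrier ?G"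
  define T where "T = proper_nontrivial_subgroups ?G"
  have "(\<lambda>j\<in>{..<k}. if j = 0 then 1 else 0) \<in> ?E"
    using p by (auto simp: elementary_abelian_def carrier_integer_mod_group)
  moreover have "(\<lambda>j\<in>{..<k}. if j = 0 then 1 else 0) \<noteq> \<one>\<^bsub>?G\<^esub>"
    using assms(2) by (auto simp: elementary_abelian_def restrict_def fun_eq_iff)
  ultimately have BE: "?B \<noteq> ?E" by blast
  have S: "subgroups = insert ?B (insert ?E T)"
    using triv_subgroup subgroup_self
    by (auto simp: subgroups_def T_def proper_nontrivial_subgroups_def)
  have T: "finite T" using finite_subgroups S by simp
  have "unreduced_suspension (realization (inclusion_poset T)) homeomorphic_space
      subtopology (powertop_real UNIV) (pole_weights subgroups ?B ?E)"
  proof (rule suspension_homeomorphic_pole_weights[OF S T BE])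
    show "?B \<notin> T" "?E \<notin> T" by (auto simp: T_def proper_nontrivial_subgroups_def)
    show "?B \<subseteq> ?E" by simp
    show "?B \<subseteq> K" "K \<subseteq> ?E" if "K \<in> T" for K
      using that subgroup.one_closed subgroup.subset
      by (fastforce simp: T_def proper_nontrivial_subgroups_def)+
  qed
  moreover have "realization (inclusion_poset T) = tits_building p k"
    by (simp add: tits_building_def tits_poset_def inclusion_poset_def T_def Let_def)
  ultimately obtain f g where fg: "homeomorphic_maps (unreduced_suspension (tits_building p k))
      (subtopology (powertop_real UNIV) (pole_weights subgroups ?B ?E)) f g"
    by (auto simp: homeomorphic_space_def)
  have "decomposition_fixed_points (Delta p k b) = decomposition_fixed_points (rho ` carrier ?G)"
    by (simp add: Delta_def)
  then have "retraction_maps (decomposition_fixed_points (Delta p k b))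
      (subtopology (powertop_real UNIV) (pole_weights subgroups ?B ?E)) retract spread_class"
    using retraction_maps_fixed_points by (simp add: decomposition_fixed_points_eq)
  then have "retraction_maps (decomposition_fixed_points (Delta p k b)) (unreduced_suspension (tits_building p k))
      (g \<circ> retract) (spread_class \<circ> f)"
    using fg unfolding retraction_maps_def homeomorphic_maps_def
    by (auto intro: continuous_map_compose dest: continuous_map_image_subset_topspace simp: image_subset_iff)
  then show ?thesis by blast
qed

end
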